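(* As $x\to\infty$ through even integers, $$\sum_{i=1}^{x/2} g(2i)=\frac{x^2}{4\ln^2 x}+O\!\left(\frac{x^2\ln\ln x}{\ln^3 x}\right).$$
   Context: For an even positive integer $n$, $g(n)$ denotes the number of unordered Goldbach partitions of $n$, i.e. the number of unordered pairs $\{p,q\}$ of primes (with $p=q$ allowed) such that $n=p+q$. *)

theory Defs
  imports "HOL-Computational_Algebra.Primes" "HOL-Library.Landau_Symbols"
begin

definition goldbach_g :: "nat \<Rightarrow> nat" where
  "goldbach_g n = card {(p, q). prime p \<and> prime q \<and> p \<le> q \<and> p + q = n}"

end

theory Submission
  imports Defs "HOL-Complex_Analysis.Complex_Analysis" "HOL-Number_Theory.Prime_Powers"
    "HOL-Probability.Characteristic_Functions" "HOL-Real_Asymp.Real_Asymp"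
begin

text \<open>
  Up to \<open>O(x)\<close> the sum is half the number of ordered pairs of primes with \<open>p + q \<le> x\<close>. Weighting the
  pairs by \<open>ln p ln q\<close> turns the count into a convolution of \<open>\<theta>\<close> with itself, so all that is needed is
  the prime number theorem with remainder, \<open>\<psi>(x) = x + O(x / ln x)\<close>.

  For that, \<open>H(s) = (s - 1)\<zeta>(s)\<close> and its derivatives are bounded by a power of \<open>1 + |t|\<close> with exponent
  slightly above 1 on \<open>Re s \<ge> 1\<close>, and the inequality \<open>3 + 4 cos x + cos 2x \<ge> 0\<close> gives a lower bound for
  \<open>|H|\<close> with exponent slightly below 1. So the Laplace
  transform of \<open>\<psi>(e\<^sup>y)e\<^sup>-\<^sup>y - 1\<close> has two derivatives bounded by the power \<open>-3/4\<close> of \<open>1 + |t|\<close>, uniformly as \<open>Re s\<close> tends to 1.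
  Smoothing with a Gaussian of width \<open>1/T\<close> and integrating by parts twice on the Fourier side bounds the
  smoothed difference at \<open>u\<close> by \<open>O(\<surd>T / u\<^sup>2)\<close>; monotonicity of \<open>\<psi>\<close> removes the smoothing, with \<open>T\<close>
  equal to \<open>u\<close> to the power \<open>3/2\<close>.
\<close>

section \<open>Regularised zeta function near the line \<open>Re s = 1\<close>\<close>


text \<open>The exponents form one budget. With W for 1 + |t|, the quotients H'/H, H''/H, H'''/H are
  O(W^0.08), where 0.08 is 1.01 - 0.93. The second derivative of the transform is a cubic expression
  in them divided by s, hence O(W^(0.24 - 1)), which is rounded to -3/4. That power is not
  integrable, so another W^(-1/2) is taken from the Gaussian at the price of \<open>sqrt T\<close>,
  and -5/4 is integrable. The transform is used only on the lines Re s = 1 + \<delta>, because the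
  damping exp (- \<delta> y) makes the Fourier integrals absolutely convergent. All bounds are
  uniform in \<delta>, and \<delta> tends to 0 only after smoothing. With T = u^(3/2) and shift h =
  1/u in the monotonicity argument, the smoothed error sqrt T / u^2 is u^(-5/4), while the loss
  e^(2h) - 1 and the Gaussian tail (1/(T h))^2 are both of order 1/u. This relative error 1/u, with
  u = ln x, is below the target, since removing the logarithmic weights costs a relative error ln ln
  x / ln x anyway.\<close>

text \<open>This is (s - 1) times the integral of n^(-s) - x^(-s) over [n, n + 1]. For Re s > 1 the
  sum over n >= 1 telescopes to (s - 1) zeta(s) - 1, and it still converges to the left of that
  line.\<close>

definition zeta_term :: "nat \<Rightarrow> complex \<Rightarrow> complex" where
  "zeta_term n s = (s - 1) * of_nat n powr (-s) + of_nat (Suc n) powr (1 - s) - of_nat n powr (1 - s)"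

text \<open>Two mean value estimates in succession. The inner difference n^(-s) - z^(-s) is bounded
  either through its derivative, which gains a power of n but costs |s|, or by the triangle
  inequality, which does neither.\<close>

lemma norm_zeta_term_le:
  assumes n: "n > 0" and s: "Re s > 0"
  shows "norm (zeta_term n s) \<le> norm (s - 1) * (norm s * real n powr (- Re s - 1))"
    and "norm (zeta_term n s) \<le> norm (s - 1) * (2 * real n powr (- Re s))"
proof -
  let ?S = "closed_segment (of_nat n :: complex) (of_nat (Suc n))"
  have seg: "\<exists>r. z = of_real r \<and> real n \<le> r" if "z \<in> ?S" for z
  proof -
    from that obtain u where "0 \<le> u" "u \<le> 1" "z = (1 - u) *\<^sub>R of_nat n + u *\<^sub>R of_nat (Suc n)"
      by (auto simp: in_segment)
    then show ?thesis
      by (intro exI[of _ "real n + u"]) (auto simp: scaleR_conv_of_real algebra_simps)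
  qed
  have 1: "norm (of_nat n powr (-s) - z powr (-s)) \<le> norm s * real n powr (- Re s - 1)"
    if z: "z \<in> ?S" for z
  proof -
    have "norm (of_nat n powr (-s) - z powr (-s)) \<le> norm s * real n powr (- Re s - 1) * norm (of_nat n - z)"
    proof (rule field_differentiable_bound[where S = ?S and f' = "\<lambda>z. (-s) * z powr (-s - 1)"])
      fix w assume "w \<in> ?S"
      from seg[OF this] obtain r where r: "w = of_real r" "real n \<le> r" by auto
      show "((\<lambda>z. z powr (-s)) has_field_derivative (-s) * w powr (-s - 1)) (at w within ?S)"
        using n r by (intro has_field_derivative_powr[THEN has_field_derivative_at_within]) auto
      have "r powr (- Re s - 1) \<le> real n powr (- Re s - 1)"
        using n r s by (intro powr_mono2') auto
      then show "norm ((-s) * w powr (-s - 1)) \<le> norm s * real n powr (- Re s - 1)"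
        using n r by (auto simp: norm_mult norm_powr_real_powr intro!: mult_left_mono)
    qed (use z in auto)
    moreover have "norm (of_nat n - z) \<le> 1"
      using segment_bound(1)[OF z] by (simp add: norm_minus_commute)
    ultimately show ?thesis
      by (metis (no_types, lifting) mult_left_le mult_nonneg_nonneg norm_ge_zero powr_ge_zero order_trans)
  qed
  have 2: "norm (of_nat n powr (-s) - z powr (-s)) \<le> 2 * real n powr (- Re s)"
    if z: "z \<in> ?S" for z
  proof -
    from seg[OF z] obtain r where r: "z = of_real r" "real n \<le> r" by auto
    have "r powr (- Re s) \<le> real n powr (- Re s)"
      using n r s by (intro powr_mono2') auto
    moreover have "norm (of_nat n powr (-s) :: complex) = real n powr (- Re s)"
      using n by (simp add: norm_powr_real_powr)
    moreover have "norm (z powr (-s) :: complex) = r powr (- Re s)"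
      using n r by (simp add: norm_powr_real_powr)
    ultimately show ?thesis using norm_triangle_ineq4[of "of_nat n powr (-s)" "z powr (-s)"] by linarith
  qed
  have alg: "(s - 1) * a + (1 - s) * b = (s - 1) * (a - b)" for a b :: complex
    by (simp add: algebra_simps)
  \<comment> \<open>The term is the increment of \<open>q\<close> over a unit segment, and q'(z) =
    (s - 1)(n^(-s) - z^(-s)); the mean value inequality thus replaces the integral.\<close>
  define q where "q = (\<lambda>z. (s - 1) * z * of_nat n powr (-s) + z powr (1 - s))"
  have q: "zeta_term n s = q (of_nat (Suc n)) - q (of_nat n)"
    by (simp add: zeta_term_def q_def algebra_simps)
  have bd: "norm (zeta_term n s) \<le> norm (s - 1) * B"
    if B: "\<And>z. z \<in> ?S \<Longrightarrow> norm (of_nat n powr (-s) - z powr (-s)) \<le> B" for B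
  proof -
    have "norm (q (of_nat (Suc n)) - q (of_nat n)) \<le> norm (s - 1) * B * norm (of_nat (Suc n) - of_nat n :: complex)"
    proof (rule field_differentiable_bound[where S = ?S and f' = "\<lambda>z. (s - 1) * (of_nat n powr (-s) - z powr (-s))"])
      fix w assume w: "w \<in> ?S"
      from seg[OF this] obtain r where r: "w = of_real r" "real n \<le> r" by auto
      have "(q has_field_derivative (s - 1) * of_nat n powr (-s) + (1 - s) * w powr (1 - s - 1)) (at w)"
        unfolding q_def using n r by (auto intro!: derivative_eq_intros has_field_derivative_powr)
      moreover have "(s - 1) * of_nat n powr (-s) + (1 - s) * w powr (1 - s - 1)
          = (s - 1) * (of_nat n powr (-s) - w powr (-s))"
        using alg[of "of_nat n powr (-s)" "w powr (-s)"] by simp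
      ultimately show "(q has_field_derivative (s - 1) * (of_nat n powr (-s) - w powr (-s))) (at w within ?S)"
        by (metis has_field_derivative_at_within)
      show "norm ((s - 1) * (of_nat n powr (-s) - w powr (-s))) \<le> norm (s - 1) * B"
        using B[OF w] by (auto simp: norm_mult intro: mult_left_mono)
    qed auto
    then show ?thesis by (simp add: q)
  qed
  show "norm (zeta_term n s) \<le> norm (s - 1) * (norm s * real n powr (- Re s - 1))"
    by (rule bd, rule 1)
  show "norm (zeta_term n s) \<le> norm (s - 1) * (2 * real n powr (- Re s))"
    by (rule bd, rule 2)
qed

lemma zeta_term_1: "n > 0 \<Longrightarrow> zeta_term n 1 = 0"
  by (simp add: zeta_term_def del: of_nat_Suc)

text \<open>Geometric mean of the two bounds with weights \<theta> and 1 - \<theta>. A small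
  \<theta> gives just enough decay in n for convergence around Re s = 1 and costs only
  |s|^\<theta>.\<close>

lemma norm_zeta_term_interpolate:
  assumes n: "n > 0" and s: "Re s > 0" and \<theta>: "0 \<le> \<theta>" "\<theta> \<le> 1"
  shows "norm (zeta_term n s) \<le> 2 * norm (s - 1) * norm s powr \<theta> * real n powr (- Re s - \<theta>)"
proof (cases "s = 1")
  case True
  then show ?thesis using n by (simp add: zeta_term_1)
next
  case False
  define x where "x = norm (zeta_term n s) / norm (s - 1)"
  have x0: "x \<ge> 0" by (simp add: x_def)
  have x: "x \<le> norm s * real n powr (- Re s - 1)" "x \<le> 2 * real n powr (- Re s)"
    using norm_zeta_term_le[OF n s] False by (simp_all add: x_def divide_simps mult_ac)
  have "x = x powr \<theta> * x powr (1 - \<theta>)"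
    using x0 by (simp flip: powr_add)
  also have "\<dots> \<le> (norm s * real n powr (- Re s - 1)) powr \<theta> * (2 * real n powr (- Re s)) powr (1 - \<theta>)"
    using x x0 \<theta> by (intro mult_mono powr_mono2) auto
  also have "\<dots> = 2 powr (1 - \<theta>) * norm s powr \<theta> * real n powr ((- Re s - 1) * \<theta> + (- Re s) * (1 - \<theta>))"
    using n unfolding powr_add by (simp add: powr_mult powr_powr)
  also have "(- Re s - 1) * \<theta> + (- Re s) * (1 - \<theta>) = - Re s - \<theta>" by (simp add: algebra_simps)
  also have "2 powr (1 - \<theta>) * norm s powr \<theta> * real n powr (- Re s - \<theta>) \<le> 2 * norm s powr \<theta> * real n powr (- Re s - \<theta>)"
    using powr_mono[of "1 - \<theta>" 1 2] \<theta> by (intro mult_right_mono) auto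
  finally show ?thesis using False by (simp add: x_def divide_simps mult_ac)
qed

text \<open>The function H of the overview, by a series that crosses the line Re s = 1 and requires
  no separate value at s = 1.\<close>

definition zeta_reg :: "complex \<Rightarrow> complex" where
  "zeta_reg s = 1 + (\<Sum>n. zeta_term (Suc n) s)"

lemma zeta_term_holomorphic [holomorphic_intros]: "n > 0 \<Longrightarrow> zeta_term n holomorphic_on S"
  unfolding zeta_term_def [abs_def]
  by (intro holomorphic_intros) auto

lemma summable_Suc_powr: "a > 1 \<Longrightarrow> summable (\<lambda>n. real (Suc n) powr (-a))"
  using summable_real_powr_iff[of "-a"] by (subst summable_Suc_iff) auto

text \<open>Interpolation with \<theta> = 1/100 leaves the exponent -(199/200 + 1/100) = -201/200 of
  n, which is summable; locally uniform convergence follows by the Weierstrass test.\<close>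

lemma zeta_reg_holomorphic: "zeta_reg holomorphic_on {s. Re s > 199 / 200}"
proof -
  have "(\<lambda>s. \<Sum>n. zeta_term (Suc n) s) holomorphic_on {s. Re s > 199 / 200}"
  proof (rule holomorphic_uniform_sequence[where f = "\<lambda>N s. \<Sum>n<N. zeta_term (Suc n) s"])
    show open_R: "open {s. Re s > 199 / 200}" by (rule open_halfspace_Re_gt)
    show "(\<lambda>s. \<Sum>n<N. zeta_term (Suc n) s) holomorphic_on {s. Re s > 199 / 200}" for N
      by (intro holomorphic_intros) auto
    fix s assume "s \<in> {s. Re s > 199 / 200}"
    with open_R obtain d where d: "d > 0" "cball s d \<subseteq> {s. Re s > 199 / 200}"
      using open_contains_cball by blast
    define R where "R = norm s + d"
    have R: "R > 0" unfolding R_def using d by (simp add: add_nonneg_pos)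
    have "uniform_limit (cball s d) (\<lambda>N s. \<Sum>n<N. zeta_term (Suc n) s) (\<lambda>s. \<Sum>n. zeta_term (Suc n) s) sequentially"
    proof (rule Weierstrass_m_test)
      fix n z assume z: "z \<in> cball s d"
      with d have Re: "Re z > 199 / 200" by auto
      have "norm z \<le> R" using z norm_triangle_ineq2[of z s]
        by (simp add: R_def dist_norm norm_minus_commute)
      moreover have "norm (z - 1) \<le> R + 1"
        using norm_triangle_ineq4[of z 1] \<open>norm z \<le> R\<close> by simp
      ultimately have "2 * norm (z - 1) * norm z powr (1/100) * real (Suc n) powr (- Re z - 1/100)
        \<le> 2 * (R + 1) * R powr (1/100) * real (Suc n) powr (- (201/200))"
        using Re R by (intro mult_mono powr_mono2 powr_mono) auto
      then show "norm (zeta_term (Suc n) z) \<le> 2 * (R + 1) * R powr (1/100) * real (Suc n) powr (- (201/200))"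
        using norm_zeta_term_interpolate[of "Suc n" z "1/100"] Re by simp
    next
      show "summable (\<lambda>n. 2 * (R + 1) * R powr (1/100) * real (Suc n) powr (- (201/200)))"
        by (intro summable_mult summable_Suc_powr) auto
    qed
    with d show "\<exists>d>0. cball s d \<subseteq> {s. Re s > 199 / 200} \<and>
        uniform_limit (cball s d) (\<lambda>N s. \<Sum>n<N. zeta_term (Suc n) s) (\<lambda>s. \<Sum>n. zeta_term (Suc n) s) sequentially"
      by blast
  qed
  then show ?thesis unfolding zeta_reg_def [abs_def] by (intro holomorphic_intros)
qed

text \<open>The exponent 101/100 is 1 from the factor |s - 1| and 1/100 from the
  interpolation.\<close>

lemma zeta_reg_bound:
  obtains C where "C > 0"
    "\<And>s. 199 / 200 < Re s \<Longrightarrow> Re s \<le> 4 \<Longrightarrow> norm (zeta_reg s) \<le> C * (1 + \<bar>Im s\<bar>) powr (101/100)"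
proof -
  define S where "S = (\<Sum>n. real (Suc n) powr (- (201/200)))"
  have sm: "summable (\<lambda>n. real (Suc n) powr (- (201/200)))" by (rule summable_Suc_powr) auto
  have S0: "S \<ge> 0" unfolding S_def by (intro suminf_nonneg sm) auto
  have "norm (zeta_reg s) \<le> (1 + 32 * S) * (1 + \<bar>Im s\<bar>) powr (101/100)"
    if s: "199 / 200 < Re s" "Re s \<le> 4" for s
  proof -
    define W where "W = 1 + \<bar>Im s\<bar>"
    have W: "W \<ge> 1" by (simp add: W_def)
    have ns: "norm s \<le> 4 * W" "norm (s - 1) \<le> 4 * W"
      using cmod_le[of s] cmod_le[of "s - 1"] s by (auto simp: W_def)
    have *: "norm (zeta_term (Suc n) s) \<le> 32 * W powr (101/100) * real (Suc n) powr (- (201/200))" for n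
    proof -
      have "2 * norm (s - 1) * norm s powr (1/100) * real (Suc n) powr (- Re s - 1/100)
          \<le> 2 * (4 * W) * (4 * W) powr (1/100) * real (Suc n) powr (- (201/200))"
        using s W ns by (intro mult_mono powr_mono2 powr_mono) auto
      also have "(4 * W) powr (1/100) = 4 powr (1/100) * W powr (1/100)"
        using W by (simp add: powr_mult)
      also have "2 * (4 * W) * (4 powr (1/100) * W powr (1/100)) = 8 * 4 powr (1/100) * (W powr 1 * W powr (1/100))"
        using W powr_one[of W] by simp
      also have "W powr 1 * W powr (1/100) = W powr (101/100)" by (subst powr_add[symmetric]) simp
      also have "8 * 4 powr (1/100) * W powr (101/100) * real (Suc n) powr (- (201/200)) \<le> 32 * W powr (101/100) * real (Suc n) powr (- (201/200))"
        using powr_mono[of "1/100" 1 "4::real"] by (intro mult_right_mono) auto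
      finally show ?thesis
        using order_trans[OF norm_zeta_term_interpolate[of "Suc n" s "1/100"]] s by simp
    qed
    have "norm (\<Sum>n. zeta_term (Suc n) s) \<le> (\<Sum>n. 32 * W powr (101/100) * real (Suc n) powr (- (201/200)))"
      by (rule norm_suminf_le[OF *]) (intro summable_mult sm)
    also have "\<dots> = 32 * W powr (101/100) * S" unfolding S_def by (rule suminf_mult[OF sm])
    finally have "norm (\<Sum>n. zeta_term (Suc n) s) \<le> 32 * W powr (101/100) * S" .
    moreover have "1 \<le> W powr (101/100)" using W by (intro ge_one_powr_ge_zero) auto
    ultimately have "norm (zeta_reg s) \<le> W powr (101/100) + 32 * W powr (101/100) * S"
      unfolding zeta_reg_def using norm_triangle_ineq[of 1 "\<Sum>n. zeta_term (Suc n) s"] by simp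
    then show ?thesis by (simp add: W_def algebra_simps)
  qed
  then show ?thesis using that[of "1 + 32 * S"] S0 by simp
qed

lemma zeta_reg_1 [simp]: "zeta_reg 1 = 1"
proof -
  show ?thesis by (simp add: zeta_reg_def zeta_term_1)
qed

text \<open>Cauchy's inequality on circles of the fixed radius 1/400, which stay inside Re s >
  199/200; hence every derivative grows no faster than the function itself.\<close>

lemma zeta_reg_deriv_bound:
  obtains C where "C > 0"
    "\<And>s. 1 \<le> Re s \<Longrightarrow> Re s \<le> 3 \<Longrightarrow> norm ((deriv ^^ k) zeta_reg s) \<le> C * (1 + \<bar>Im s\<bar>) powr (101/100)"
proof -
  obtain C where C: "C > 0"
    "\<And>s. 199 / 200 < Re s \<Longrightarrow> Re s \<le> 4 \<Longrightarrow> norm (zeta_reg s) \<le> C * (1 + \<bar>Im s\<bar>) powr (101/100)"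
    by (rule zeta_reg_bound) blast
  define r :: real where "r = 1/400"
  have "norm ((deriv ^^ k) zeta_reg s) \<le> fact k * (C * 4) / r ^ k * (1 + \<bar>Im s\<bar>) powr (101/100)"
    if s: "1 \<le> Re s" "Re s \<le> 3" for s
  proof -
    have cb: "199/200 < Re z \<and> Re z \<le> 4 \<and> \<bar>Im z\<bar> \<le> 1 + \<bar>Im s\<bar>" if "dist s z \<le> r" for z
      using that abs_Re_le_cmod[of "s - z"] abs_Im_le_cmod[of "s - z"] s by (auto simp: dist_norm r_def)
    have "norm ((deriv ^^ k) zeta_reg s) \<le> fact k * (C * (2 * (1 + \<bar>Im s\<bar>)) powr (101/100)) / r ^ k"
    proof (rule Cauchy_inequality)
      have sub: "cball s r \<subseteq> {s. 199 / 200 < Re s}" using cb by auto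
      then show "zeta_reg holomorphic_on ball s r"
        using zeta_reg_holomorphic by (meson ball_subset_cball holomorphic_on_subset order_trans)
      show "continuous_on (cball s r) zeta_reg"
        using zeta_reg_holomorphic sub holomorphic_on_imp_continuous_on holomorphic_on_subset by blast
      fix z assume "norm (s - z) = r"
      with cb[of z] have z: "199/200 < Re z" "Re z \<le> 4" "\<bar>Im z\<bar> \<le> 1 + \<bar>Im s\<bar>" by (auto simp: dist_norm)
      have "norm (zeta_reg z) \<le> C * (1 + \<bar>Im z\<bar>) powr (101/100)" using C z by auto
      also have "\<dots> \<le> C * (2 * (1 + \<bar>Im s\<bar>)) powr (101/100)"
        using z C by (intro mult_left_mono powr_mono2) auto
      finally show "norm (zeta_reg z) \<le> C * (2 * (1 + \<bar>Im s\<bar>)) powr (101/100)" .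
    qed (auto simp: r_def)
    also have "(2 * (1 + \<bar>Im s\<bar>)) powr (101/100) = 2 powr (101/100) * (1 + \<bar>Im s\<bar>) powr (101/100)"
      by (subst powr_mult) auto
    also have "fact k * (C * (2 powr (101/100) * (1 + \<bar>Im s\<bar>) powr (101/100))) / r ^ k
      \<le> fact k * (C * (4 * (1 + \<bar>Im s\<bar>) powr (101/100))) / r ^ k"
      using powr_mono[of "101/100" 2 "2::real"] C by (intro divide_right_mono mult_left_mono mult_right_mono) (auto simp: r_def)
    finally show ?thesis by (simp add: mult_ac)
  qed
  moreover have "fact k * (C * 4) / r ^ k > 0" using C by (simp add: r_def)
  ultimately show ?thesis using that by blast
qed


section \<open>Dirichlet series of zeta and of the von Mangoldt function for Re s > 1\<close>

lemma norm_nat_powr: "norm (of_nat n powr s :: complex) = real n powr Re s"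
  by (cases "n = 0") (auto simp: norm_powr_real_powr)

lemma ln_nat_le_powr: "0 < e \<Longrightarrow> ln (real n) \<le> real n powr e / e"
  by (cases "n = 0") (auto intro: ln_powr_bound)

lemma summable_powr_nat: "a > 1 \<Longrightarrow> summable (\<lambda>n. real n powr (-a))"
  by (simp add: summable_real_powr_iff)

lemma summable_ln_powr: 
  assumes "a > 1" shows "summable (\<lambda>n. ln (real n) * real n powr (-a))"
proof (rule summable_comparison_test')
  define e where "e = (a - 1) / 2"
  have e: "e > 0" "a - e > 1" using assms by (auto simp: e_def field_simps)
  show "summable (\<lambda>n. real n powr (-(a - e)) / e)"
    by (intro summable_divide summable_powr_nat e)
  show "norm (ln (real n) * real n powr (-a)) \<le> real n powr (-(a - e)) / e" for n
  proof (cases "n = 0")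
    case False
    then have "ln (real n) * real n powr (-a) \<le> real n powr e / e * real n powr (-a)"
      by (intro mult_right_mono ln_nat_le_powr e) auto
    also have "\<dots> = real n powr (-(a - e)) / e" by (simp add: powr_diff powr_minus field_simps)
    finally show ?thesis using False by (simp add: abs_mult)
  qed auto
qed

lemma mangoldt_le_ln: "(mangoldt n :: real) \<le> ln (real n)"
  by (cases "n = 0") (auto intro: mangoldt_le)

text \<open>The index 0 is harmless because \<open>0 powr z = 0\<close>, so this is the usual series
  from 1.\<close>

definition zeta_sum :: "complex \<Rightarrow> complex" where
  "zeta_sum s = (\<Sum>n. of_nat n powr (-s))"

definition mangoldt_series :: "complex \<Rightarrow> complex" where
  "mangoldt_series s = (\<Sum>n. mangoldt n * of_nat n powr (-s))"

lemma abs_summable_zeta: "Re s > 1 \<Longrightarrow> summable (\<lambda>n. norm (of_nat n powr (-s) :: complex))"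
  by (simp add: norm_nat_powr summable_real_powr_iff)

lemma abs_summable_mangoldt:
  assumes "Re s > 1" shows "summable (\<lambda>n. norm (mangoldt n * of_nat n powr (-s) :: complex))"
proof (rule summable_comparison_test')
  show "summable (\<lambda>n. ln (real n) * real n powr (-Re s))" by (rule summable_ln_powr[OF assms])
  show "norm (norm (mangoldt n * of_nat n powr (-s) :: complex)) \<le> ln (real n) * real n powr (-Re s)" for n
    by (simp add: norm_mult norm_nat_powr abs_mult mult_right_mono mangoldt_le_ln)
qed

text \<open>The powers n^(1 - s) telescope in the partial sums, and the boundary term (N + 1)^(1 -
  s) tends to 0 for Re s > 1.\<close>

lemma zeta_reg_eq:
  assumes s: "Re s > 1"
  shows "zeta_reg s = (s - 1) * zeta_sum s"
proof -
  have sm: "summable (\<lambda>n. of_nat n powr (-s) :: complex)"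
    by (rule summable_norm_cancel[OF abs_summable_zeta[OF s]])
  have part: "(\<Sum>n<N. zeta_term (Suc n) s) = (s - 1) * (\<Sum>n<Suc N. of_nat n powr (-s)) + of_nat (Suc N) powr (1 - s) - 1" for N
    by (induction N) (simp_all add: zeta_term_def algebra_simps del: of_nat_Suc, simp)
  have "(\<lambda>N. norm (of_nat (Suc N) powr (1 - s) :: complex)) \<longlonglongrightarrow> 0"
  proof -
    have "(\<lambda>n. real n powr (1 - Re s)) \<longlonglongrightarrow> 0" using s
      by (intro tendsto_neg_powr filterlim_real_sequentially) auto
    then have "(\<lambda>n. real (Suc n) powr (1 - Re s)) \<longlonglongrightarrow> 0" by (rule LIMSEQ_Suc)
    then show ?thesis by (simp add: norm_nat_powr del: of_nat_Suc)
  qed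
  then have 1: "(\<lambda>N. of_nat (Suc N) powr (1 - s) :: complex) \<longlonglongrightarrow> 0" by (rule tendsto_norm_zero_cancel)
  have "(\<lambda>N. \<Sum>n<N. of_nat n powr (-s)) \<longlonglongrightarrow> zeta_sum s"
    unfolding zeta_sum_def by (rule summable_LIMSEQ[OF sm])
  then have 2: "(\<lambda>N. \<Sum>n<Suc N. of_nat n powr (-s)) \<longlonglongrightarrow> zeta_sum s"
    by (rule LIMSEQ_Suc)
  have "(\<lambda>N. \<Sum>n<N. zeta_term (Suc n) s) \<longlonglongrightarrow> (s - 1) * zeta_sum s + 0 - 1"
    unfolding part by (intro tendsto_intros 1 2)
  then have "(\<lambda>n. zeta_term (Suc n) s) sums ((s - 1) * zeta_sum s - 1)" by (simp add: sums_def)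
  then show ?thesis unfolding zeta_reg_def by (simp add: sums_unique[symmetric])
qed

lemma zeta_sum_deriv:
  assumes s: "Re s > 1"
  shows "(zeta_sum has_field_derivative (\<Sum>n. - (of_real (ln (real n)) * of_nat n powr (-s)))) (at s)"
proof -
  define a where "a = (1 + Re s) / 2"
  have a: "a > 1" "Re s > a" using s by (auto simp: a_def)
  let ?S = "{z. Re z > a}"
  have "((\<lambda>s. \<Sum>n. of_nat n powr (-s)) has_field_derivative (\<Sum>n. - (of_real (ln (real n)) * of_nat n powr (-s)))) (at s)"
  proof (rule has_field_derivative_series'(2)[of ?S])
    show "convex ?S" by (rule convex_halfspace_Re_gt)
    show "((\<lambda>s. of_nat n powr (-s)) has_field_derivative - (of_real (ln (real n)) * of_nat n powr (-z))) (at z within ?S)" for n z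
    proof (cases "n = 0")
      case False
      have "((\<lambda>s. of_nat n powr (-s)) has_field_derivative (Ln (of_nat n) * of_nat n powr (-z) * (-1))) (at z)"
        using False by (auto intro!: derivative_eq_intros simp: powr_def)
      moreover have "Ln (of_nat n) = of_real (ln (real n))" using False
        by (metis Ln_of_real of_nat_0_less_iff of_real_of_nat_eq gr0I)
      ultimately show ?thesis by (auto intro: has_field_derivative_at_within)
    qed auto
    show "uniformly_convergent_on ?S (\<lambda>n z. \<Sum>i<n. - (of_real (ln (real i)) * of_nat i powr (-z)))"
    proof (rule Weierstrass_m_test')
      show "summable (\<lambda>n. ln (real n) * real n powr (-a))" by (rule summable_ln_powr[OF a(1)])
      show "norm (- (of_real (ln (real n)) * of_nat n powr (-z))) \<le> ln (real n) * real n powr (-a)" if "z \<in> ?S" for n z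
      proof (cases "n = 0")
        case False
        then show ?thesis using that
          by (auto simp: norm_mult norm_nat_powr abs_mult intro!: mult_left_mono powr_mono)
      qed auto
    qed
    show "s \<in> ?S" "s \<in> interior ?S"
      using a interior_open[OF open_halfspace_Re_gt[of a]] by auto
    show "summable (\<lambda>n. of_nat n powr (-s) :: complex)"
      by (rule summable_norm_cancel[OF abs_summable_zeta[OF s]])
  qed
  then show ?thesis by (simp add: zeta_sum_def [abs_def])
qed

text \<open>The divisor sum of the von Mangoldt function is ln, so the absolutely convergent double
  series is regrouped by the product k = d m.\<close>

lemma mangoldt_times_zeta:
  assumes s: "Re s > 1"
  shows "mangoldt_series s * zeta_sum s = (\<Sum>n. of_real (ln (real n)) * of_nat n powr (-s))"
proof -
  define f where "f = (\<lambda>(d::nat, m::nat). (mangoldt d * of_nat d powr (-s)) * (of_nat m powr (-s) :: complex))"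
  have Lsum: "((\<lambda>n. mangoldt n * of_nat n powr (-s)) has_sum mangoldt_series s) UNIV"
    unfolding mangoldt_series_def
    by (intro norm_summable_imp_has_sum abs_summable_mangoldt s summable_sums summable_norm_cancel[OF abs_summable_mangoldt])
  have Zsum: "((\<lambda>n. of_nat n powr (-s)) has_sum zeta_sum s) UNIV"
    unfolding zeta_sum_def
    by (intro norm_summable_imp_has_sum abs_summable_zeta s summable_sums summable_norm_cancel[OF abs_summable_zeta])
  have aL: "(\<lambda>n. norm (mangoldt n * of_nat n powr (-s) :: complex)) summable_on UNIV"
    using norm_summable_imp_summable_on[of "\<lambda>n. norm (mangoldt n * of_nat n powr (-s) :: complex)"] abs_summable_mangoldt[OF s] by simp
  have aZ: "(\<lambda>n. norm (of_nat n powr (-s) :: complex)) summable_on UNIV"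
    using norm_summable_imp_summable_on[of "\<lambda>n. norm (of_nat n powr (-s) :: complex)"] abs_summable_zeta[OF s] by simp
  have "(\<lambda>p. norm (f p)) summable_on (UNIV \<times> UNIV)"
  proof (subst Infinite_Sum.abs_summable_on_Sigma_iff, intro conjI ballI)
    fix d :: nat
    show "(\<lambda>m. norm (f (d, m))) summable_on UNIV"
      unfolding f_def prod.case norm_mult by (intro summable_on_cmult_right) (use aZ in \<open>simp add: norm_mult\<close>)
    next
    have "(\<Sum>\<^sub>\<infinity>m. norm (f (d, m))) = norm (mangoldt d * of_nat d powr (-s) :: complex) * (\<Sum>\<^sub>\<infinity>m. norm (of_nat m powr (-s) :: complex))" for d
      unfolding f_def prod.case norm_mult[of "mangoldt d * of_nat d powr (-s)"] by (rule infsum_cmult_right') 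
    then show "(\<lambda>d. norm (\<Sum>\<^sub>\<infinity>m. norm (f (d, m)))) summable_on UNIV"
      using aL by (auto simp: abs_mult infsum_nonneg intro!: summable_on_cmult_left)
  qed
  then have "f summable_on (UNIV \<times> UNIV)" by (rule Infinite_Sum.abs_summable_summable)
  then obtain S where S: "(f has_sum S) (UNIV \<times> UNIV)" by (auto simp: summable_on_def)
  have "((\<lambda>d. mangoldt d * of_nat d powr (-s) * zeta_sum s) has_sum S) UNIV"
    by (rule has_sum_SigmaD[OF S]) (auto simp: f_def intro!: has_sum_cmult_right Zsum)
  moreover have "((\<lambda>d. mangoldt d * of_nat d powr (-s) * zeta_sum s) has_sum (mangoldt_series s * zeta_sum s)) UNIV"
    by (intro has_sum_cmult_left Lsum)
  ultimately have SE: "S = mangoldt_series s * zeta_sum s" by (rule has_sum_unique)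
  \<comment> \<open>Pairs with a zero entry contribute nothing; once they are removed, (d, m) -> (d
    m, d) is a bijection onto pairs of a positive number and one of its divisors.\<close>
  have "(f has_sum S) ({0<..} \<times> {0<..})"
    by (rule has_sum_cong_neutral[THEN iffD1, OF _ _ _ S]) (auto simp: f_def)
  moreover define g where "g = (\<lambda>(k::nat, d::nat). f (d, k div d))"
  have "(f has_sum S) ({0<..} \<times> {0<..}) \<longleftrightarrow> (g has_sum S) (SIGMA k:{0<..}. {d. d dvd k})"
    by (rule has_sum_reindex_bij_witness[of _ "\<lambda>(k, d). (d, k div d)" "\<lambda>(d, m). (d * m, d)"])
       (auto simp: g_def dvd_div_eq_0_iff intro!: Nat.gr0I)
  ultimately have "(g has_sum S) (SIGMA k:{0<..}. {d. d dvd k})" by simp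
  then have "((\<lambda>k. of_real (ln (real k)) * of_nat k powr (-s)) has_sum S) {0<..}"
  proof (rule has_sum_SigmaD)
    fix k :: nat assume k: "k \<in> {0<..}"
    have "((\<lambda>d. g (k, d)) has_sum (\<Sum>d | d dvd k. g (k, d))) {d. d dvd k}"
      using k by (intro has_sum_finite) auto
    also have "(\<Sum>d | d dvd k. g (k, d)) = (\<Sum>d | d dvd k. mangoldt d * of_nat k powr (-s))"
    proof (intro sum.cong refl)
      fix d assume "d \<in> {d. d dvd k}"
      then obtain m where m: "k = d * m" by auto
      with k have "d > 0" "m > 0" by auto
      then show "g (k, d) = mangoldt d * of_nat k powr (-s)"
        by (simp add: g_def f_def m powr_times_real)
    qed
    also have "\<dots> = of_real (ln (real k)) * of_nat k powr (-s)"
      using k by (simp flip: sum_distrib_right add: mangoldt_sum)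
    finally show "((\<lambda>d. g (k, d)) has_sum (of_real (ln (real k)) * of_nat k powr (-s))) {d. d dvd k}" .
  qed
  then have "((\<lambda>k. of_real (ln (real k)) * of_nat k powr (-s)) has_sum S) UNIV"
    by (rule has_sum_cong_neutral[THEN iffD1, rotated 3]) auto
  then have "(\<lambda>k. of_real (ln (real k)) * of_nat k powr (-s)) sums S" by (rule has_sum_imp_sums)
  then show ?thesis by (simp add: SE sums_unique[symmetric])
qed

text \<open>The logarithmic derivative of zeta in product form, which presupposes nothing about
  zeros.\<close>

lemma zeta_sum_deriv':
  assumes s: "Re s > 1"
  shows "(zeta_sum has_field_derivative (- mangoldt_series s * zeta_sum s)) (at s)"
proof -
  have "(\<Sum>n. - (of_real (ln (real n)) * of_nat n powr (-s))) = - (\<Sum>n. of_real (ln (real n)) * of_nat n powr (-s) :: complex)"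
  proof (rule suminf_minus, rule summable_comparison_test')
    show "summable (\<lambda>n. ln (real n) * real n powr (-Re s))" by (rule summable_ln_powr[OF s])
    show "norm (of_real (ln (real n)) * of_nat n powr (-s) :: complex) \<le> ln (real n) * real n powr (-Re s)" for n
      by (cases "n = 0") (auto simp: norm_mult norm_nat_powr)
  qed
  with zeta_sum_deriv[OF s] mangoldt_times_zeta[OF s] show ?thesis by simp
qed

section \<open>Lower bound for zeta on the line \<open>Re s = 1\<close>\<close>


text \<open>With c = cos (t ln n), the n-th term carries the factor 3 + 4 c + (2 c^2 - 1) = 2 (1 +
  c)^2 next to nonnegative weights.\<close>

lemma three_four_one_nonneg:
  assumes s: "\<sigma> > 1"
  shows "Re (3 * mangoldt_series (of_real \<sigma>) + 4 * mangoldt_series (Complex \<sigma> t) + mangoldt_series (Complex \<sigma> (2 * t))) \<ge> 0"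
proof -
  have Re_term: "Re (mangoldt n * of_nat n powr (- Complex \<sigma> u)) = mangoldt n * (real n powr (-\<sigma>) * cos (u * ln (real n)))" for n u
  proof (cases "n = 0")
    case False
    then have "of_nat n powr (- Complex \<sigma> u) = exp (- Complex \<sigma> u * of_real (ln (real n)))"
      by (simp add: powr_def Ln_of_nat)
    moreover have "Re (mangoldt n * z) = mangoldt n * Re z" for z
      by (simp add: mangoldt_def)
    ultimately show ?thesis using False
      by (simp add: Re_exp powr_def)
  qed auto
  have sms: "(\<lambda>n. Re (mangoldt n * of_nat n powr (- Complex \<sigma> u))) sums Re (mangoldt_series (Complex \<sigma> u))" for u
    unfolding mangoldt_series_def
    by (intro sums_Re summable_sums summable_norm_cancel[OF abs_summable_mangoldt]) (use s in auto)
  have "(\<lambda>n. 3 * Re (mangoldt n * of_nat n powr (- Complex \<sigma> 0)) + 4 * Re (mangoldt n * of_nat n powr (- Complex \<sigma> t)) + Re (mangoldt n * of_nat n powr (- Complex \<sigma> (2 * t))))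
      sums (3 * Re (mangoldt_series (Complex \<sigma> 0)) + 4 * Re (mangoldt_series (Complex \<sigma> t)) + Re (mangoldt_series (Complex \<sigma> (2 * t))))"
    by (intro sums_add sums_mult sms)
  with _ sums_zero have "0 \<le> 3 * Re (mangoldt_series (Complex \<sigma> 0)) + 4 * Re (mangoldt_series (Complex \<sigma> t)) + Re (mangoldt_series (Complex \<sigma> (2 * t)))"
  proof (rule sums_le)
    fix n
    let ?c = "cos (t * ln (real n))"
    have cos2: "cos (2 * t * ln (real n)) = 2 * ?c\<^sup>2 - 1"
      using cos_double_cos[of "t * ln (real n)"] by (simp add: mult.assoc)
    then have "3 * Re (mangoldt n * of_nat n powr (- Complex \<sigma> 0)) + 4 * Re (mangoldt n * of_nat n powr (- Complex \<sigma> t)) + Re (mangoldt n * of_nat n powr (- Complex \<sigma> (2 * t)))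
      = mangoldt n * real n powr (-\<sigma>) * (2 * (1 + ?c)\<^sup>2)"
      by (simp only: Re_term cos2) (simp add: power2_eq_square algebra_simps)
    also have "\<dots> \<ge> 0" by (intro mult_nonneg_nonneg mangoldt_nonneg) auto
    finally show "0 \<le> 3 * Re (mangoldt n * of_nat n powr (- Complex \<sigma> 0)) + 4 * Re (mangoldt n * of_nat n powr (- Complex \<sigma> t)) + Re (mangoldt n * of_nat n powr (- Complex \<sigma> (2 * t)))" .
  qed
  then show ?thesis by (simp add: complex_of_real_def)
qed

text \<open>The term n = 1 is the limit; for n >= 2 and x >= 2 the rest is dominated by 2^(2 - x)
  n^(-2). This normalises the monotone product in \<open>three_four_one\<close> at infinity.\<close>

lemma zeta_sum_tendsto_1: "((\<lambda>x. zeta_sum (Complex x t)) \<longlongrightarrow> 1) at_top"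
proof -
  define S where "S = (\<Sum>n. real (n + 2) powr (-2))"
  have sm: "summable (\<lambda>n. real (n + 2) powr (-2))"
    by (rule summable_ignore_initial_segment) (simp add: summable_powr_nat)
  have bd: "norm (zeta_sum (Complex x t) - 1) \<le> 2 powr (2 - x) * S" if x: "x \<ge> 2" for x
  proof -
    have smz: "summable (\<lambda>n. norm (of_nat n powr (- Complex x t) :: complex))"
      by (rule abs_summable_zeta) (use x in auto)
    have "zeta_sum (Complex x t) = (\<Sum>n. of_nat (n + 2) powr (- Complex x t)) + (\<Sum>n<2. of_nat n powr (- Complex x t))"
      unfolding zeta_sum_def by (rule suminf_split_initial_segment[OF summable_norm_cancel[OF smz]])
    then have "zeta_sum (Complex x t) - 1 = (\<Sum>n. of_nat (n + 2) powr (- Complex x t))"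
      by (simp add: eval_nat_numeral)
    also have "norm \<dots> \<le> (\<Sum>n. 2 powr (2 - x) * real (n + 2) powr (-2))"
    proof (rule norm_suminf_le)
      fix n
      have "real (n + 2) powr (-x) = real (n + 2) powr (2 - x) * real (n + 2) powr (-2)"
        by (simp flip: powr_add)
      also have "\<dots> \<le> 2 powr (2 - x) * real (n + 2) powr (-2)"
        using x by (intro mult_right_mono powr_mono2') auto
      finally show "norm (of_nat (n + 2) powr (- Complex x t) :: complex) \<le> 2 powr (2 - x) * real (n + 2) powr (-2)"
        unfolding norm_nat_powr by simp
    qed (intro summable_mult sm)
    also have "\<dots> = 2 powr (2 - x) * S" unfolding S_def by (rule suminf_mult[OF sm])
    finally show ?thesis .
  qed
  have "((\<lambda>x. 2 powr (2 - x) * S) \<longlongrightarrow> 0) at_top" by real_asymp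
  with _ have "((\<lambda>x. zeta_sum (Complex x t) - 1) \<longlongrightarrow> 0) at_top"
    by (rule Lim_null_comparison) (use bd in \<open>auto intro!: eventually_mono[OF eventually_ge_at_top[of 2]]\<close>)
  then show ?thesis by (simp add: LIM_zero_iff)
qed

text \<open>The modulus of the product below is nonincreasing in \<open>\<sigma>\<close>, because its logarithmic derivative
  has nonpositive real part, and it tends to 1; no Euler product is needed.\<close>

lemma three_four_one:
  assumes s: "\<sigma> > 1"
  shows "norm (zeta_sum (of_real \<sigma>)) ^ 3 * norm (zeta_sum (Complex \<sigma> t)) ^ 4 * norm (zeta_sum (Complex \<sigma> (2 * t))) \<ge> 1"
proof -
  let ?a = "\<i> * of_real t" and ?b = "\<i> * of_real (2 * t)"
  define Q where "Q = (\<lambda>z. zeta_sum z ^ 3 * zeta_sum (z + ?a) ^ 4 * zeta_sum (z + ?b))"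
  define M where "M = (\<lambda>z. 3 * mangoldt_series z + 4 * mangoldt_series (z + ?a) + mangoldt_series (z + ?b))"
  have cx: "of_real x + ?a = Complex x t" "of_real x + ?b = Complex x (2 * t)" for x
    by (auto simp: complex_eq_iff)
  have Qd: "(Q has_field_derivative (- M z * Q z)) (at z)" if z: "Re z > 1" for z
  proof -
    have 1: "((\<lambda>z. zeta_sum (z + c)) has_field_derivative (- mangoldt_series (z + c) * zeta_sum (z + c))) (at z)" if "Re c = 0" for c
    proof -
      have "Re (z + c) > 1" using z that by simp
      from zeta_sum_deriv'[OF this] show ?thesis by (simp add: DERIV_shift)
    qed
    have 2: "(zeta_sum has_field_derivative (- mangoldt_series z * zeta_sum z)) (at z)" using zeta_sum_deriv'[OF z] .
    \<comment> \<open>The left side reproduces literally the derivative that the product and power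
      rules deliver, including \<open>3 - Suc 0\<close>, so that it can be rewritten in
      place.\<close>
    have alg: "(of_nat 3 * ((- l0 * z0) * z0 ^ (3 - Suc 0)) * z1 ^ 4 + of_nat 4 * ((- l1 * z1) * z1 ^ (4 - Suc 0)) * z0 ^ 3) * z2
        + (- l2 * z2) * (z0 ^ 3 * z1 ^ 4) = - (3 * l0 + 4 * l1 + l2) * (z0 ^ 3 * z1 ^ 4 * z2)" for z0 z1 z2 l0 l1 l2 :: complex
      by (simp add: eval_nat_numeral algebra_simps)
    have 1: "((\<lambda>z. zeta_sum (z + ?a)) has_field_derivative (- mangoldt_series (z + ?a) * zeta_sum (z + ?a))) (at z)"
      "((\<lambda>z. zeta_sum (z + ?b)) has_field_derivative (- mangoldt_series (z + ?b) * zeta_sum (z + ?b))) (at z)"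
      by (rule 1, simp)+
    note d = DERIV_mult[OF DERIV_mult[OF DERIV_power[OF 2, of 3] DERIV_power[OF 1(1), of 4]] 1(2)]
    from d show ?thesis unfolding alg by (simp only: Q_def M_def)
  qed
  \<comment> \<open>The squared modulus is differentiable even where \<open>Q\<close> might vanish,
    and N' = -2 Re(M) N avoids taking a logarithm of \<open>Q\<close>.\<close>
  define N where "N = (\<lambda>x::real. (Re (Q (of_real x)))\<^sup>2 + (Im (Q (of_real x)))\<^sup>2)"
  have N_norm: "N x = (norm (Q (of_real x)))\<^sup>2" for x by (simp add: N_def cmod_power2)
  have Nd: "(N has_real_derivative - 2 * Re (M (of_real x)) * N x) (at x)" if x: "x > 1" for x
  proof -
    have v: "((\<lambda>x. Q (of_real x)) has_vector_derivative (- M (of_real x) * Q (of_real x))) (at x)"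
      by (rule has_vector_derivative_real_field[OF Qd]) (use x in auto)
    show ?thesis unfolding N_def
      by (rule derivative_eq_intros has_field_derivative_Re[OF v] has_field_derivative_Im[OF v] refl)+
         (simp add: power2_eq_square algebra_simps)
  qed
  have dec: "N b \<le> N \<sigma>" if "b \<ge> \<sigma>" for b
  proof (rule DERIV_nonpos_imp_nonincreasing[OF that])
    fix x assume "\<sigma> \<le> x" "x \<le> b"
    with s have x: "x > 1" by auto
    have "Re (M (of_real x)) \<ge> 0" unfolding M_def cx by (rule three_four_one_nonneg[OF x])
    then have "- 2 * Re (M (of_real x)) * N x \<le> 0" by (simp add: N_def)
    with Nd[OF x] show "\<exists>y. (N has_real_derivative y) (at x) \<and> y \<le> 0" by blast
  qed
  have "((\<lambda>x. norm (Q (of_real x)) ^ 2) \<longlongrightarrow> norm (1 ^ 3 * 1 ^ 4 * 1 :: complex) ^ 2) at_top"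
    unfolding Q_def cx using zeta_sum_tendsto_1[of 0]
    by (intro tendsto_intros zeta_sum_tendsto_1) (simp add: complex_of_real_def)
  then have "(N \<longlongrightarrow> 1) at_top" by (simp add: N_norm [abs_def])
  then have "1 \<le> N \<sigma>"
    by (rule tendsto_upperbound) (use dec in \<open>auto intro: eventually_mono[OF eventually_ge_at_top[of \<sigma>]]\<close>)
  then have "1 \<le> (norm (Q (of_real \<sigma>)))\<^sup>2" by (simp add: N_norm)
  then have "1 \<le> norm (Q (of_real \<sigma>))" by (simp add: power2_eq_square) (metis abs_le_square_iff abs_norm_cancel abs_one one_power2 power2_eq_square)
  then show ?thesis unfolding Q_def cx norm_mult norm_power .
qed

text \<open>\<open>three_four_one\<close> multiplied by the factors |z - 1| that turn zeta into H,
  each bounded below by its imaginary part off the real axis.\<close>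

lemma zeta_reg_three_four_one:
  assumes s: "\<sigma> > 1"
  shows "(\<sigma> - 1) ^ 3 * \<bar>t\<bar> ^ 4 * \<bar>2 * t\<bar> \<le>
    norm (zeta_reg (of_real \<sigma>)) ^ 3 * norm (zeta_reg (Complex \<sigma> t)) ^ 4 * norm (zeta_reg (Complex \<sigma> (2 * t)))"
proof -
  have n: "norm (zeta_reg z) = norm (z - 1) * norm (zeta_sum z)" if "Re z > 1" for z
    using zeta_reg_eq[OF that] by (simp add: norm_mult)
  let ?Z = "norm (zeta_sum (of_real \<sigma>)) ^ 3 * norm (zeta_sum (Complex \<sigma> t)) ^ 4 * norm (zeta_sum (Complex \<sigma> (2 * t)))"
  have 0: "norm (of_real \<sigma> - 1 :: complex) = \<sigma> - 1"
    using s by (metis abs_of_pos diff_gt_0_iff_gt norm_of_real of_real_1 of_real_diff)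
  have 1: "\<bar>u\<bar> \<le> norm (Complex \<sigma> u - 1)" for u
    using abs_Im_le_cmod[of "Complex \<sigma> u - 1"] by simp
  have "(\<sigma> - 1) ^ 3 * \<bar>t\<bar> ^ 4 * \<bar>2 * t\<bar> \<le> (\<sigma> - 1) ^ 3 * norm (Complex \<sigma> t - 1) ^ 4 * norm (Complex \<sigma> (2 * t) - 1)"
    using s by (intro mult_mono power_mono 1) auto
  also have "\<dots> \<le> (\<sigma> - 1) ^ 3 * norm (Complex \<sigma> t - 1) ^ 4 * norm (Complex \<sigma> (2 * t) - 1) * ?Z"
    using mult_left_mono[OF three_four_one[OF s, of t],
      of "(\<sigma> - 1) ^ 3 * norm (Complex \<sigma> t - 1) ^ 4 * norm (Complex \<sigma> (2 * t) - 1)"] s by simp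
  also have "\<dots> = norm (zeta_reg (of_real \<sigma>)) ^ 3 * norm (zeta_reg (Complex \<sigma> t)) ^ 4 * norm (zeta_reg (Complex \<sigma> (2 * t)))"
    using s by (simp add: n 0 power_mult_distrib)
  finally show ?thesis .
qed

lemma powr_le_imp_mult_power:
  fixes W a b :: real assumes "W \<ge> 1" "0 \<le> b" "b * real n \<le> a"
  shows "(W powr b) ^ n \<le> W powr a"
  using assms by (simp add: powr_power powr_mono mult.commute)

text \<open>For \<sigma> > 1 the 3-4-1 inequality leaves |H|^4 >= c (\<sigma> - 1)^3 W^(5 - 1.01),
  where W = 1 + |t|. Close to \<sigma> = 1 this degenerates, and the bound is carried over from a
  point slightly to the right by the derivative estimate. The factor |t|^5 on the left forces a
  distance \<open>t0\<close> from the real axis.\<close>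

lemma zeta_reg_lower_bound_aux:
  assumes t0: "t0 > 0"
  obtains c where "c > 0"
    "\<And>\<sigma> t. 1 \<le> \<sigma> \<Longrightarrow> \<sigma> \<le> 2 \<Longrightarrow> \<bar>t\<bar> \<ge> t0 \<Longrightarrow> norm (zeta_reg (Complex \<sigma> t)) \<ge> c * (1 + \<bar>t\<bar>) powr (93/100)"
proof -
  obtain C where C: "C > 0"
    "\<And>s. 1 \<le> Re s \<Longrightarrow> Re s \<le> 3 \<Longrightarrow> norm (zeta_reg s) \<le> C * (1 + \<bar>Im s\<bar>) powr (101/100)"
    using zeta_reg_deriv_bound[of 0] by auto
  obtain C1 where C1: "C1 > 0"
    "\<And>s. 1 \<le> Re s \<Longrightarrow> Re s \<le> 3 \<Longrightarrow> norm (deriv zeta_reg s) \<le> C1 * (1 + \<bar>Im s\<bar>) powr (101/100)"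
    using zeta_reg_deriv_bound[of 1] by auto
  \<comment> \<open>As t / (1 + t) increases, |t| >= \<open>t0\<close> gives
    \<open>k * W \<le> \<bar>t\<bar>\<close>; this turns powers of |t| into powers of W.\<close>
  define k where "k = t0 / (1 + t0)"
  have k: "k > 0" using t0 by (simp add: k_def)
  define c1 where "c1 = k ^ 5 / (C ^ 4 * 4)"
  have c1: "c1 > 0" using k C by (simp add: c1_def)
  define c2 where "c2 = root 4 c1"
  have c2: "c2 > 0" "c2 ^ 4 = c1" using c1 by (simp_all add: c2_def)
  have low: "norm (zeta_reg (Complex \<sigma> t)) \<ge> c2 * (\<sigma> - 1) powr (3/4) * (1 + \<bar>t\<bar>) powr (99/100)"
    if \<sigma>: "1 < \<sigma>" "\<sigma> \<le> 2" and t: "\<bar>t\<bar> \<ge> t0" for \<sigma> t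
  proof -
    define W where "W = 1 + \<bar>t\<bar>"
    define h where "h = norm (zeta_reg (Complex \<sigma> t))"
    have W: "W \<ge> 1" by (simp add: W_def)
    have kW: "k * W \<le> \<bar>t\<bar>" using t t0 by (simp add: k_def W_def field_simps)
    have "1 + \<bar>2 * t\<bar> \<le> 2 * W" by (simp add: W_def)
    then have "(1 + \<bar>2 * t\<bar>) powr (101/100) \<le> (2 * W) powr (101/100)" by (intro powr_mono2) auto
    also have "\<dots> = 2 powr (101/100) * W powr (101/100)" using W by (subst powr_mult) auto
    also have "\<dots> \<le> 4 * W powr (101/100)"
      using powr_mono[of "101/100" 2 "2::real"] by (intro mult_right_mono) auto
    finally have w2: "(1 + \<bar>2 * t\<bar>) powr (101/100) \<le> 4 * W powr (101/100)" .
    have H2: "norm (zeta_reg (Complex \<sigma> (2 * t))) \<le> C * (4 * W powr (101/100))"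
      by (rule order_trans[OF _ mult_left_mono[OF w2]]) (use C(2)[of "Complex \<sigma> (2 * t)"] C(1) \<sigma> in auto)
    have H0: "norm (zeta_reg (of_real \<sigma>)) \<le> C" using C(2)[of "of_real \<sigma>"] \<sigma> by auto
    have "(\<sigma> - 1) ^ 3 * (k * W) ^ 5 \<le> (\<sigma> - 1) ^ 3 * (\<bar>t\<bar> ^ 4 * \<bar>2 * t\<bar>)"
    proof (intro mult_left_mono)
      have "(k * W) ^ 5 \<le> \<bar>t\<bar> ^ 5" using kW k W by (intro power_mono) auto
      also have "\<dots> = \<bar>t\<bar> ^ 4 * \<bar>t\<bar>" by (simp add: eval_nat_numeral)
      also have "\<dots> \<le> \<bar>t\<bar> ^ 4 * \<bar>2 * t\<bar>" by (intro mult_left_mono) auto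
      finally show "(k * W) ^ 5 \<le> \<bar>t\<bar> ^ 4 * \<bar>2 * t\<bar>" .
    qed (use \<sigma> in auto)
    also have "\<dots> \<le> norm (zeta_reg (of_real \<sigma>)) ^ 3 * h ^ 4 * norm (zeta_reg (Complex \<sigma> (2 * t)))"
      using zeta_reg_three_four_one[OF \<sigma>(1), of t] by (simp add: h_def mult.assoc)
    also have "\<dots> \<le> C ^ 3 * h ^ 4 * (C * (4 * W powr (101/100)))"
      using C by (intro mult_mono power_mono H0 H2) (auto simp: h_def)
    also have "\<dots> = (C ^ 4 * 4) * h ^ 4 * W powr (101/100)" by (simp add: eval_nat_numeral)
    finally have "c1 * (\<sigma> - 1) ^ 3 * W ^ 5 \<le> h ^ 4 * W powr (101/100)"
      using C by (simp add: c1_def field_simps power_mult_distrib)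
    also have "W ^ 5 = W powr (399/100) * W powr (101/100)"
      using W by (subst powr_add[symmetric]) simp
    finally have h4: "c1 * (\<sigma> - 1) ^ 3 * W powr (399/100) \<le> h ^ 4" using W by (simp add: mult.assoc[symmetric])
    \<comment> \<open>Since 4 * 99/100 <= 399/100, the fourth root may be taken with the rounded
      exponent 99/100.\<close>
    have "(c2 * (\<sigma> - 1) powr (3/4) * W powr (99/100)) ^ 4 = c1 * (\<sigma> - 1) ^ 3 * (W powr (99/100)) ^ 4"
      using \<sigma> by (simp add: power_mult_distrib c2) (simp add: powr_power)
    also have "\<dots> \<le> c1 * (\<sigma> - 1) ^ 3 * W powr (399/100)"
      using W c1 \<sigma> by (intro mult_left_mono powr_le_imp_mult_power) auto
    also note h4
    finally have "c2 * (\<sigma> - 1) powr (3/4) * W powr (99/100) \<le> h"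
      by (rule power_le_imp_le_base[of _ 3, simplified, unfolded numeral_eq_Suc, simplified]) (simp add: h_def)
    then show ?thesis by (simp add: h_def W_def)
  qed
  \<comment> \<open>Chosen so that the derivative error \<open>C1 * b ^ 4\<close> is at most half of
    the main term \<open>b ^ 3 * c2\<close>.\<close>
  define b where "b = min 1 (c2 / (2 * C1))"
  have b: "0 < b" "b \<le> 1" "C1 * b \<le> c2 / 2" using c2 C1 by (auto simp: b_def min_def field_simps)
  have "norm (zeta_reg (Complex \<sigma> t)) \<ge> (b ^ 3 * c2 / 2) * (1 + \<bar>t\<bar>) powr (93/100)"
    if \<sigma>: "1 \<le> \<sigma>" "\<sigma> \<le> 2" and t: "\<bar>t\<bar> \<ge> t0" for \<sigma> t
  proof -
    define W where "W = 1 + \<bar>t\<bar>"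
    have W: "W \<ge> 1" by (simp add: W_def)
    \<comment> \<open>The exponent -8/100 balances the two sides: 99/100 - (3/4)(8/100) = 93/100 for
      the lower bound at 1 + \<tau>, and 101/100 - 8/100 = 93/100 for the variation over a segment
      of length at most \<tau>.\<close>
    define \<tau> where "\<tau> = b ^ 4 * W powr (-8/100)"
    have \<tau>: "0 < \<tau>" "\<tau> \<le> 1"
    proof -
      show "0 < \<tau>" using b W by (simp add: \<tau>_def)
      have "b ^ 4 \<le> 1" using b by (intro power_le_one) auto
      moreover have "W powr (-8/100) \<le> 1" using W powr_mono[of "-8/100" 0 W] by simp
      ultimately show "\<tau> \<le> 1" using b unfolding \<tau>_def by (intro mult_le_one) auto
    qed
    have \<tau>34: "\<tau> powr (3/4) = b ^ 3 * W powr (-6/100)"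
    proof -
      have "b ^ 4 = b powr 4" using b by simp
      then have "(b ^ 4) powr (3/4) = b powr 3" by (simp only: powr_powr) simp
      then show ?thesis using b W by (simp add: \<tau>_def powr_mult powr_powr)
    qed
    have near: "norm (zeta_reg (Complex \<sigma>' t)) \<ge> b ^ 3 * c2 * W powr (93/100)"
      if \<sigma>': "1 + \<tau> \<le> \<sigma>'" "\<sigma>' \<le> 2" for \<sigma>'
    proof -
      have "b ^ 3 * c2 * W powr (93/100) = c2 * \<tau> powr (3/4) * W powr (99/100)"
        by (simp add: \<tau>34 powr_add[symmetric])
      also have "\<dots> \<le> c2 * (\<sigma>' - 1) powr (3/4) * W powr (99/100)"
        using \<sigma>' \<tau> c2 by (intro mult_right_mono mult_left_mono powr_mono2) auto
      also have "\<dots> \<le> norm (zeta_reg (Complex \<sigma>' t))" using low[of \<sigma>' t] \<sigma>' \<tau> t by (simp add: W_def)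
      finally show ?thesis .
    qed
    have half: "b ^ 3 * c2 / 2 * W powr (93/100) \<le> b ^ 3 * c2 * W powr (93/100)"
      using b c2 by simp
    show ?thesis
    proof (cases "1 + \<tau> \<le> \<sigma>")
      case True
      then show ?thesis using order_trans[OF half near[of \<sigma>]] \<sigma> by (simp add: W_def)
    next
      case False
      let ?S = "closed_segment (Complex \<sigma> t) (Complex (1 + \<tau>) t)"
      have S: "Im z = t \<and> 1 \<le> Re z \<and> Re z \<le> 2" if z: "z \<in> ?S" for z
      proof -
        from z obtain u where u: "0 \<le> u" "u \<le> 1" "z = (1 - u) *\<^sub>R Complex \<sigma> t + u *\<^sub>R Complex (1 + \<tau>) t"
          by (auto simp: in_segment)
        have "Re z = (1 - u) * \<sigma> + u * (1 + \<tau>)" "Im z = t"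
          unfolding u(3) by (simp_all add: algebra_simps)
        moreover have "(1 - u) * \<sigma> + u * (1 + \<tau>) \<ge> (1 - u) * 1 + u * 1"
          using u \<sigma> \<tau> by (intro add_mono mult_left_mono) auto
        moreover have "(1 - u) * \<sigma> + u * (1 + \<tau>) \<le> (1 - u) * 2 + u * 2"
          using u \<sigma> \<tau> by (intro add_mono mult_left_mono) auto
        ultimately show ?thesis by simp
      qed
      have "norm (zeta_reg (Complex (1 + \<tau>) t) - zeta_reg (Complex \<sigma> t))
          \<le> C1 * W powr (101/100) * norm (Complex (1 + \<tau>) t - Complex \<sigma> t)"
      proof (rule field_differentiable_bound[where S = ?S and f' = "deriv zeta_reg"])
        fix z assume z: "z \<in> ?S"
        have "z \<in> {s. Re s > 199/200}" using S[OF z] by auto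
        then show "(zeta_reg has_field_derivative deriv zeta_reg z) (at z within ?S)"
          using holomorphic_derivI[OF zeta_reg_holomorphic open_halfspace_Re_gt] by blast
        show "norm (deriv zeta_reg z) \<le> C1 * W powr (101/100)"
          using C1(2)[of z] S[OF z] by (simp add: W_def)
      qed auto
      also have "norm (Complex (1 + \<tau>) t - Complex \<sigma> t) \<le> \<tau>"
        using False \<sigma> by (simp add: cmod_def)
      also have "C1 * W powr (101/100) * \<tau> = b ^ 3 * (C1 * b) * W powr (93/100)"
        by (simp add: \<tau>_def powr_add[symmetric] eval_nat_numeral)
      also have "\<dots> \<le> b ^ 3 * (c2 / 2) * W powr (93/100)"
        using b by (intro mult_right_mono mult_left_mono) auto
      finally have "norm (zeta_reg (Complex (1 + \<tau>) t) - zeta_reg (Complex \<sigma> t)) \<le> b ^ 3 * (c2 / 2) * W powr (93/100)"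
        using C1 by (auto simp: mult_left_mono)
      moreover have "norm (zeta_reg (Complex (1 + \<tau>) t)) \<ge> b ^ 3 * c2 * W powr (93/100)"
        using near[of "1 + \<tau>"] \<tau> by simp
      ultimately show ?thesis
        using norm_triangle_ineq2[of "zeta_reg (Complex (1 + \<tau>) t)" "zeta_reg (Complex \<sigma> t)"]
        by (simp add: W_def field_simps)
    qed
  qed
  then show ?thesis using that[of "b ^ 3 * c2 / 2"] b c2 by simp
qed

text \<open>Off the real axis the preceding bound applies with \<open>t0\<close> equal to |Im s|; at
  real s > 1 the case t = 0 of \<open>three_four_one\<close> excludes a zero of zeta, and H(1) =
  1.\<close>

lemma zeta_reg_nonzero:
  assumes "Re s \<ge> 1" "Re s \<le> 2"
  shows "zeta_reg s \<noteq> 0"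
proof (cases "Im s = 0")
  case False
  from zeta_reg_lower_bound_aux[of "\<bar>Im s\<bar>"] False obtain c where "c > 0"
    "\<And>\<sigma> t. 1 \<le> \<sigma> \<Longrightarrow> \<sigma> \<le> 2 \<Longrightarrow> \<bar>t\<bar> \<ge> \<bar>Im s\<bar> \<Longrightarrow> norm (zeta_reg (Complex \<sigma> t)) \<ge> c * (1 + \<bar>t\<bar>) powr (93/100)"
    by auto
  from this(2)[of "Re s" "Im s"] assms have "norm (zeta_reg s) \<ge> c * (1 + \<bar>Im s\<bar>) powr (93/100)" by simp
  moreover have "c * (1 + \<bar>Im s\<bar>) powr (93/100) > 0" using \<open>c > 0\<close> by simp
  ultimately show ?thesis by auto
next
  case True
  then have s: "s = of_real (Re s)" by (simp add: complex_eq_iff)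
  show ?thesis
  proof (cases "Re s = 1")
    case True
    then show ?thesis using s by simp
  next
    case False
    then have "Re s > 1" using assms by simp
    from three_four_one[OF this, of 0] have "zeta_sum s \<noteq> 0"
      using s by auto
    moreover have "s \<noteq> 1" using False by auto
    ultimately show ?thesis using zeta_reg_eq[of s] \<open>Re s > 1\<close> by simp
  qed
qed

text \<open>The remaining range |Im s| <= 1 lies in a compact rectangle without zeros. The minimum
  \<open>m\<close> is halved because (1 + |Im s|)^(93/100) <= 2 there.\<close>

lemma zeta_reg_lower_bound:
  obtains c where "c > 0"
    "\<And>s. 1 \<le> Re s \<Longrightarrow> Re s \<le> 2 \<Longrightarrow> norm (zeta_reg s) \<ge> c * (1 + \<bar>Im s\<bar>) powr (93/100)"
proof -
  obtain c where c: "c > 0"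
    "\<And>\<sigma> t. 1 \<le> \<sigma> \<Longrightarrow> \<sigma> \<le> 2 \<Longrightarrow> \<bar>t\<bar> \<ge> 1 \<Longrightarrow> norm (zeta_reg (Complex \<sigma> t)) \<ge> c * (1 + \<bar>t\<bar>) powr (93/100)"
    using zeta_reg_lower_bound_aux[of 1] by auto
  let ?K = "cbox (Complex 1 (-1)) (Complex 2 1)"
  have K: "z \<in> ?K \<longleftrightarrow> 1 \<le> Re z \<and> Re z \<le> 2 \<and> -1 \<le> Im z \<and> Im z \<le> 1" for z
    by (auto simp: in_cbox_complex_iff)
  have "continuous_on ?K (\<lambda>z. norm (zeta_reg z))"
    by (intro continuous_on_norm holomorphic_on_imp_continuous_on holomorphic_on_subset[OF zeta_reg_holomorphic])
       (auto simp: K)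
  moreover have "?K \<noteq> {}" using K[of 1] by auto
  ultimately obtain w where w: "w \<in> ?K" "\<And>z. z \<in> ?K \<Longrightarrow> norm (zeta_reg w) \<le> norm (zeta_reg z)"
    using continuous_attains_inf[of ?K "\<lambda>z. norm (zeta_reg z)"] compact_cbox by blast
  define m where "m = norm (zeta_reg w)"
  have m: "m > 0" using w(1) zeta_reg_nonzero[of w] by (simp add: m_def K)
  have "norm (zeta_reg s) \<ge> min c (m / 2) * (1 + \<bar>Im s\<bar>) powr (93/100)" if s: "1 \<le> Re s" "Re s \<le> 2" for s
  proof (cases "\<bar>Im s\<bar> \<ge> 1")
    case True
    have "min c (m / 2) * (1 + \<bar>Im s\<bar>) powr (93/100) \<le> c * (1 + \<bar>Im s\<bar>) powr (93/100)"
      by (intro mult_right_mono) auto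
    also have "\<dots> \<le> norm (zeta_reg s)" using True c(2)[of "Re s" "Im s"] s by simp
    finally show ?thesis .
  next
    case False
    have "(1 + \<bar>Im s\<bar>) powr (93/100) \<le> (1 + \<bar>Im s\<bar>) powr 1" by (intro powr_mono) auto
    also have "\<dots> \<le> 2" using False by simp
    finally have "min c (m / 2) * (1 + \<bar>Im s\<bar>) powr (93/100) \<le> m / 2 * 2"
      using m c by (intro mult_mono) auto
    also have "\<dots> \<le> norm (zeta_reg s)" using w(2)[of s] False s by (auto simp: K m_def abs_if split: if_splits)
    finally show ?thesis .
  qed
  then show ?thesis using that[of "min c (m / 2)"] c m by simp
qed


section \<open>Bounds for the transform and two derivatives, uniform up to Re s = 1\<close>

text \<open>The Laplace transform of \<open>\<psi>(e\<^sup>y)e\<^sup>-\<^sup>y - 1\<close> at \<open>s - 1\<close>.\<close>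

definition psi_transform :: "complex \<Rightarrow> complex" where
  "psi_transform s = mangoldt_series s / s - 1 / (s - 1)"

text \<open>H'/H = 1/(s - 1) + zeta'/zeta, so the pole at s = 1 cancels and the right side involves
  only H, which is controlled up to the line Re s = 1.\<close>

lemma psi_transform_eq:
  assumes s: "Re s > 1" "Re s \<le> 2"
  shows "psi_transform s = - (1 + deriv zeta_reg s / zeta_reg s) / s"
proof -
  have nz: "zeta_reg s \<noteq> 0" using zeta_reg_nonzero s by simp
  have s0: "s \<noteq> 0" "s - 1 \<noteq> 0" using s by auto
  have "((\<lambda>s. (s - 1) * zeta_sum s) has_field_derivative (zeta_sum s + (s - 1) * (- mangoldt_series s * zeta_sum s))) (at s)"
    by (rule derivative_eq_intros zeta_sum_deriv' refl s | simp)+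
  moreover have "eventually (\<lambda>z. zeta_reg z = (z - 1) * zeta_sum z) (nhds s)"
    using eventually_nhds_in_open[OF open_halfspace_Re_gt[of 1], of s] s
    by (auto elim!: eventually_mono intro: zeta_reg_eq)
  ultimately have "(zeta_reg has_field_derivative (zeta_sum s + (s - 1) * (- mangoldt_series s * zeta_sum s))) (at s)"
    by (subst DERIV_cong_ev[OF refl _ refl]) auto
  then have "deriv zeta_reg s = zeta_sum s + (s - 1) * (- mangoldt_series s * zeta_sum s)"
    by (rule DERIV_imp_deriv)
  moreover have "zeta_reg s = (s - 1) * zeta_sum s" "zeta_sum s \<noteq> 0" using zeta_reg_eq[of s] s nz by auto
  ultimately have "deriv zeta_reg s / zeta_reg s = 1 / (s - 1) - mangoldt_series s"
    using s0 by (simp add: divide_simps) (simp add: algebra_simps)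
  moreover have "1 + 1 / (s - 1) = s / (s - 1)" using s0 by (simp add: field_simps)
  ultimately have "- (1 + deriv zeta_reg s / zeta_reg s) / s = (mangoldt_series s - s / (s - 1)) / s"
    by (simp add: algebra_simps)
  then show ?thesis using s0 by (simp add: psi_transform_def diff_divide_distrib)
qed

text \<open>Each derivative is a polynomial in H'/H, H''/H, H'''/H over powers of s, of weight at
  most 3 in the common bound \<open>v\<close>. Three factors W^(8/100) and one division by s give
  W^(-76/100). Continuity of \<open>G2\<close> is recorded for the later use of the fundamental
  theorem of calculus.\<close>

lemma psi_transform_bounds:
  obtains G1 G2 :: "complex \<Rightarrow> complex" and C where "C > 0"
    "\<And>s. 1 < Re s \<Longrightarrow> Re s < 2 \<Longrightarrow> (psi_transform has_field_derivative G1 s) (at s)"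
    "\<And>s. 1 < Re s \<Longrightarrow> Re s < 2 \<Longrightarrow> (G1 has_field_derivative G2 s) (at s)"
    "continuous_on {s. 1 < Re s \<and> Re s < 2} G2"
    "\<And>s. 1 < Re s \<Longrightarrow> Re s < 2 \<Longrightarrow> norm (psi_transform s) \<le> C * (1 + \<bar>Im s\<bar>) powr (-3/4)"
    "\<And>s. 1 < Re s \<Longrightarrow> Re s < 2 \<Longrightarrow> norm (G1 s) \<le> C * (1 + \<bar>Im s\<bar>) powr (-3/4)"
    "\<And>s. 1 < Re s \<Longrightarrow> Re s < 2 \<Longrightarrow> norm (G2 s) \<le> C * (1 + \<bar>Im s\<bar>) powr (-3/4)"
proof -
  \<comment> \<open>This family is closed under differentiation: the derivative of
    \<open>q k\<close> is \<open>q (Suc k) - q k * q 1\<close>.\<close>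
  define q where "q = (\<lambda>k s. (deriv ^^ k) zeta_reg s / zeta_reg s)"
  define S where "S = {s. 1 < Re s \<and> Re s < 2}"
  have S: "open S" unfolding S_def
    by (intro open_Collect_conj open_halfspace_Re_gt open_halfspace_Re_lt)
  have nz: "zeta_reg s \<noteq> 0" "s \<noteq> 0" if "s \<in> S" for s
    using zeta_reg_nonzero[of s] that by (auto simp: S_def)
  have hol: "zeta_reg holomorphic_on S"
    by (rule holomorphic_on_subset[OF zeta_reg_holomorphic]) (auto simp: S_def)
  have holk: "(deriv ^^ k) zeta_reg holomorphic_on S" for k
    by (rule holomorphic_higher_deriv[OF hol S])
  have dk: "((deriv ^^ k) zeta_reg has_field_derivative (deriv ^^ Suc k) zeta_reg s) (at s)" if "s \<in> S" for k s
    using holomorphic_derivI[OF holk S that] by simp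
  have qd: "(q k has_field_derivative (q (Suc k) s - q k s * q 1 s)) (at s)" if s: "s \<in> S" for k s
  proof -
    have "(q k has_field_derivative (((deriv ^^ Suc k) zeta_reg s * zeta_reg s - (deriv ^^ k) zeta_reg s * deriv zeta_reg s) / (zeta_reg s * zeta_reg s))) (at s)"
      unfolding q_def using dk[OF s, of k] dk[OF s, of 0] nz[OF s] by (intro DERIV_divide) auto
    then show ?thesis by (rule DERIV_cong) (use nz[OF s] in \<open>simp add: q_def field_simps\<close>)
  qed
  define G where "G = (\<lambda>s. - (1 + q 1 s) / s)"
  define G1 where "G1 = (\<lambda>s. - (q 2 s - q 1 s ^ 2) / s + (1 + q 1 s) / s ^ 2)"
  define G2 where "G2 = (\<lambda>s. - (q 3 s - q 2 s * q 1 s - 2 * q 1 s * (q 2 s - q 1 s ^ 2)) / s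
      + 2 * (q 2 s - q 1 s ^ 2) / s ^ 2 - 2 * (1 + q 1 s) / s ^ 3)"
  have Geq: "psi_transform s = G s" if "s \<in> S" for s
    using psi_transform_eq[of s] that by (simp add: S_def G_def q_def)
  have q1: "(q 1 has_field_derivative (q 2 s - q 1 s ^ 2)) (at s)" if "s \<in> S" for s
    using qd[OF that, of 1] by (simp add: numeral_2_eq_2 power2_eq_square)
  have q2: "(q 2 has_field_derivative (q 3 s - q 2 s * q 1 s)) (at s)" if "s \<in> S" for s
    using qd[OF that, of 2] by (simp add: eval_nat_numeral)
  have d1: "(psi_transform has_field_derivative G1 s) (at s)" if s: "s \<in> S" for s
  proof -
    have "(G has_field_derivative G1 s) (at s)"
      unfolding G_def using nz[OF s]
      by (auto intro!: derivative_eq_intros q1[OF s] simp: G1_def field_simps power2_eq_square simp del: One_nat_def)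
    moreover have "eventually (\<lambda>z. psi_transform z = G z) (nhds s)"
      using eventually_nhds_in_open[OF S s] by (auto elim!: eventually_mono intro: Geq)
    ultimately show ?thesis by (subst DERIV_cong_ev[OF refl _ refl]) auto
  qed
  have d2: "(G1 has_field_derivative G2 s) (at s)" if s: "s \<in> S" for s
  proof -
    have i: "(inverse has_field_derivative - ((inverse s)\<^sup>2)) (at s)"
      using DERIV_inverse[of s UNIV] nz[OF s] by (simp add: numeral_2_eq_2)
    have eq: "G1 = (\<lambda>s. - (q 2 s - q 1 s ^ 2) * inverse s + (1 + q 1 s) * inverse s ^ 2)"
      by (simp add: G1_def divide_inverse power_inverse)
    have alg: "- ((c - b * a) - of_nat 2 * ((b - a\<^sup>2) * a ^ (2 - Suc 0))) * j + - (j\<^sup>2) * - (b - a\<^sup>2)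
        + ((0 + (b - a\<^sup>2)) * j\<^sup>2 + of_nat 2 * (- (j\<^sup>2) * j ^ (2 - Suc 0)) * (1 + a))
      = - (c - b * a - 2 * a * (b - a\<^sup>2)) * j + 2 * (b - a\<^sup>2) * j\<^sup>2 - 2 * (1 + a) * j ^ 3" for a b c j :: complex
      by (simp add: eval_nat_numeral algebra_simps)
    note D = DERIV_add[OF DERIV_mult[OF DERIV_minus[OF DERIV_diff[OF q2[OF s] DERIV_power[OF q1[OF s], of 2]]] i]
      DERIV_mult[OF DERIV_add[OF DERIV_const[of 1] q1[OF s]] DERIV_power[OF i, of 2]]]
    from D show ?thesis
      unfolding alg eq by (simp add: G2_def divide_inverse power_inverse del: One_nat_def)
  qed
  have qcont: "continuous_on S (q k)" for k
    using qd by (meson DERIV_isCont continuous_at_imp_continuous_on)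
  have c2: "continuous_on S G2"
    unfolding G2_def using nz by (intro continuous_intros qcont) auto
  obtain c where c: "c > 0"
    "\<And>s. 1 \<le> Re s \<Longrightarrow> Re s \<le> 2 \<Longrightarrow> norm (zeta_reg s) \<ge> c * (1 + \<bar>Im s\<bar>) powr (93/100)"
    by (rule zeta_reg_lower_bound) blast
  have "\<exists>K\<ge>1. \<forall>s\<in>S. norm (q k s) \<le> K * (1 + \<bar>Im s\<bar>) powr (8/100)" for k
  proof -
    obtain B where B: "B > 0"
      "\<And>s. 1 \<le> Re s \<Longrightarrow> Re s \<le> 3 \<Longrightarrow> norm ((deriv ^^ k) zeta_reg s) \<le> B * (1 + \<bar>Im s\<bar>) powr (101/100)"
      using zeta_reg_deriv_bound[of k] by auto
    have "norm (q k s) \<le> max 1 (B / c) * (1 + \<bar>Im s\<bar>) powr (8/100)" if s: "s \<in> S" for s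
    proof -
      let ?W = "1 + \<bar>Im s\<bar>"
      have "norm (q k s) = norm ((deriv ^^ k) zeta_reg s) / norm (zeta_reg s)" by (simp add: q_def norm_divide)
      also have "\<dots> \<le> (B * ?W powr (101/100)) / (c * ?W powr (93/100))"
        using s B c by (intro frac_le) (auto simp: S_def)
      also have "\<dots> = B / c * (?W powr (101/100) / ?W powr (93/100))" by simp
      also have "?W powr (101/100) / ?W powr (93/100) = ?W powr (8/100)"
        by (subst powr_diff[symmetric]) simp
      also have "B / c * ?W powr (8/100) \<le> max 1 (B / c) * ?W powr (8/100)" by (intro mult_right_mono) auto
      finally show ?thesis .
    qed
    then show ?thesis by (intro exI[of _ "max 1 (B / c)"]) auto
  qed
  then obtain K where K: "\<And>k. K k \<ge> 1" "\<And>k s. s \<in> S \<Longrightarrow> norm (q k s) \<le> K k * (1 + \<bar>Im s\<bar>) powr (8/100)"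
    by metis
  define M where "M = max (K 1) (max (K 2) (K 3))"
  have M: "M \<ge> 1" "K 1 \<le> M" "K 2 \<le> M" "K 3 \<le> M" using K(1)[of 1] by (auto simp: M_def)
  have bound: "norm (psi_transform s) \<le> 28 * M ^ 3 * (1 + \<bar>Im s\<bar>) powr (-3/4) \<and>
      norm (G1 s) \<le> 28 * M ^ 3 * (1 + \<bar>Im s\<bar>) powr (-3/4) \<and> norm (G2 s) \<le> 28 * M ^ 3 * (1 + \<bar>Im s\<bar>) powr (-3/4)"
    if s: "s \<in> S" for s
  proof -
    define W where "W = 1 + \<bar>Im s\<bar>"
    have W: "W \<ge> 1" by (simp add: W_def)
    define v where "v = M * W powr (8/100)"
    have "1 * 1 \<le> M * W powr (8/100)" using M W by (intro mult_mono ge_one_powr_ge_zero) auto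
    then have v: "v \<ge> 1" by (simp add: v_def)
    have qv: "norm (q k s) \<le> v" if "k \<in> {1, 2, 3}" for k
    proof -
      have "norm (q k s) \<le> K k * W powr (8/100)" using K(2)[OF s] by (simp add: W_def)
      also have "\<dots> \<le> v" unfolding v_def using that M by (intro mult_right_mono) auto
      finally show ?thesis .
    qed
    have v12: "v \<le> v ^ 3" "v ^ 2 \<le> v ^ 3" "1 \<le> v ^ 3" using v by (auto intro: power_increasing[of _ 3, simplified] self_le_power)
    have n1: "norm (q 1 s) \<le> v" and n2: "norm (q 2 s) \<le> v" and n3: "norm (q 3 s) \<le> v" by (rule qv, simp)+
    have a1: "norm (1 + q 1 s) \<le> 2 * v ^ 3"
      using norm_triangle_ineq[of 1 "q 1 s"] n1 v12 by simp
    have n11: "norm (q 1 s ^ 2) \<le> v ^ 2" unfolding norm_power by (intro power_mono n1) auto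
    have a2': "norm (q 2 s - q 1 s ^ 2) \<le> v + v ^ 2"
      using norm_triangle_ineq4[of "q 2 s" "q 1 s ^ 2"] n2 n11 by simp
    then have a2: "norm (q 2 s - q 1 s ^ 2) \<le> 2 * v ^ 3" using v12 by simp
    have a3: "norm (q 3 s - q 2 s * q 1 s - 2 * q 1 s * (q 2 s - q 1 s ^ 2)) \<le> 6 * v ^ 3"
    proof -
      have "norm (q 2 s * q 1 s) \<le> v * v" unfolding norm_mult by (intro mult_mono n1 n2) (use v in auto)
      moreover have "norm (2 * q 1 s * (q 2 s - q 1 s ^ 2)) \<le> 2 * v * (v + v ^ 2)"
        unfolding norm_mult by (intro mult_mono n1 a2') (use v in auto)
      moreover have "2 * v * (v + v ^ 2) = 2 * v ^ 2 + 2 * v ^ 3" by (simp add: eval_nat_numeral algebra_simps)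
      ultimately show ?thesis
        using norm_triangle_ineq4[of "q 3 s - q 2 s * q 1 s" "2 * q 1 s * (q 2 s - q 1 s ^ 2)"]
          norm_triangle_ineq4[of "q 3 s" "q 2 s * q 1 s"] n3 v12 by (simp add: power2_eq_square)
    qed
    have ns: "norm s \<ge> 1" "norm s \<ge> W / 2"
      using abs_Re_le_cmod[of s] abs_Im_le_cmod[of s] s by (auto simp: S_def W_def)
    \<comment> \<open>Only one power of |s| is used for decay in Im s; the others are discarded by
      |s| >= 1.\<close>
    have dv: "norm (z / s ^ Suc k) \<le> 2 * a / W" if "norm z \<le> a" for z a k
    proof -
      have a: "a \<ge> 0" using that norm_ge_zero order_trans by blast
      have "W / 2 \<le> norm s * norm s ^ k" using ns W mult_mono[of "W/2" "norm s" 1 "norm s ^ k"] by auto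
      then have "norm z / (norm s * norm s ^ k) \<le> a / (W / 2)" using that a W by (intro frac_le) auto
      then show ?thesis by (simp add: norm_divide norm_power norm_mult mult_ac)
    qed
    have tot: "v ^ 3 / W \<le> M ^ 3 * W powr (-3/4)"
    proof -
      have "v ^ 3 / W = M ^ 3 * ((W powr (8/100)) ^ 3 / W powr 1)" using W by (simp add: v_def power_mult_distrib)
      also have "(W powr (8/100)) ^ 3 / W powr 1 = W powr (24/100 - 1)" using W by (subst powr_diff) (simp add: powr_power)
      also have "M ^ 3 * W powr (24/100 - 1) \<le> M ^ 3 * W powr (-3/4)" using W M by (intro mult_left_mono powr_mono) auto
      finally show ?thesis .
    qed
    have "norm (psi_transform s) \<le> 2 * (2 * v ^ 3) / W"
      unfolding Geq[OF s] G_def using dv[of "- (1 + q 1 s)" "2 * v ^ 3" 0] a1 by (simp only: norm_minus_cancel) simp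
    moreover have "norm (G1 s) \<le> 2 * (2 * v ^ 3) / W + 2 * (2 * v ^ 3) / W"
      unfolding G1_def using dv[of "- (q 2 s - q 1 s ^ 2)" "2 * v ^ 3" 0] dv[of "1 + q 1 s" "2 * v ^ 3" 1] a1 a2
      by (intro norm_triangle_le add_mono) (auto simp: power2_eq_square norm_minus_commute)
    moreover have "norm (G2 s) \<le> 2 * (6 * v ^ 3) / W + 2 * (4 * v ^ 3) / W + 2 * (4 * v ^ 3) / W"
      unfolding G2_def
    proof (intro norm_triangle_le_diff norm_triangle_le add_mono)
      show "norm (- (q 3 s - q 2 s * q 1 s - 2 * q 1 s * (q 2 s - (q 1 s)\<^sup>2)) / s) \<le> 2 * (6 * v ^ 3) / W"
        using dv[of "- (q 3 s - q 2 s * q 1 s - 2 * q 1 s * (q 2 s - q 1 s ^ 2))" "6 * v ^ 3" 0] a3 by (simp only: norm_minus_cancel) simp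
      show "norm (2 * (q 2 s - (q 1 s)\<^sup>2) / s\<^sup>2) \<le> 2 * (4 * v ^ 3) / W"
        using dv[of "2 * (q 2 s - q 1 s ^ 2)" "4 * v ^ 3" 1] a2 by (simp only: norm_mult) (simp add: power2_eq_square)
      show "norm (2 * (1 + q 1 s) / s ^ 3) \<le> 2 * (4 * v ^ 3) / W"
        using dv[of "2 * (1 + q 1 s)" "4 * v ^ 3" 2] a1 by (simp only: norm_mult) (simp add: eval_nat_numeral)
    qed
    moreover have "0 \<le> v ^ 3 / W" using v W by simp
    ultimately have "norm (psi_transform s) \<le> 28 * (v ^ 3 / W) \<and> norm (G1 s) \<le> 28 * (v ^ 3 / W) \<and> norm (G2 s) \<le> 28 * (v ^ 3 / W)"
      by auto
    then show ?thesis using tot by (auto simp: W_def)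
  qed
  show ?thesis
  proof (rule that[of "28 * M ^ 3" G1 G2])
    show "28 * M ^ 3 > 0" using M by simp
  qed (use d1 d2 c2 bound in \<open>auto simp: S_def\<close>)
qed

section \<open>Laplace transform of the Chebyshev function\<close>


definition primes_psi :: "real \<Rightarrow> real" where
  "primes_psi x = (\<Sum>n\<in>{1..nat \<lfloor>x\<rfloor>}. mangoldt n)"

definition psi_exp :: "real \<Rightarrow> real" where
  "psi_exp y = primes_psi (exp y) * exp (- y)"

lemma primes_psi_nonneg: "primes_psi x \<ge> 0"
  unfolding primes_psi_def by (intro sum_nonneg mangoldt_nonneg)

lemma primes_psi_mono: "x \<le> y \<Longrightarrow> primes_psi x \<le> primes_psi y"
  unfolding primes_psi_def by (intro sum_mono2) (auto simp: mangoldt_nonneg nat_mono floor_mono)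

lemma psi_exp_nonneg: "psi_exp y \<ge> 0"
  by (simp add: psi_exp_def primes_psi_nonneg)

lemma psi_exp_neg: "y < 0 \<Longrightarrow> psi_exp y = 0"
  by (simp add: psi_exp_def primes_psi_def)

text \<open>The Tauberian condition: \<open>psi_exp y * exp y\<close> is nondecreasing, so
  \<open>psi_exp\<close> can fall by at most the factor exp (u - y) between u and y.\<close>

lemma psi_exp_le_shift: "u \<le> y \<Longrightarrow> psi_exp u \<le> psi_exp y * exp (y - u)"
  using primes_psi_mono[of "exp u" "exp y"] by (simp add: psi_exp_def exp_diff exp_minus field_simps)

text \<open>The trivial bound by n terms of size at most ln n. It is too weak asymptotically, but it
  makes integrals against a Gaussian converge before boundedness is known.\<close>

lemma psi_exp_le: 
  assumes "y \<ge> 0" shows "psi_exp y \<le> y"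
proof -
  have "primes_psi (exp y) \<le> (\<Sum>n\<in>{1..nat \<lfloor>exp y\<rfloor>}. y)"
    unfolding primes_psi_def
  proof (rule sum_mono)
    fix n assume n: "n \<in> {1..nat \<lfloor>exp y\<rfloor>}"
    then have "real n \<le> exp y" using of_nat_floor[of "exp y"] by (meson atLeastAtMost_iff exp_ge_zero le_nat_floor of_nat_le_iff order_trans)
    then have "ln (real n) \<le> y" using n ln_le_cancel_iff[of "real n" "exp y"] by simp
    then show "mangoldt n \<le> y" using mangoldt_le_ln[of n] by simp
  qed
  also have "\<dots> = real (nat \<lfloor>exp y\<rfloor>) * y" by simp
  also have "\<dots> \<le> exp y * y" using assms by (intro mult_right_mono of_nat_floor) auto
  finally show ?thesis by (simp add: psi_exp_def exp_minus field_simps)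
qed

lemma primes_psi_measurable [measurable]: "primes_psi \<in> borel_measurable borel"
  by (rule borel_measurable_mono) (auto simp: mono_def primes_psi_mono)

lemma psi_exp_measurable [measurable]: "psi_exp \<in> borel_measurable borel"
  unfolding psi_exp_def [abs_def] by measurable

text \<open>Writing \<psi> as a superposition of jumps prepares its Laplace transform term by
  term.\<close>

lemma primes_psi_suminf:
  assumes "x \<ge> 0"
  shows "primes_psi x = (\<Sum>n. mangoldt n * indicator {real n..} x)"
    and "summable (\<lambda>n. mangoldt n * indicator {real n..} x :: real)"
proof -
  have *: "mangoldt n * indicator {real n..} x = (0::real)" if "n \<notin> {1..nat \<lfloor>x\<rfloor>}" for n
  proof (cases "n = 0")
    case False
    with that have "x < real n" by (auto simp: not_le) linarith
    then show ?thesis by simp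
  qed auto
  have "(\<Sum>n. mangoldt n * indicator {real n..} x) = (\<Sum>n\<in>{1..nat \<lfloor>x\<rfloor>}. mangoldt n * indicator {real n..} x :: real)"
    by (rule suminf_finite) (use * in auto)
  also have "\<dots> = primes_psi x"
    unfolding primes_psi_def
  proof (intro sum.cong refl)
    fix n assume "n \<in> {1..nat \<lfloor>x\<rfloor>}"
    then have "real n \<le> x" using assms by (auto simp: le_nat_floor) linarith
    then show "mangoldt n * indicator {real n..} x = mangoldt n" by simp
  qed
  finally show "primes_psi x = (\<Sum>n. mangoldt n * indicator {real n..} x)" ..
  show "summable (\<lambda>n. mangoldt n * indicator {real n..} x :: real)"
    by (rule summable_finite[of "{1..nat \<lfloor>x\<rfloor>}"]) (use * in auto)
qed

lemma set_lebesgue_integral_Ici: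
  fixes f :: "real \<Rightarrow> 'a::{banach, second_countable_topology}"
  shows "(LINT y:{a..}|lborel. f y) = (LINT y:{a<..}|lborel. f y)"
  by (rule set_integral_discrete_difference[where X = "{a}"]) auto

lemma set_integral_exp_ray:
  assumes s: "Re s > 0"
  shows "set_integrable lborel {a..} (\<lambda>y. exp (- s * of_real y))"
    and "(LINT y:{a..}|lborel. exp (- s * of_real y)) = exp (- s * of_real a) / s"
proof -
  have s0: "s \<noteq> 0" using s by auto
  have I: "set_integrable lborel {a..} (\<lambda>y. exp (- Re s * y))"
  proof -
    have "((\<lambda>y. exp (- Re s * y)) has_integral exp (- Re s * a) / Re s) {a..}"
      using has_integral_exp_minus_to_infinity[OF s, of a] by simp
    then have "(\<lambda>y. exp (- Re s * y)) absolutely_integrable_on {a..}"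
      by (intro nonnegative_absolutely_integrable_1) (auto simp: has_integral_integrable)
    then show ?thesis by (simp add: set_integrable_def integrable_completion)
  qed
  show 1: "set_integrable lborel {a..} (\<lambda>y. exp (- s * of_real y))"
    unfolding set_integrable_def
    by (rule Bochner_Integration.integrable_bound[OF I[unfolded set_integrable_def]]) (auto simp: norm_mult)
  have 2: "(LBINT y=a..\<infinity>. exp (- s * of_real y)) = 0 - (- exp (- s * of_real a) / s)"
  proof (rule interval_integral_FTC_integrable)
    show "((\<lambda>y. - exp (- s * of_real y) / s) has_vector_derivative exp (- s * of_real x)) (at x)" for x
      using s0 by (auto intro!: derivative_eq_intros has_vector_derivative_real_field simp: field_simps)
    show "isCont (\<lambda>y. exp (- s * of_real y)) x" for x by (intro continuous_intros)
    show "set_integrable lborel (einterval (ereal a) \<infinity>) (\<lambda>y. exp (- s * of_real y))"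
      by (rule set_integrable_subset[OF 1]) (auto simp: einterval_def)
    have "((\<lambda>y. - exp (- s * of_real y) / s) \<longlongrightarrow> - exp (- s * of_real a) / s) (at a)"
      using s0 by (intro tendsto_intros)
    then show "(((\<lambda>y. - exp (- s * of_real y) / s) \<circ> real_of_ereal) \<longlongrightarrow> - exp (- s * of_real a) / s) (at_right (ereal a))"
      unfolding ereal_tendsto_simps using filterlim_at_split by blast
    have "((\<lambda>y. norm (- exp (- s * of_real y) / s)) \<longlongrightarrow> 0) at_top"
    proof -
      have "((\<lambda>y. exp (- Re s * y) / norm s) \<longlongrightarrow> 0) at_top"
        using s s0 by real_asymp
      then show ?thesis by (simp add: norm_divide)
    qed
    then show "(((\<lambda>y. - exp (- s * of_real y) / s) \<circ> real_of_ereal) \<longlongrightarrow> 0) (at_left \<infinity>)"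
      unfolding ereal_tendsto_simps by (rule tendsto_norm_zero_cancel)
  qed auto
  then show "(LINT y:{a..}|lborel. exp (- s * of_real y)) = exp (- s * of_real a) / s"
    by (simp add: interval_integral_to_infinity_eq set_lebesgue_integral_Ici)
qed

lemma exp_ln_powr: "n > 0 \<Longrightarrow> exp (- s * of_real (ln (real n))) = (of_nat n powr (-s) :: complex)"
  by (simp add: powr_def Ln_of_nat)

text \<open>The jump at ln n contributes \<Lambda>(n) n^(-s) / s. Interchanging sum and integral is
  justified by the summability of the L1 norms \<Lambda>(n) n^(-Re s) / Re s.\<close>

lemma laplace_primes_psi:
  assumes s: "Re s > 1"
  shows "set_integrable lborel {0..} (\<lambda>y. of_real (primes_psi (exp y)) * exp (- s * of_real y))"
    and "(LINT y:{0..}|lborel. of_real (primes_psi (exp y)) * exp (- s * of_real y)) = mangoldt_series s / s"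
proof -
  \<comment> \<open>At n = 0 the value \<open>ln 0\<close> does not matter because
    \<open>mangoldt 0 = 0\<close>.\<close>
  define h where "h = (\<lambda>(n::nat) y. indicator {ln (real n)..} y *\<^sub>R (mangoldt n * exp (- s * of_real y)) :: complex)"
  have s0: "Re s > 0" "s \<noteq> 0" using s by auto
  have hi: "integrable lborel (h n)" for n
    using set_integrable_mult_right[OF set_integral_exp_ray(1)[OF s0(1), of "ln (real n)"], of "mangoldt n"]
    by (simp add: h_def set_integrable_def)
  have h_int: "integral\<^sup>L lborel (h n) = mangoldt n * of_nat n powr (-s) / s" for n
  proof (cases "n = 0")
    case False
    have "integral\<^sup>L lborel (h n) = (LINT y:{ln (real n)..}|lborel. mangoldt n * exp (- s * of_real y))"
      by (simp only: set_lebesgue_integral_def h_def)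
    also have "\<dots> = mangoldt n * (LINT y:{ln (real n)..}|lborel. exp (- s * of_real y))"
      by (rule set_integral_mult_right)
    also have "\<dots> = mangoldt n * (of_nat n powr (-s) / s)"
      using False exp_ln_powr[of n s] by (simp only: set_integral_exp_ray(2)[OF s0(1)] neq0_conv)
    finally show ?thesis by simp
  qed (simp add: h_def)
  have h_norm: "(\<integral>y. norm (h n y) \<partial>lborel) = mangoldt n * real n powr (-Re s) / Re s" for n
  proof (cases "n = 0")
    case False
    \<comment> \<open>The real integral is embedded into the complex numbers so that the exponential
      formula applies with s replaced by Re s.\<close>
    have "complex_of_real (\<integral>y. norm (h n y) \<partial>lborel) = (\<integral>y. of_real (norm (h n y)) \<partial>lborel)"
      by (rule integral_of_real[OF integrable_norm[OF hi], symmetric])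
    also have "(\<lambda>y. complex_of_real (norm (h n y))) = (\<lambda>y. indicator {ln (real n)..} y *\<^sub>R (mangoldt n * exp (- of_real (Re s) * of_real y)))"
      by (auto simp: h_def norm_mult scaleR_conv_of_real exp_of_real[symmetric] split: split_indicator)
    also have "integral\<^sup>L lborel \<dots> = (LINT y:{ln (real n)..}|lborel. mangoldt n * exp (- of_real (Re s) * of_real y))"
      by (simp only: set_lebesgue_integral_def)
    also have "\<dots> = mangoldt n * (LINT y:{ln (real n)..}|lborel. exp (- of_real (Re s) * of_real y))"
      by (rule set_integral_mult_right)
    also have "\<dots> = mangoldt n * (exp (- of_real (Re s) * of_real (ln (real n))) / of_real (Re s))"
      by (subst set_integral_exp_ray(2)) (use s in auto)
    also have "\<dots> = of_real (mangoldt n * exp (- Re s * ln (real n)) / Re s)"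
      by (simp add: exp_of_real[symmetric])
    also have "exp (- Re s * ln (real n)) = real n powr (- Re s)" using False by (simp add: powr_def)
    finally show ?thesis by (simp only: of_real_eq_iff)
  qed (simp add: h_def)
  have sum_h: "indicator {0..} y *\<^sub>R (of_real (primes_psi (exp y)) * exp (- s * of_real y)) = (\<Sum>n. h n y)"
    and summ_h: "summable (\<lambda>n. norm (h n y))" for y
  proof -
    have ind: "h n y = of_real (mangoldt n * indicator {real n..} (exp y)) * exp (- s * of_real y)" for n
    proof (cases "n = 0")
      case False
      then have "ln (real n) \<le> y \<longleftrightarrow> real n \<le> exp y"
        using ln_le_cancel_iff[of "real n" "exp y"] by simp
      then show ?thesis by (simp add: h_def indicator_def)
    qed (simp add: h_def)
    have "summable (\<lambda>n. mangoldt n * indicator {real n..} (exp y) * exp (- Re s * y))"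
      by (intro summable_mult2 primes_psi_suminf) simp
    then show "summable (\<lambda>n. norm (h n y))"
      by (simp add: ind norm_mult abs_mult)
    have "(\<Sum>n. h n y) = (\<Sum>n. of_real (mangoldt n * indicator {real n..} (exp y))) * exp (- s * of_real y)"
      unfolding ind by (intro suminf_mult2[symmetric] summable_of_real primes_psi_suminf) simp
    also have "\<dots> = of_real (primes_psi (exp y)) * exp (- s * of_real y)"
      using primes_psi_suminf[of "exp y"] by (subst suminf_of_real[symmetric]) auto
    also have "\<dots> = indicator {0..} y *\<^sub>R (of_real (primes_psi (exp y)) * exp (- s * of_real y))"
      by (auto simp: primes_psi_def split: split_indicator)
    finally show "indicator {0..} y *\<^sub>R (of_real (primes_psi (exp y)) * exp (- s * of_real y)) = (\<Sum>n. h n y)" ..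
  qed
  have AE_sum: "AE y in lborel. summable (\<lambda>n. norm (h n y))" using summ_h by simp
  have sm: "summable (\<lambda>n. \<integral>y. norm (h n y) \<partial>lborel)"
    using abs_summable_mangoldt[OF s] unfolding h_norm by (intro summable_divide) (simp add: norm_mult norm_nat_powr)
  show "set_integrable lborel {0..} (\<lambda>y. of_real (primes_psi (exp y)) * exp (- s * of_real y))"
    unfolding set_integrable_def sum_h by (rule integrable_suminf[OF hi AE_sum sm])
  have "(LINT y:{0..}|lborel. of_real (primes_psi (exp y)) * exp (- s * of_real y)) = (\<Sum>n. mangoldt n * of_nat n powr (-s) / s)"
    unfolding set_lebesgue_integral_def sum_h by (subst integral_suminf[OF hi AE_sum sm]) (simp only: h_int)
  also have "\<dots> = mangoldt_series s / s"
    unfolding mangoldt_series_def by (intro suminf_divide summable_norm_cancel[OF abs_summable_mangoldt] s)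
  finally show "(LINT y:{0..}|lborel. of_real (primes_psi (exp y)) * exp (- s * of_real y)) = mangoldt_series s / s" .
qed

text \<open>The cut at 0 matters: \<open>psi_exp\<close> vanishes for y < 0 but the subtracted 1
  does not, and the damping exp (- \<delta> y) grows in that direction.\<close>

definition psi_dev :: "real \<Rightarrow> real" where
  "psi_dev y = indicator {0..} y * (psi_exp y - 1)"

lemma psi_dev_measurable [measurable]: "psi_dev \<in> borel_measurable borel"
  unfolding psi_dev_def [abs_def] by measurable

text \<open>The subtracted 1 has Laplace transform 1/(s - 1) at s - 1, exactly the subtraction in
  \<open>psi_transform\<close>; on Re s = 1 + \<delta> the transform becomes a Fourier transform of
  the damped function.\<close>

lemma laplace_psi_dev:
  assumes \<delta>: "\<delta> > 0"
  shows "integrable lborel (\<lambda>y. psi_dev y * exp (- \<delta> * y))"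
    and "(\<integral>y. of_real (psi_dev y * exp (- \<delta> * y)) * exp (- \<i> * of_real t * of_real y) \<partial>lborel) = psi_transform (Complex (1 + \<delta>) t)"
proof -
  define s where "s = Complex (1 + \<delta>) t"
  have s: "Re s > 1" "Re (s - 1) > 0" using \<delta> by (auto simp: s_def)
  have ex: "exp (- \<delta> * y) * exp (- \<i> * of_real t * of_real y) = exp (- (s - 1) * complex_of_real y)" for y
  proof -
    have "s - 1 = of_real \<delta> + \<i> * of_real t" by (simp add: s_def complex_eq_iff)
    then show ?thesis by (simp add: exp_of_real[symmetric] exp_add[symmetric] algebra_simps)
  qed
  have ex1: "exp (- y) * exp (- (s - 1) * complex_of_real y) = exp (- s * complex_of_real y)" for y
    by (simp add: exp_of_real[symmetric] exp_add[symmetric] algebra_simps)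
  have eq: "of_real (psi_dev y * exp (- \<delta> * y)) * exp (- \<i> * of_real t * of_real y) =
      indicator {0..} y *\<^sub>R (of_real (primes_psi (exp y)) * exp (- s * of_real y)) - indicator {0..} y *\<^sub>R exp (- (s - 1) * complex_of_real y)" for y
    unfolding ex1[symmetric] ex[symmetric]
    by (auto simp: psi_dev_def psi_exp_def algebra_simps exp_of_real[symmetric] split: split_indicator)
  have int: "integrable lborel (\<lambda>y. of_real (psi_dev y * exp (- \<delta> * y)) * exp (- \<i> * of_real t * of_real y))"
    unfolding eq
    using laplace_primes_psi(1)[OF s(1)] set_integral_exp_ray(1)[OF s(2), of 0] unfolding set_integrable_def
    by (intro Bochner_Integration.integrable_diff)
  then have "integrable lborel (\<lambda>y. norm (of_real (psi_dev y * exp (- \<delta> * y)) * exp (- \<i> * of_real t * of_real y)))"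
    by (rule integrable_norm)
  then have "integrable lborel (\<lambda>y. norm (psi_dev y * exp (- \<delta> * y)))" by (simp add: norm_mult abs_mult)
  then show "integrable lborel (\<lambda>y. psi_dev y * exp (- \<delta> * y))"
    by (subst (asm) integrable_norm_iff) auto
  have "(\<integral>y. of_real (psi_dev y * exp (- \<delta> * y)) * exp (- \<i> * of_real t * of_real y) \<partial>lborel)
    = mangoldt_series s / s - exp (- (s - 1) * of_real 0) / (s - 1)"
    unfolding eq
    using laplace_primes_psi[OF s(1)] set_integral_exp_ray[OF s(2), of 0] unfolding set_integrable_def set_lebesgue_integral_def
    by (subst Bochner_Integration.integral_diff) auto
  then show "(\<integral>y. of_real (psi_dev y * exp (- \<delta> * y)) * exp (- \<i> * of_real t * of_real y) \<partial>lborel) = psi_transform (Complex (1 + \<delta>) t)"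
    by (simp add: psi_transform_def s_def)
qed

section \<open>Gaussian smoothing\<close>


text \<open>Substituting t = T x reduces the integral to the characteristic function of the standard
  normal distribution.\<close>

lemma gaussian_fourier:
  assumes T: "T > 0"
  shows "(\<integral>t. of_real (exp (- t\<^sup>2 / (2 * T\<^sup>2))) * exp (\<i> * of_real (v * t)) \<partial>lborel)
    = complex_of_real (2 * pi * normal_density 0 (1 / T) v)"
proof -
  have sp: "sqrt (2 * pi) > 0" by simp
  have "(\<integral>t. of_real (exp (- t\<^sup>2 / (2 * T\<^sup>2))) * exp (\<i> * of_real (v * t)) \<partial>lborel) =
    \<bar>T\<bar> *\<^sub>R (\<integral>x. of_real (exp (- (0 + T * x)\<^sup>2 / (2 * T\<^sup>2))) * exp (\<i> * of_real (v * (0 + T * x))) \<partial>lborel)"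
    using T by (intro lborel_integral_real_affine) auto
  also have "(\<lambda>x. complex_of_real (exp (- (0 + T * x)\<^sup>2 / (2 * T\<^sup>2))) * exp (\<i> * of_real (v * (0 + T * x)))) =
      (\<lambda>x. of_real (sqrt (2 * pi)) * (std_normal_density x *\<^sub>R iexp ((v * T) * x)))"
    using T sp by (auto simp: fun_eq_iff std_normal_density_def scaleR_conv_of_real power_mult_distrib mult_ac)
  also have "integral\<^sup>L lborel \<dots> = of_real (sqrt (2 * pi)) * (\<integral>x. std_normal_density x *\<^sub>R iexp ((v * T) * x) \<partial>lborel)"
    by (rule integral_mult_right_zero)
  also have "(\<integral>x. std_normal_density x *\<^sub>R iexp ((v * T) * x) \<partial>lborel) = char std_normal_distribution (v * T)"
    unfolding char_def by (subst integral_density) auto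
  also have "\<dots> = complex_of_real (exp (- ((v * T)\<^sup>2) / 2))" by (simp only: char_std_normal_distribution)
  also have "\<bar>T\<bar> *\<^sub>R (of_real (sqrt (2 * pi)) * complex_of_real (exp (- ((v * T)\<^sup>2) / 2)))
    = complex_of_real (T * sqrt (2 * pi) * exp (- ((v * T)\<^sup>2) / 2))" using T by (simp add: scaleR_conv_of_real)
  also have "T * sqrt (2 * pi) * exp (- ((v * T)\<^sup>2) / 2) = 2 * pi * normal_density 0 (1 / T) v"
  proof -
    have sq: "sqrt (2 * pi * (1 / T)\<^sup>2) = sqrt (2 * pi) / T"
      using T by (simp add: real_sqrt_mult power_divide real_sqrt_divide)
    have ex: "- (v - 0)\<^sup>2 / (2 * (1 / T)\<^sup>2) = - ((v * T)\<^sup>2) / 2" using T by (simp add: field_simps)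
    have "2 * pi * normal_density 0 (1 / T) v = 2 * pi / sqrt (2 * pi) * T * exp (- ((v * T)\<^sup>2) / 2)"
      unfolding normal_density_def sq ex by simp
    also have "2 * pi / sqrt (2 * pi) = sqrt (2 * pi)" by (simp add: real_div_sqrt)
    finally show ?thesis by simp
  qed
  finally show ?thesis .
qed

lemma normal_density_swap: "normal_density 0 \<sigma> (u - y) = normal_density u \<sigma> y"
  by (simp add: normal_density_def power2_commute)

lemma integrable_gaussian: "T > 0 \<Longrightarrow> integrable lborel (\<lambda>t::real. exp (- t\<^sup>2 / (2 * T\<^sup>2)))"
proof -
  assume T: "T > 0"
  have "integrable lborel (\<lambda>t. sqrt (2 * pi * T\<^sup>2) * normal_density 0 T t)"
    using T by (intro integrable_mult_right) auto
  then show ?thesis using T by (simp add: normal_density_def)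
qed

text \<open>The kernel is written as the Fourier integral of a Gaussian and the two integrations are
  exchanged. Fubini applies because damping makes \<open>psi_dev\<close> integrable in y and the
  Gaussian is integrable in t.\<close>

lemma psi_dev_smoothed:
  assumes \<delta>: "\<delta> > 0" and T: "T > 0"
  shows "complex_of_real (\<integral>y. psi_dev y * exp (- \<delta> * y) * normal_density u (1 / T) y \<partial>lborel) =
    (\<integral>t. psi_transform (Complex (1 + \<delta>) t) * (of_real (exp (- t\<^sup>2 / (2 * T\<^sup>2))) * exp (\<i> * of_real (u * t))) \<partial>lborel) / of_real (2 * pi)"
proof -
  let ?d = "\<lambda>y. psi_dev y * exp (- \<delta> * y)"
  let ?k = "\<lambda>t. exp (- t\<^sup>2 / (2 * T\<^sup>2))"
  define f where "f = (\<lambda>y t. complex_of_real (?d y) * (of_real (?k t) * exp (\<i> * of_real ((u - y) * t))))"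
  have [measurable]: "case_prod f \<in> borel_measurable (lborel \<Otimes>\<^sub>M lborel)" unfolding f_def by measurable
  have nf: "norm (f y t) = \<bar>?d y\<bar> * ?k t" for y t
    by (simp add: f_def norm_mult abs_mult)
  have id: "integrable lborel ?d" by (rule laplace_psi_dev(1)[OF \<delta>])
  note ik = integrable_gaussian[OF T]
  have fi: "integrable (lborel \<Otimes>\<^sub>M lborel) (case_prod f)"
  proof (rule lborel_pair.Fubini_integrable)
    show "integrable lborel (\<lambda>x. \<integral>y. norm (case_prod f (x, y)) \<partial>lborel)"
      unfolding prod.case nf using integrable_abs[OF id] by simp
    have "integrable lborel (f y)" for y
    proof (rule Bochner_Integration.integrable_bound[OF integrable_mult_right[OF ik, of "\<bar>?d y\<bar>"]])
      show "f y \<in> borel_measurable lborel" unfolding f_def by measurable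
    qed (simp add: nf abs_mult)
    then show "AE x in lborel. integrable lborel (\<lambda>y. case_prod f (x, y))" by simp
  qed simp
  have "complex_of_real (\<integral>y. psi_dev y * exp (- \<delta> * y) * normal_density u (1 / T) y \<partial>lborel)
    = (\<integral>y. of_real (?d y) * complex_of_real (normal_density 0 (1 / T) (u - y)) \<partial>lborel)"
    unfolding normal_density_swap by (subst integral_complex_of_real[symmetric]) (simp only: of_real_mult)
  also have "\<dots> = (\<integral>y. (\<integral>t. f y t \<partial>lborel) / of_real (2 * pi) \<partial>lborel)"
  proof (intro Bochner_Integration.integral_cong refl)
    fix y
    have "(\<integral>t. f y t \<partial>lborel) = of_real (?d y) * of_real (2 * pi * normal_density 0 (1 / T) (u - y))"
      unfolding f_def by (subst integral_mult_right_zero) (simp only: gaussian_fourier[OF T])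
    then show "of_real (?d y) * complex_of_real (normal_density 0 (1 / T) (u - y)) = (\<integral>t. f y t \<partial>lborel) / of_real (2 * pi)"
      by simp
  qed
  also have "\<dots> = (\<integral>y. (\<integral>t. f y t \<partial>lborel) \<partial>lborel) / of_real (2 * pi)" by simp
  also have "(\<integral>y. (\<integral>t. f y t \<partial>lborel) \<partial>lborel) = (\<integral>t. (\<integral>y. f y t \<partial>lborel) \<partial>lborel)"
    by (rule lborel_pair.Fubini_integral[OF fi, symmetric])
  also have "\<dots> = (\<integral>t. psi_transform (Complex (1 + \<delta>) t) * (of_real (?k t) * exp (\<i> * of_real (u * t))) \<partial>lborel)"
  proof (intro Bochner_Integration.integral_cong refl)
    fix t
    have "f y t = (of_real (?d y) * exp (- \<i> * of_real t * of_real y)) * (of_real (?k t) * exp (\<i> * of_real (u * t)))" for y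
    proof -
      have "exp (\<i> * of_real ((u - y) * t)) = exp (- \<i> * of_real t * of_real y) * exp (\<i> * of_real (u * t))"
        by (simp add: exp_add[symmetric] algebra_simps)
      then show ?thesis by (simp add: f_def mult_ac)
    qed
    then have "(\<integral>y. f y t \<partial>lborel) = (\<integral>y. of_real (?d y) * exp (- \<i> * of_real t * of_real y) \<partial>lborel) * (of_real (?k t) * exp (\<i> * of_real (u * t)))"
      by (simp only: integral_mult_left_zero)
    also have "\<dots> = psi_transform (Complex (1 + \<delta>) t) * (of_real (?k t) * exp (\<i> * of_real (u * t)))"
      by (simp only: laplace_psi_dev(2)[OF \<delta>])
    finally show "(\<integral>y. f y t \<partial>lborel) = psi_transform (Complex (1 + \<delta>) t) * (of_real (?k t) * exp (\<i> * of_real (u * t)))" .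
  qed
  finally show ?thesis .
qed

lemma integrable_one_plus_abs_powr:
  assumes "e < -1"
  shows "integrable lborel (\<lambda>t::real. (1 + \<bar>t\<bar>) powr e)"
proof -
  have "((\<lambda>x. x powr e) has_integral -(1 powr (e + 1)) / (e + 1)) {1..}"
    using assms by (intro has_integral_powr_to_inf) auto
  then have "(\<lambda>x. x powr e) absolutely_integrable_on {1..}"
    by (intro nonnegative_absolutely_integrable_1) (auto simp: has_integral_integrable)
  then have 1: "integrable lborel (\<lambda>x. indicator {1..} x *\<^sub>R x powr e)"
    by (simp add: set_integrable_def integrable_completion)
  have 2: "integrable lborel (\<lambda>x. indicator {1..} (1 + c * x) *\<^sub>R (1 + c * x) powr e)" if "c \<noteq> 0" for c :: real
    by (rule lborel_integrable_real_affine[OF 1 that])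
  have "integrable lborel (\<lambda>x. indicator {1..} (1 + 1 * x) *\<^sub>R (1 + 1 * x) powr e + indicator {1..} (1 + (-1) * x) *\<^sub>R (1 + (-1) * x) powr e)"
    by (intro Bochner_Integration.integrable_add 2) auto
  then show ?thesis
    by (rule Bochner_Integration.integrable_bound) (auto simp: indicator_def abs_if)
qed

text \<open>The polynomial collects the factors that appear when transform times Gaussian is
  differentiated twice, with v = |t| / T. The constant is 2 * 64: (2 + 2 v + v^2)(1 + v) is at most
  2 (1 + v)^3, and (1 + v)^3 is at most 64 exp (v^2 / 2).\<close>

lemma poly_times_gaussian_le:
  assumes "v \<ge> (0::real)"
  shows "(2 + 2 * v + v\<^sup>2) * exp (- v\<^sup>2 / 2) \<le> 128 / (1 + v)"
proof -
  have e: "1 \<le> exp (v\<^sup>2 / 2)" "v ^ 4 / 8 \<le> exp (v\<^sup>2 / 2)"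
  proof -
    have "1 + v\<^sup>2 / 2 + (v\<^sup>2 / 2)\<^sup>2 / 2 \<le> exp (v\<^sup>2 / 2)"
      by (rule exp_lower_Taylor_quadratic) simp
    moreover have "(v\<^sup>2 / 2)\<^sup>2 / 2 = v ^ 4 / 8" by (simp add: power_divide)
    moreover have "0 \<le> v\<^sup>2 / 2" "0 \<le> v ^ 4 / 8" by simp_all
    ultimately show "1 \<le> exp (v\<^sup>2 / 2)" "v ^ 4 / 8 \<le> exp (v\<^sup>2 / 2)" by linarith+
  qed
  have "(1 + v) ^ 3 \<le> 64 * exp (v\<^sup>2 / 2)"
  proof (cases "v \<le> 1")
    case True
    then have "(1 + v) ^ 3 \<le> 2 ^ 3" using assms by (intro power_mono) auto
    moreover have "(2::real) ^ 3 = 8" by simp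
    ultimately show ?thesis using e(1) by linarith
  next
    case False
    then have "(1 + v) ^ 3 \<le> (2 * v) ^ 3" by (intro power_mono) auto
    also have "\<dots> \<le> 8 * v ^ 4" using False by (simp add: eval_nat_numeral)
    finally show ?thesis using e by simp
  qed
  moreover have "(2 + 2 * v + v\<^sup>2) * (1 + v) \<le> 2 * (1 + v) ^ 3"
    using assms by (simp add: eval_nat_numeral algebra_simps)
  ultimately have "(2 + 2 * v + v\<^sup>2) * (1 + v) \<le> 128 * exp (v\<^sup>2 / 2)" by linarith
  then show ?thesis using assms by (simp add: exp_minus field_simps)
qed

text \<open>Two integrations by parts give the factor 1/u^2 and leave the integral of a second
  derivative. From the Gaussian only a decay 1/(1 + v) is kept, which is at most sqrt T (1 +
  |t|)^(-1/2); together with -3/4 this yields the integrable exponent -5/4.\<close>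

lemma psi_transform_gaussian_bound:
  obtains C where "C > 0"
    "\<And>\<delta> T u. 0 < \<delta> \<Longrightarrow> \<delta> < 1 \<Longrightarrow> T \<ge> 1 \<Longrightarrow> u > 0 \<Longrightarrow>
      norm (\<integral>t. psi_transform (Complex (1 + \<delta>) t) * (of_real (exp (- t\<^sup>2 / (2 * T\<^sup>2))) * exp (\<i> * of_real (u * t))) \<partial>lborel)
        \<le> C * sqrt T / u\<^sup>2"
proof -
  obtain G1 G2 C where C: "C > 0"
    and G: "\<And>s. 1 < Re s \<Longrightarrow> Re s < 2 \<Longrightarrow> (psi_transform has_field_derivative G1 s) (at s)"
    and G1: "\<And>s. 1 < Re s \<Longrightarrow> Re s < 2 \<Longrightarrow> (G1 has_field_derivative G2 s) (at s)"
    and cG2: "continuous_on {s. 1 < Re s \<and> Re s < 2} G2"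
    and b0: "\<And>s. 1 < Re s \<Longrightarrow> Re s < 2 \<Longrightarrow> norm (psi_transform s) \<le> C * (1 + \<bar>Im s\<bar>) powr (-3/4)"
    and b1: "\<And>s. 1 < Re s \<Longrightarrow> Re s < 2 \<Longrightarrow> norm (G1 s) \<le> C * (1 + \<bar>Im s\<bar>) powr (-3/4)"
    and b2: "\<And>s. 1 < Re s \<Longrightarrow> Re s < 2 \<Longrightarrow> norm (G2 s) \<le> C * (1 + \<bar>Im s\<bar>) powr (-3/4)"
    by (rule psi_transform_bounds) blast
  define J where "J = (\<integral>t. (1 + \<bar>t\<bar>) powr (-5/4) \<partial>(lborel :: real measure))"
  have iJ: "integrable lborel (\<lambda>t::real. (1 + \<bar>t\<bar>) powr (-5/4))" by (rule integrable_one_plus_abs_powr) simp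
  have J0: "J \<ge> 0" unfolding J_def by (intro integral_nonneg_AE) auto
  have main: "norm (\<integral>t. psi_transform (Complex (1 + \<delta>) t) * (of_real (exp (- t\<^sup>2 / (2 * T\<^sup>2))) * exp (\<i> * of_real (u * t))) \<partial>lborel)
        \<le> (128 * C * (J + 1)) * sqrt T / u\<^sup>2" if \<delta>: "0 < \<delta>" "\<delta> < 1" and T: "T \<ge> 1" and u: "u > 0" for \<delta> T u
  proof -
    \<comment> \<open>The integrand is treated as a holomorphic function of z, evaluated at z = i t:
      \<open>p\<close> moves z to the line Re s = 1 + \<delta>, and \<open>k\<close> restricts to
      the Gaussian exp (- t^2 / (2 T^2)).\<close>
    define p where "p = (\<lambda>z::complex. z + of_real (1 + \<delta>))"
    define c where "c = complex_of_real (1 / T\<^sup>2)"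
    define k where "k = (\<lambda>z::complex. exp (z\<^sup>2 * c / 2))"
    define a where "a = (\<lambda>z. psi_transform (p z) * k z)"
    define a1 where "a1 = (\<lambda>z. (G1 (p z) + psi_transform (p z) * (z * c)) * k z)"
    define a2 where "a2 = (\<lambda>z. (G2 (p z) + 2 * G1 (p z) * (z * c) + psi_transform (p z) * (c + z\<^sup>2 * c\<^sup>2)) * k z)"
    have p: "1 < Re (p (\<i> * of_real t))" "Re (p (\<i> * of_real t)) < 2" "p (\<i> * of_real t) = Complex (1 + \<delta>) t" for t
      using \<delta> by (auto simp: p_def complex_eq_iff)
    have dp: "((\<lambda>z. h (p z)) has_field_derivative D) (at z)" if "(h has_field_derivative D) (at (p z))" for h D z
      using that unfolding p_def by (simp add: DERIV_shift)
    have dk: "(k has_field_derivative (z * c * k z)) (at z)" for z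
      unfolding k_def by (auto intro!: derivative_eq_intros)
    have da: "(a has_field_derivative a1 z) (at z)" if "1 < Re (p z)" "Re (p z) < 2" for z
      unfolding a_def a1_def
      by (rule DERIV_cong[OF DERIV_mult[OF dp[OF G[OF that]] dk]]) (simp add: algebra_simps)
    have da1: "(a1 has_field_derivative a2 z) (at z)" if "1 < Re (p z)" "Re (p z) < 2" for z
      unfolding a1_def a2_def
      by (rule DERIV_cong[OF DERIV_mult[OF DERIV_add[OF dp[OF G1[OF that]] DERIV_mult[OF dp[OF G[OF that]] DERIV_cmult_right[OF DERIV_ident]]] dk]])
         (simp add: algebra_simps power2_eq_square)
    define e where "e = (\<lambda>t::real. exp (\<i> * of_real (u * t)))"
    have ne: "norm (e t) = 1" for t by (simp add: e_def)
    have de: "(e has_vector_derivative (\<i> * of_real u * e t)) (at t)" for t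
    proof -
      have "((\<lambda>z. exp (\<i> * of_real u * z)) has_field_derivative (\<i> * of_real u * exp (\<i> * of_real u * of_real t))) (at (of_real t))"
        by (auto intro!: derivative_eq_intros)
      from has_vector_derivative_real_field[OF this] show ?thesis by (simp add: e_def mult.assoc)
    qed
    have dv: "((\<lambda>t. h (\<i> * of_real t)) has_vector_derivative (\<i> * D)) (at t)"
      if "(h has_field_derivative D) (at (\<i> * of_real t))" for h D t
    proof -
      have "((\<lambda>z. h (\<i> * z)) has_field_derivative (D * \<i>)) (at (of_real t))"
        by (rule DERIV_chain2[where g = "\<lambda>z. \<i> * z"]) (use that in \<open>auto intro!: derivative_eq_intros\<close>)
      from has_vector_derivative_real_field[OF this] show ?thesis by (simp add: mult.commute)
    qed
    \<comment> \<open>Both integrations by parts at once. With A(t) = a(i t), the derivative of (A'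
      - i u A) e is (A'' + u^2 A) e, and A'' = - a2(i t). Since \<open>F\<close> vanishes at both
      ends, u^2 times the integral of a e equals that of a2 e.\<close>
    define F where "F = (\<lambda>t. (\<i> * a1 (\<i> * of_real t) - \<i> * of_real u * a (\<i> * of_real t)) * e t)"
    define f where "f = (\<lambda>t. (of_real (u\<^sup>2) * a (\<i> * of_real t) - a2 (\<i> * of_real t)) * e t)"
    have dF: "(F has_vector_derivative f t) (at t)" for t
    proof -
      have "(F has_vector_derivative (\<i> * a1 (\<i> * of_real t) - \<i> * of_real u * a (\<i> * of_real t)) * (\<i> * of_real u * e t)
          + (\<i> * (\<i> * a2 (\<i> * of_real t)) - \<i> * of_real u * (\<i> * a1 (\<i> * of_real t))) * e t) (at t)"
        unfolding F_def
        by (intro has_vector_derivative_mult has_vector_derivative_diff has_vector_derivative_mult_right dv da da1 p de)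
      also have "(\<i> * a1 (\<i> * of_real t) - \<i> * of_real u * a (\<i> * of_real t)) * (\<i> * of_real u * e t)
          + (\<i> * (\<i> * a2 (\<i> * of_real t)) - \<i> * of_real u * (\<i> * a1 (\<i> * of_real t))) * e t = f t"
        by (simp add: f_def algebra_simps power2_eq_square) 
      finally show ?thesis .
    qed
    have bound: "norm (a (\<i> * of_real t)) \<le> 128 * C * sqrt T * (1 + \<bar>t\<bar>) powr (-5/4)"
      "norm (a1 (\<i> * of_real t)) \<le> 128 * C * sqrt T * (1 + \<bar>t\<bar>) powr (-5/4)"
      "norm (a2 (\<i> * of_real t)) \<le> 128 * C * sqrt T * (1 + \<bar>t\<bar>) powr (-5/4)" for t
    proof -
      define v where "v = \<bar>t\<bar> / T"
      define g where "g = C * (1 + \<bar>t\<bar>) powr (-3/4)"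
      have v: "v \<ge> 0" using T by (simp add: v_def)
      have g: "g \<ge> 0" using C by (simp add: g_def)
      have gb: "norm (psi_transform (p (\<i> * of_real t))) \<le> g" "norm (G1 (p (\<i> * of_real t))) \<le> g" "norm (G2 (p (\<i> * of_real t))) \<le> g"
        using b0[OF p(1,2), of t] b1[OF p(1,2), of t] b2[OF p(1,2), of t] by (simp_all add: g_def p(3))
      have c1: "norm c \<le> 1" using T by (simp add: c_def norm_divide norm_power)
      have zc: "norm (\<i> * of_real t * c) \<le> v"
      proof -
        have "norm (\<i> * of_real t * c) = v * (1 / T)" using T by (simp add: c_def v_def norm_mult norm_divide norm_power power2_eq_square)
        also have "\<dots> \<le> v * 1" using v T by (intro mult_left_mono) auto
        finally show ?thesis by simp
      qed
      have zc2: "norm ((\<i> * of_real t)\<^sup>2 * c\<^sup>2) \<le> v\<^sup>2"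
        using power_mono[OF zc, of 2] by (simp add: power_mult_distrib norm_mult norm_power)
      have nk: "norm (k (\<i> * of_real t)) = exp (- v\<^sup>2 / 2)"
      proof -
        have "(\<i> * of_real t)\<^sup>2 * c / 2 = of_real (- v\<^sup>2 / 2)"
          using T by (simp add: c_def v_def power_mult_distrib power_divide)
        then show ?thesis by (simp add: k_def)
      qed
      have fin: "g * (2 + 2 * v + v\<^sup>2) * exp (- v\<^sup>2 / 2) \<le> 128 * C * sqrt T * (1 + \<bar>t\<bar>) powr (-5/4)"
      proof -
        \<comment> \<open>Because T >= 1, (1 + |t|) / T <= 1 + v, and sqrt (1 + v) <= 1 + v.\<close>
        have "1 / (1 + v) \<le> sqrt T * (1 + \<bar>t\<bar>) powr (-1/2)"
        proof -
          have vT: "(1 + \<bar>t\<bar>) / T \<le> 1 + v" using T by (simp add: v_def field_simps)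
          have "sqrt ((1 + \<bar>t\<bar>) / T) \<le> sqrt (1 + v)" using vT by simp
          also have "\<dots> \<le> 1 + v" using v real_le_lsqrt[of "1 + v" "1 + v"] by (simp add: power2_eq_square)
          finally have "1 / (1 + v) \<le> 1 / sqrt ((1 + \<bar>t\<bar>) / T)" using T v by (intro divide_left_mono) auto
          also have "\<dots> = sqrt T * (1 + \<bar>t\<bar>) powr (-1/2)"
            by (simp add: real_sqrt_divide powr_minus powr_half_sqrt field_simps)
          finally show ?thesis .
        qed
        then have "128 / (1 + v) \<le> 128 * (sqrt T * (1 + \<bar>t\<bar>) powr (-1/2))" by simp
        with poly_times_gaussian_le[OF v] have "(2 + 2 * v + v\<^sup>2) * exp (- v\<^sup>2 / 2) \<le> 128 * (sqrt T * (1 + \<bar>t\<bar>) powr (-1/2))" by linarith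
        then have "g * ((2 + 2 * v + v\<^sup>2) * exp (- v\<^sup>2 / 2)) \<le> g * (128 * (sqrt T * (1 + \<bar>t\<bar>) powr (-1/2)))"
          using g by (rule mult_left_mono)
        also have "\<dots> = 128 * C * sqrt T * ((1 + \<bar>t\<bar>) powr (-3/4) * (1 + \<bar>t\<bar>) powr (-1/2))" by (simp add: g_def)
        also have "(1 + \<bar>t\<bar>) powr (-3/4) * (1 + \<bar>t\<bar>) powr (-1/2) = (1 + \<bar>t\<bar>) powr (-5/4)"
          by (subst powr_add[symmetric]) simp
        finally show ?thesis by (simp add: mult.assoc)
      qed
      have step: "norm (w * k (\<i> * of_real t)) \<le> 128 * C * sqrt T * (1 + \<bar>t\<bar>) powr (-5/4)"
        if "norm w \<le> g * (2 + 2 * v + v\<^sup>2)" for w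
      proof -
        have "norm (w * k (\<i> * of_real t)) \<le> g * (2 + 2 * v + v\<^sup>2) * exp (- v\<^sup>2 / 2)"
          using that by (simp add: norm_mult nk mult_right_mono)
        also note fin
        finally show ?thesis .
      qed
      have x: "0 \<le> g * v" "0 \<le> g * v\<^sup>2" using g v by auto
      have m1: "norm (psi_transform (p (\<i> * of_real t)) * (\<i> * of_real t * c)) \<le> g * v"
        using gb(1) zc g unfolding norm_mult[of "psi_transform _"] by (intro mult_mono) auto
      have m2: "norm (2 * G1 (p (\<i> * of_real t)) * (\<i> * of_real t * c)) \<le> (2 * g) * v"
        using gb(2) zc g unfolding norm_mult[of "2 * G1 _"] by (intro mult_mono) (auto simp: norm_mult)
      have m3: "norm (psi_transform (p (\<i> * of_real t)) * (c + (\<i> * of_real t)\<^sup>2 * c\<^sup>2)) \<le> g * (1 + v\<^sup>2)"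
        using gb(1) g norm_triangle_ineq[of c "(\<i> * of_real t)\<^sup>2 * c\<^sup>2"] c1 zc2 unfolding norm_mult[of "psi_transform _"]
        by (intro mult_mono) auto
      show "norm (a (\<i> * of_real t)) \<le> 128 * C * sqrt T * (1 + \<bar>t\<bar>) powr (-5/4)"
        unfolding a_def
      proof (rule step)
        have "g * 1 \<le> g * (2 + 2 * v + v\<^sup>2)" using v zero_le_power2[of v] by (intro mult_left_mono g) linarith
        with gb(1) show "norm (psi_transform (p (\<i> * of_real t))) \<le> g * (2 + 2 * v + v\<^sup>2)" by linarith
      qed
      show "norm (a1 (\<i> * of_real t)) \<le> 128 * C * sqrt T * (1 + \<bar>t\<bar>) powr (-5/4)"
        unfolding a1_def
        by (rule step, rule order_trans[OF norm_triangle_ineq], rule order_trans[OF add_mono[OF gb(2) m1]])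
           (use x g in \<open>simp add: algebra_simps\<close>)
      show "norm (a2 (\<i> * of_real t)) \<le> 128 * C * sqrt T * (1 + \<bar>t\<bar>) powr (-5/4)"
        unfolding a2_def
        by (rule step, rule order_trans[OF norm_triangle_ineq], rule order_trans[OF add_mono[OF order_trans[OF norm_triangle_ineq add_mono[OF gb(3) m2]] m3]])
           (use x g in \<open>simp add: algebra_simps\<close>)
    qed
    let ?B = "\<lambda>t::real. 128 * C * sqrt T * (1 + \<bar>t\<bar>) powr (-5/4)"
    have iB: "integrable lborel ?B" by (intro integrable_mult_right iJ)
    have cont_p: "isCont h (p (\<i> * of_real t)) \<Longrightarrow> isCont (\<lambda>t. h (p (\<i> * of_real t))) t" for h and t :: real
      by (rule isCont_o2) (auto simp: p_def intro!: continuous_intros)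
    have ca: "isCont (\<lambda>t. a (\<i> * of_real t)) t" for t :: real
      by (rule isCont_o2[OF _ DERIV_isCont[OF da]]) (use p in \<open>auto intro!: continuous_intros\<close>)
    have oS: "open {s. 1 < Re s \<and> Re s < 2}"
      by (intro open_Collect_conj open_halfspace_Re_gt open_halfspace_Re_lt)
    have ca2: "isCont (\<lambda>t. a2 (\<i> * of_real t)) t" for t :: real
    proof -
      have "isCont G2 (p (\<i> * of_real t))" using cG2 oS p[of t] by (simp add: continuous_on_eq_continuous_at)
      moreover have "isCont G1 (p (\<i> * of_real t))" "isCont psi_transform (p (\<i> * of_real t))"
        using DERIV_isCont[OF G1[OF p(1,2)]] DERIV_isCont[OF G[OF p(1,2)]] by auto
      ultimately show ?thesis unfolding a2_def k_def
        by (intro continuous_intros cont_p) auto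
    qed
    have ce: "isCont e t" for t unfolding e_def by (intro continuous_intros)
    have bm: "h \<in> borel_measurable lborel" if "\<And>t. isCont h t" for h :: "real \<Rightarrow> complex"
      using that by (simp add: borel_measurable_continuous_onI continuous_at_imp_continuous_on)
    have ia: "integrable lborel (\<lambda>t. a (\<i> * of_real t) * e t)"
    proof (rule Bochner_Integration.integrable_bound[OF iB])
      show "(\<lambda>t. a (\<i> * of_real t) * e t) \<in> borel_measurable lborel"
        by (intro bm continuous_intros ca ce)
    qed (use bound(1) C T in \<open>simp add: norm_mult ne abs_mult\<close>)
    have ia2: "integrable lborel (\<lambda>t. a2 (\<i> * of_real t) * e t)"
    proof (rule Bochner_Integration.integrable_bound[OF iB])
      show "(\<lambda>t. a2 (\<i> * of_real t) * e t) \<in> borel_measurable lborel"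
        by (intro bm continuous_intros ca2 ce)
    qed (use bound(3) C T in \<open>simp add: norm_mult ne abs_mult\<close>)
    have f_eq: "f = (\<lambda>t. of_real (u\<^sup>2) * (a (\<i> * of_real t) * e t) - a2 (\<i> * of_real t) * e t)"
      by (simp add: f_def fun_eq_iff algebra_simps)
    have if': "integrable lborel f" unfolding f_eq
      by (intro Bochner_Integration.integrable_diff integrable_mult_right ia ia2)
    have F0: "norm (F t) \<le> (1 + u) * ?B t" for t
    proof -
      have "norm (F t) \<le> norm (a1 (\<i> * of_real t)) + u * norm (a (\<i> * of_real t))"
        unfolding F_def norm_mult ne using u
        by (simp add: norm_mult) (rule order_trans[OF norm_triangle_ineq4], simp add: norm_mult)
      also have "\<dots> \<le> ?B t + u * ?B t" using bound(1,2)[of t] u by (intro add_mono mult_left_mono) auto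
      finally show ?thesis by (simp add: algebra_simps)
    qed
    have "((\<lambda>t::real. (1 + u) * ?B t) \<longlongrightarrow> 0) at_top" by real_asymp
    with _ have lim_top: "(F \<longlongrightarrow> 0) at_top"
      by (rule Lim_null_comparison) (use F0 in auto)
    have "((\<lambda>t::real. (1 + u) * ?B t) \<longlongrightarrow> 0) at_bot" by real_asymp
    with _ have lim_bot: "(F \<longlongrightarrow> 0) at_bot"
      by (rule Lim_null_comparison) (use F0 in auto)
    have "(LBINT x=-\<infinity>..\<infinity>. f x) = 0 - 0"
    proof (rule interval_integral_FTC_integrable)
      show "(F has_vector_derivative f x) (at x)" for x by (rule dF)
      show "isCont f x" for x unfolding f_def by (intro continuous_intros ca ca2 ce)
      show "set_integrable lborel (einterval (-\<infinity>) \<infinity>) f" using if' by (simp add: set_integrable_def)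
      show "((F \<circ> real_of_ereal) \<longlongrightarrow> 0) (at_right (-\<infinity>))" using lim_bot unfolding ereal_tendsto_simps .
      show "((F \<circ> real_of_ereal) \<longlongrightarrow> 0) (at_left \<infinity>)" using lim_top unfolding ereal_tendsto_simps .
    qed auto
    then have "(\<integral>t. f t \<partial>lborel) = 0"
      by (simp add: interval_lebesgue_integral_def set_lebesgue_integral_def)
    then have id: "of_real (u\<^sup>2) * (\<integral>t. a (\<i> * of_real t) * e t \<partial>lborel) = (\<integral>t. a2 (\<i> * of_real t) * e t \<partial>lborel)"
      unfolding f_eq using ia ia2 by (subst (asm) Bochner_Integration.integral_diff) (auto simp del: of_real_power)
    have "norm (\<integral>t. a2 (\<i> * of_real t) * e t \<partial>lborel) \<le> (\<integral>t. ?B t \<partial>lborel)"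
      by (rule Bochner_Integration.integral_norm_bound_integral[OF ia2 iB]) (simp add: norm_mult ne bound(3)[simplified])
    also have "\<dots> = 128 * C * sqrt T * J" unfolding J_def by (rule integral_mult_right_zero)
    also have "\<dots> \<le> 128 * C * (J + 1) * sqrt T" using C T by (simp add: algebra_simps)
    finally have "u\<^sup>2 * norm (\<integral>t. a (\<i> * of_real t) * e t \<partial>lborel) \<le> 128 * C * (J + 1) * sqrt T"
      unfolding id[symmetric] norm_mult by (simp add: norm_power)
    then have "norm (\<integral>t. a (\<i> * of_real t) * e t \<partial>lborel) \<le> 128 * C * (J + 1) * sqrt T / u\<^sup>2"
      using u by (simp add: field_simps)
    moreover have "a (\<i> * of_real t) * e t = psi_transform (Complex (1 + \<delta>) t) * (of_real (exp (- t\<^sup>2 / (2 * T\<^sup>2))) * exp (\<i> * of_real (u * t)))" for t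
    proof -
      have "(\<i> * complex_of_real t)\<^sup>2 * c / 2 = of_real (- t\<^sup>2 / (2 * T\<^sup>2))"
        by (simp add: c_def power_mult_distrib)
      then show ?thesis by (simp add: a_def k_def e_def p(3) exp_of_real mult.assoc del: of_real_divide of_real_minus)
    qed
    ultimately show ?thesis by simp
  qed
  show ?thesis
    by (rule that[of "128 * C * (J + 1)"]) (use main C J0 in auto)
qed


section \<open>Removal of damping and smoothing; the prime number theorem with remainder\<close>

lemma psi_dev_bound: "\<bar>psi_dev y\<bar> \<le> \<bar>y\<bar> + 1"
  using psi_exp_le[of y] psi_exp_nonneg[of y] by (auto simp: psi_dev_def split: split_indicator)

text \<open>The bound does not depend on \<delta>, so it survives the limit \<delta> -> 0 by
  dominated convergence; the majorant (|y| + 1) times the normal density comes from the trivial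
  bound on \<open>psi_exp\<close>.\<close>

lemma psi_dev_gaussian:
  obtains C where "C > 0"
    "\<And>T u. T \<ge> 1 \<Longrightarrow> u > 0 \<Longrightarrow> integrable lborel (\<lambda>y. psi_dev y * normal_density u (1 / T) y)"
    "\<And>T u. T \<ge> 1 \<Longrightarrow> u > 0 \<Longrightarrow> \<bar>\<integral>y. psi_dev y * normal_density u (1 / T) y \<partial>lborel\<bar> \<le> C * sqrt T / u\<^sup>2"
proof -
  obtain C where C: "C > 0"
    "\<And>\<delta> T u. 0 < \<delta> \<Longrightarrow> \<delta> < 1 \<Longrightarrow> T \<ge> 1 \<Longrightarrow> u > 0 \<Longrightarrow>
      norm (\<integral>t. psi_transform (Complex (1 + \<delta>) t) * (of_real (exp (- t\<^sup>2 / (2 * T\<^sup>2))) * exp (\<i> * of_real (u * t))) \<partial>lborel)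
        \<le> C * sqrt T / u\<^sup>2"
    by (rule psi_transform_gaussian_bound) blast
  have int: "integrable lborel (\<lambda>y. (\<bar>y\<bar> + 1) * normal_density u (1 / T) y)" if "T \<ge> 1" for T u
  proof -
    have "integrable lborel (\<lambda>y. \<bar>normal_density u (1 / T) y * y\<bar> + normal_density u (1 / T) y)"
      using that by (intro Bochner_Integration.integrable_add integrable_abs integrable_normal_moment_nz_1 integrable_normal_density) auto
    then show ?thesis by (simp add: abs_mult algebra_simps)
  qed
  have le: "\<bar>psi_dev y * normal_density u (1 / T) y\<bar> \<le> (\<bar>y\<bar> + 1) * normal_density u (1 / T) y" for T u y
    by (simp add: abs_mult psi_dev_bound mult_right_mono)
  have int2: "integrable lborel (\<lambda>y. psi_dev y * normal_density u (1 / T) y)" if "T \<ge> 1" for T u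
    by (rule Bochner_Integration.integrable_bound[OF int[OF that]]) (use le in \<open>auto intro: order_trans[OF le]\<close>)
  have "\<bar>\<integral>y. psi_dev y * normal_density u (1 / T) y \<partial>lborel\<bar> \<le> C * sqrt T / u\<^sup>2" if T: "T \<ge> 1" and u: "u > 0" for T u
  proof -
    \<comment> \<open>The shift n + 2 keeps \<delta> = 1/(n + 2) strictly between 0 and 1 for every
      n.\<close>
    define I where "I = (\<lambda>n. \<integral>y. psi_dev y * exp (- (1 / real (n + 2)) * y) * normal_density u (1 / T) y \<partial>lborel)"
    have bd: "\<bar>I n\<bar> \<le> C * sqrt T / u\<^sup>2" for n
    proof -
      have T0: "T > 0" using T by simp
      have n2pi: "norm (complex_of_real (2 * pi)) = 2 * pi" by (simp add: norm_mult)
      have d: "0 < 1 / real (n + 2)" "1 / real (n + 2) < 1" by auto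
      have "\<bar>I n\<bar> = norm (complex_of_real (I n))" by simp
      also have "\<dots> \<le> (C * sqrt T / u\<^sup>2) / (2 * pi)"
        unfolding I_def psi_dev_smoothed[OF d(1) T0] norm_divide n2pi
        by (rule divide_right_mono[OF C(2)[OF d T u]]) simp
      also have "\<dots> \<le> (C * sqrt T / u\<^sup>2) / 1"
        using C T pi_ge_two by (intro divide_left_mono) auto
      finally show ?thesis by simp
    qed
    have "I \<longlonglongrightarrow> (\<integral>y. psi_dev y * normal_density u (1 / T) y \<partial>lborel)"
      unfolding I_def
    proof (rule integral_dominated_convergence[OF _ _ int[OF T]])
      show "AE y in lborel. (\<lambda>n. psi_dev y * exp (- (1 / real (n + 2)) * y) * normal_density u (1 / T) y) \<longlonglongrightarrow> psi_dev y * normal_density u (1 / T) y"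
      proof (intro AE_I2)
        fix y
        have "(\<lambda>n. 1 / real (n + 2)) \<longlonglongrightarrow> 0" by real_asymp
        then have "(\<lambda>n. psi_dev y * exp (- (1 / real (n + 2)) * y) * normal_density u (1 / T) y) \<longlonglongrightarrow> psi_dev y * exp (- 0 * y) * normal_density u (1 / T) y"
          by (intro tendsto_intros)
        then show "(\<lambda>n. psi_dev y * exp (- (1 / real (n + 2)) * y) * normal_density u (1 / T) y) \<longlonglongrightarrow> psi_dev y * normal_density u (1 / T) y" by simp
      qed
      show "AE y in lborel. norm (psi_dev y * exp (- (1 / real (n + 2)) * y) * normal_density u (1 / T) y) \<le> (\<bar>y\<bar> + 1) * normal_density u (1 / T) y" for n
      proof (intro AE_I2)
        fix y
        show "norm (psi_dev y * exp (- (1 / real (n + 2)) * y) * normal_density u (1 / T) y) \<le> (\<bar>y\<bar> + 1) * normal_density u (1 / T) y"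
        proof (cases "y \<ge> 0")
          case True
          have "norm (psi_dev y * exp (- (1 / real (n + 2)) * y) * normal_density u (1 / T) y) =
            exp (- (1 / real (n + 2)) * y) * \<bar>psi_dev y * normal_density u (1 / T) y\<bar>" by (simp add: abs_mult)
          also have "\<dots> \<le> 1 * ((\<bar>y\<bar> + 1) * normal_density u (1 / T) y)"
            using True by (intro mult_mono le) auto
          finally show ?thesis by simp
        qed (simp add: psi_dev_def)
      qed
    qed measurable
    then have "(\<lambda>n. \<bar>I n\<bar>) \<longlonglongrightarrow> \<bar>\<integral>y. psi_dev y * normal_density u (1 / T) y \<partial>lborel\<bar>" by (rule tendsto_rabs)
    then show ?thesis by (rule LIMSEQ_le_const2) (use bd in auto)
  qed
  with int2 C(1) show ?thesis using that by blast
qed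

lemma normal_second_moment:
  assumes "\<sigma> > 0"
  shows "integrable lborel (\<lambda>y. normal_density \<mu> \<sigma> y * (y - \<mu>)\<^sup>2)"
    and "(\<integral>y. normal_density \<mu> \<sigma> y * (y - \<mu>)\<^sup>2 \<partial>lborel) = \<sigma>\<^sup>2"
  using normal_moment_even[OF assms, of \<mu> 1] assms
  by (auto simp: has_bochner_integral_iff fact_numeral)

text \<open>\<open>psi_exp\<close> is \<open>psi_dev\<close> plus the indicator of the nonnegative
  axis. The Gaussian centred at u has at most mass 1/(u T)^2 on the negative axis, which is the
  extra loss in the lower bound.\<close>

lemma psi_exp_smoothed:
  obtains C where "C > 0"
    "\<And>T u. T \<ge> 1 \<Longrightarrow> u > 0 \<Longrightarrow> integrable lborel (\<lambda>y. psi_exp y * normal_density u (1 / T) y)"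
    "\<And>T u. T \<ge> 1 \<Longrightarrow> u > 0 \<Longrightarrow> (\<integral>y. psi_exp y * normal_density u (1 / T) y \<partial>lborel) \<le> 1 + C * sqrt T / u\<^sup>2"
    "\<And>T u. T \<ge> 1 \<Longrightarrow> u > 0 \<Longrightarrow> (\<integral>y. psi_exp y * normal_density u (1 / T) y \<partial>lborel) \<ge> 1 - C * sqrt T / u\<^sup>2 - 1 / (u * T)\<^sup>2"
proof -
  obtain C where C: "C > 0"
    "\<And>T u. T \<ge> 1 \<Longrightarrow> u > 0 \<Longrightarrow> integrable lborel (\<lambda>y. psi_dev y * normal_density u (1 / T) y)"
    "\<And>T u. T \<ge> 1 \<Longrightarrow> u > 0 \<Longrightarrow> \<bar>\<integral>y. psi_dev y * normal_density u (1 / T) y \<partial>lborel\<bar> \<le> C * sqrt T / u\<^sup>2"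
    by (rule psi_dev_gaussian) blast
  have *: "integrable lborel (\<lambda>y. psi_exp y * normal_density u (1 / T) y)
    \<and> (\<integral>y. psi_exp y * normal_density u (1 / T) y \<partial>lborel) \<le> 1 + C * sqrt T / u\<^sup>2
    \<and> (\<integral>y. psi_exp y * normal_density u (1 / T) y \<partial>lborel) \<ge> 1 - C * sqrt T / u\<^sup>2 - 1 / (u * T)\<^sup>2"
    if T: "T \<ge> 1" and u: "u > 0" for T u
  proof -
    let ?n = "normal_density u (1 / T)"
    have s: "1 / T > 0" using T by simp
    have n: "integrable lborel ?n" "(\<integral>y. ?n y \<partial>lborel) = 1" using s by auto
    have i1: "integrable lborel (\<lambda>y. indicator {0..} y * ?n y)"
      by (rule Bochner_Integration.integrable_bound[OF n(1)]) (auto split: split_indicator)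
    have eq: "psi_exp y * ?n y = psi_dev y * ?n y + indicator {0..} y * ?n y" for y
      by (auto simp: psi_dev_def psi_exp_neg algebra_simps split: split_indicator)
    have int: "integrable lborel (\<lambda>y. psi_exp y * ?n y)"
      unfolding eq by (intro Bochner_Integration.integrable_add C(2) T u i1)
    have I: "(\<integral>y. psi_exp y * ?n y \<partial>lborel) = (\<integral>y. psi_dev y * ?n y \<partial>lborel) + (\<integral>y. indicator {0..} y * ?n y \<partial>lborel)"
      unfolding eq by (intro Bochner_Integration.integral_add C(2) T u i1)
    have up: "(\<integral>y. indicator {0..} y * ?n y \<partial>lborel) \<le> 1"
    proof -
      have "(\<integral>y. indicator {0..} y * ?n y \<partial>lborel) \<le> (\<integral>y. ?n y \<partial>lborel)"
        by (intro integral_mono i1 n) (auto split: split_indicator)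
      then show ?thesis using n by simp
    qed
    have lo: "(\<integral>y. indicator {0..} y * ?n y \<partial>lborel) \<ge> 1 - 1 / (u * T)\<^sup>2"
    proof -
      have "1 - 1 / (u * T)\<^sup>2 = (\<integral>y. ?n y - (?n y * (y - u)\<^sup>2) / u\<^sup>2 \<partial>lborel)"
        using n normal_second_moment[OF s, of u] u
        by (subst Bochner_Integration.integral_diff) (auto simp: power_mult_distrib power_divide)
      also have "\<dots> \<le> (\<integral>y. indicator {0..} y * ?n y \<partial>lborel)"
      proof (intro integral_mono i1)
        show "integrable lborel (\<lambda>y. ?n y - (?n y * (y - u)\<^sup>2) / u\<^sup>2)"
          by (intro Bochner_Integration.integrable_diff integrable_divide n normal_second_moment s)
        fix y
        \<comment> \<open>Chebyshev's inequality in pointwise form: a parabola below the indicator,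
          integrated by means of the second moment.\<close>
        have "1 - (y - u)\<^sup>2 / u\<^sup>2 \<le> indicator {0..} y"
        proof (cases "y \<ge> 0")
          case False
          then have "u\<^sup>2 \<le> (y - u)\<^sup>2" using u by (simp add: abs_le_square_iff[symmetric])
          then show ?thesis using False u by simp
        qed simp
        then have "?n y * (1 - (y - u)\<^sup>2 / u\<^sup>2) \<le> ?n y * indicator {0..} y" by (intro mult_left_mono) auto
        then show "?n y - (?n y * (y - u)\<^sup>2) / u\<^sup>2 \<le> indicator {0..} y * ?n y" by (simp add: algebra_simps)
      qed
      finally show ?thesis .
    qed
    show ?thesis using int I up lo C(3)[OF T u] by linarith
  qed
  then show ?thesis using that C(1) by blast
qed

text \<open>Monotonicity of \<open>\<psi>\<close> compares the smoothed value at \<open>u \<plusminus> h\<close> with \<open>\<psi>(e\<^sup>u)\<close>; the tails of the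
  Gaussian are controlled by its second moment.\<close>

lemma psi_exp_upper:
  assumes h: "h > 0" and s: "\<sigma> > 0"
    and int: "integrable lborel (\<lambda>y. psi_exp y * normal_density (u + h) \<sigma> y)"
  shows "psi_exp u * exp (- 2 * h) * (1 - (\<sigma> / h)\<^sup>2) \<le> (\<integral>y. psi_exp y * normal_density (u + h) \<sigma> y \<partial>lborel)"
proof -
  let ?n = "normal_density (u + h) \<sigma>" and ?c = "psi_exp u * exp (- 2 * h)"
  have n: "integrable lborel ?n" "(\<integral>y. ?n y \<partial>lborel) = 1" using s by auto
  have "?c * (1 - (\<sigma> / h)\<^sup>2) = (\<integral>y. ?c * (?n y - (?n y * (y - (u + h))\<^sup>2) / h\<^sup>2) \<partial>lborel)"
    using n normal_second_moment[OF s, of "u + h"]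
    by (subst integral_mult_right_zero, subst Bochner_Integration.integral_diff) (auto simp: power_divide)
  also have "\<dots> \<le> (\<integral>y. psi_exp y * ?n y \<partial>lborel)"
  proof (intro integral_mono int)
    show "integrable lborel (\<lambda>y. ?c * (?n y - (?n y * (y - (u + h))\<^sup>2) / h\<^sup>2))"
      by (intro integrable_mult_right Bochner_Integration.integrable_diff integrable_divide n normal_second_moment s)
    fix y
    have "?c * (1 - (y - (u + h))\<^sup>2 / h\<^sup>2) \<le> psi_exp y"
    proof (cases "\<bar>y - (u + h)\<bar> \<le> h")
      case True
      have "psi_exp u \<le> psi_exp y * exp (y - u)" using True by (intro psi_exp_le_shift) auto
      also have "\<dots> \<le> psi_exp y * exp (2 * h)" using True by (intro mult_left_mono psi_exp_nonneg) auto
      finally have "?c \<le> psi_exp y" by (simp add: exp_minus field_simps)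
      moreover have "?c * (1 - (y - (u + h))\<^sup>2 / h\<^sup>2) \<le> ?c * 1" by (intro mult_left_mono) (auto simp: psi_exp_nonneg)
      ultimately show ?thesis by simp
    next
      case False
      then have "h\<^sup>2 \<le> (y - (u + h))\<^sup>2" using h by (simp add: abs_le_square_iff[symmetric])
      then have "1 - (y - (u + h))\<^sup>2 / h\<^sup>2 \<le> 0" using h by simp
      then have "?c * (1 - (y - (u + h))\<^sup>2 / h\<^sup>2) \<le> 0" by (intro mult_nonneg_nonpos) (auto simp: psi_exp_nonneg)
      then show ?thesis using psi_exp_nonneg[of y] by linarith
    qed
    then have "(?c * (1 - (y - (u + h))\<^sup>2 / h\<^sup>2)) * ?n y \<le> psi_exp y * ?n y" by (intro mult_right_mono) auto
    then show "?c * (?n y - (?n y * (y - (u + h))\<^sup>2) / h\<^sup>2) \<le> psi_exp y * ?n y" by (simp add: algebra_simps)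
  qed
  finally show ?thesis .
qed

text \<open>Beyond distance h the integrand has to be bounded from above, hence the global bound
  \<open>B\<close>; in the opposite estimate that part is dropped by positivity.\<close>

lemma psi_exp_lower:
  assumes h: "h > 0" and s: "\<sigma> > 0" and B: "\<And>y. psi_exp y \<le> B"
    and int: "integrable lborel (\<lambda>y. psi_exp y * normal_density (u - h) \<sigma> y)"
  shows "(\<integral>y. psi_exp y * normal_density (u - h) \<sigma> y \<partial>lborel) \<le> psi_exp u * exp (2 * h) + B * (\<sigma> / h)\<^sup>2"
proof -
  let ?n = "normal_density (u - h) \<sigma>" and ?c = "psi_exp u * exp (2 * h)"
  have n: "integrable lborel ?n" "(\<integral>y. ?n y \<partial>lborel) = 1" using s by auto
  have B0: "B \<ge> 0" using B[of 0] psi_exp_nonneg[of 0] by linarith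
  have "(\<integral>y. psi_exp y * ?n y \<partial>lborel) \<le> (\<integral>y. ?c * ?n y + B / h\<^sup>2 * (?n y * (y - (u - h))\<^sup>2) \<partial>lborel)"
  proof (intro integral_mono int)
    show "integrable lborel (\<lambda>y. ?c * ?n y + B / h\<^sup>2 * (?n y * (y - (u - h))\<^sup>2))"
      by (intro integrable_mult_right Bochner_Integration.integrable_add n normal_second_moment s)
    fix y
    have "psi_exp y \<le> ?c + B / h\<^sup>2 * (y - (u - h))\<^sup>2"
    proof (cases "\<bar>y - (u - h)\<bar> \<le> h")
      case True
      have "psi_exp y \<le> psi_exp u * exp (u - y)" using True by (intro psi_exp_le_shift) auto
      also have "\<dots> \<le> ?c" using True by (intro mult_left_mono psi_exp_nonneg) auto
      finally show ?thesis using B0 by (simp add: add_increasing2)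
    next
      case False
      then have "h\<^sup>2 \<le> (y - (u - h))\<^sup>2" using h by (simp add: abs_le_square_iff[symmetric])
      then have "B / h\<^sup>2 * h\<^sup>2 \<le> B / h\<^sup>2 * (y - (u - h))\<^sup>2" using B0 by (intro mult_left_mono) auto
      then have "B \<le> B / h\<^sup>2 * (y - (u - h))\<^sup>2" using h by simp
      moreover have "?c \<ge> 0" by (simp add: psi_exp_nonneg)
      ultimately show ?thesis using B[of y] by linarith
    qed
    then have "psi_exp y * ?n y \<le> (?c + B / h\<^sup>2 * (y - (u - h))\<^sup>2) * ?n y" by (intro mult_right_mono) auto
    then show "psi_exp y * ?n y \<le> ?c * ?n y + B / h\<^sup>2 * (?n y * (y - (u - h))\<^sup>2)" by (simp add: algebra_simps)
  qed
  also have "\<dots> = ?c + B * (\<sigma> / h)\<^sup>2"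
    using n normal_second_moment[OF s, of "u - h"]
    by (subst Bochner_Integration.integral_add) (auto simp: power_divide)
  finally show ?thesis .
qed


text \<open>Bootstrap from the one-sided estimate alone: smoothing at the fixed scale T = 1 already
  yields the bound that \<open>psi_exp_lower\<close> presupposes.\<close>

lemma psi_exp_bounded:
  obtains B where "B > 0" "\<And>u. psi_exp u \<le> B"
proof -
  obtain C where C: "C > 0"
    "\<And>T u. T \<ge> 1 \<Longrightarrow> u > 0 \<Longrightarrow> integrable lborel (\<lambda>y. psi_exp y * normal_density u (1 / T) y)"
    "\<And>T u. T \<ge> 1 \<Longrightarrow> u > 0 \<Longrightarrow> (\<integral>y. psi_exp y * normal_density u (1 / T) y \<partial>lborel) \<le> 1 + C * sqrt T / u\<^sup>2"
    by (rule psi_exp_smoothed) blast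
  have "psi_exp u \<le> 2 * exp 4 * (1 + C)" for u
  proof (cases "u < 0")
    case True
    then show ?thesis using C(1) by (simp add: psi_exp_neg)
  next
    case False
    \<comment> \<open>Shift h = 2 against width 1 leaves the positive factor 1 - (1/2)^2 =
      3/4.\<close>
    have "psi_exp u * exp (- 2 * 2) * (1 - (1 / 2)\<^sup>2) \<le> (\<integral>y. psi_exp y * normal_density (u + 2) 1 y \<partial>lborel)"
      using C(2)[of 1 "u + 2"] False by (intro psi_exp_upper) auto
    also have "\<dots> \<le> 1 + C * sqrt 1 / (u + 2)\<^sup>2" using C(3)[of 1 "u + 2"] False by simp
    also have "\<dots> \<le> 1 + C"
    proof -
      have "(1::real)\<^sup>2 \<le> (u + 2)\<^sup>2" using False by (intro power_mono) auto
      then show ?thesis using C(1) False by (simp add: divide_le_eq mult_le_cancel_left1)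
    qed
    finally have "psi_exp u * exp (- 4) * (3 / 4) \<le> 1 + C" by (simp add: power2_eq_square)
    then have "psi_exp u \<le> 4 / 3 * exp 4 * (1 + C)" by (simp add: exp_minus field_simps)
    also have "\<dots> \<le> 2 * exp 4 * (1 + C)" using C(1) by (intro mult_right_mono) auto
    finally show ?thesis .
  qed
  moreover have "2 * exp 4 * (1 + C) > 0" using C(1) by simp
  ultimately show ?thesis using that by blast
qed

text \<open>The shift is h = x = 1/u. For u >= 4 one has x <= 1/4 and u - x >= u/2, so both shifted
  centres are comparable with u; smaller u are covered by enlarging the constant.\<close>

lemma psi_exp_asymp:
  obtains K where "K > 0" "\<And>u. u > 0 \<Longrightarrow> \<bar>psi_exp u - 1\<bar> \<le> K / u"
proof -
  obtain C where C: "C > 0"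
    "\<And>T u. T \<ge> 1 \<Longrightarrow> u > 0 \<Longrightarrow> integrable lborel (\<lambda>y. psi_exp y * normal_density u (1 / T) y)"
    "\<And>T u. T \<ge> 1 \<Longrightarrow> u > 0 \<Longrightarrow> (\<integral>y. psi_exp y * normal_density u (1 / T) y \<partial>lborel) \<le> 1 + C * sqrt T / u\<^sup>2"
    "\<And>T u. T \<ge> 1 \<Longrightarrow> u > 0 \<Longrightarrow> (\<integral>y. psi_exp y * normal_density u (1 / T) y \<partial>lborel) \<ge> 1 - C * sqrt T / u\<^sup>2 - 1 / (u * T)\<^sup>2"
    by (rule psi_exp_smoothed) blast
  obtain B where B: "B > 0" "\<And>u. psi_exp u \<le> B" by (rule psi_exp_bounded) blast
  have large: "\<bar>psi_exp u - 1\<bar> \<le> (4 * C + 4 + 5 * B) / u" if u: "u \<ge> 4" for u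
  proof -
    define x where "x = 1 / u"
    have x: "0 < x" "x \<le> 1 / 4" using u by (auto simp: x_def field_simps)
    \<comment> \<open>With T = u^(3/2) the tail (1/(T x))^2 equals u^2 / u^3 = x, and the crude
      \<open>sqrt T \<le> u\<close> already makes sqrt T / u^2 at most x.\<close>
    define T where "T = u * sqrt u"
    have su: "1 \<le> sqrt u" "sqrt u \<le> u" using u real_le_lsqrt[of u u] by (auto simp: power2_eq_square)
    have T1: "T \<ge> 1" using mult_mono[of 1 u 1 "sqrt u"] u su by (simp add: T_def)
    have T2: "T\<^sup>2 = u ^ 3" using u by (simp add: T_def power_mult_distrib eval_nat_numeral)
    have sT: "sqrt T \<le> u" using u su by (intro real_le_lsqrt) (auto simp: T_def power2_eq_square)
    have "(1 / T / x)\<^sup>2 = u\<^sup>2 / T\<^sup>2" by (simp add: x_def power_divide)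
    also have "\<dots> = x" unfolding T2 using u by (simp add: x_def eval_nat_numeral)
    finally have rat: "(1 / T / x)\<^sup>2 = x" .
    have f: "psi_exp u \<ge> 0" "psi_exp u \<le> B" by (auto simp: psi_exp_nonneg B)
    have "psi_exp u * exp (- 2 * x) * (1 - (1 / T / x)\<^sup>2) \<le> (\<integral>y. psi_exp y * normal_density (u + x) (1 / T) y \<partial>lborel)"
      using T1 x u by (intro psi_exp_upper C(2)) auto
    also have "\<dots> \<le> 1 + C * sqrt T / (u + x)\<^sup>2" using T1 x u by (intro C(3)) auto
    also have "C * sqrt T / (u + x)\<^sup>2 \<le> C * u / u\<^sup>2"
      using C(1) sT x u T1 by (intro frac_le mult_mono power_mono) auto
    also have "C * u / u\<^sup>2 = C * x" using u by (simp add: x_def power2_eq_square)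
    finally have 1: "psi_exp u * exp (- 2 * x) * (1 - x) \<le> 1 + C * x" unfolding rat by simp
    have "1 - 3 * x \<le> (1 - 2 * x) * (1 - x)" by (simp add: algebra_simps)
    also have "\<dots> \<le> exp (- 2 * x) * (1 - x)"
      using exp_ge_add_one_self[of "- 2 * x"] x by (intro mult_right_mono) auto
    finally have "psi_exp u * (1 - 3 * x) \<le> psi_exp u * (exp (- 2 * x) * (1 - x))"
      using f by (intro mult_left_mono) auto
    then have "psi_exp u * (1 - 3 * x) \<le> 1 + C * x" using 1 by (simp add: mult.assoc)
    moreover have "psi_exp u * x \<le> B * x" using f x by (intro mult_right_mono) auto
    ultimately have up: "psi_exp u \<le> 1 + C * x + 3 * (B * x)" by (simp add: algebra_simps)
    have ux: "u / 2 \<le> u - x" "u - x > 0" using x u by auto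
    have "1 - C * sqrt T / (u - x)\<^sup>2 - 1 / ((u - x) * T)\<^sup>2 \<le> (\<integral>y. psi_exp y * normal_density (u - x) (1 / T) y \<partial>lborel)"
      using T1 ux by (intro C(4)) auto
    also have "\<dots> \<le> psi_exp u * exp (2 * x) + B * (1 / T / x)\<^sup>2"
      using T1 x ux B by (intro psi_exp_lower C(2)) auto
    also have "exp (2 * x) \<le> 1 + 4 * x"
    proof -
      have "x * x \<le> 1 / 4 * x" using x by (intro mult_right_mono) auto
      moreover have "exp (2 * x) \<le> 1 + 2 * x + 4 * (x * x)"
        using exp_bound[of "2 * x"] x by (simp add: power2_eq_square)
      ultimately show ?thesis using x by linarith
    qed
    finally have 2: "1 - C * sqrt T / (u - x)\<^sup>2 - 1 / ((u - x) * T)\<^sup>2 \<le> psi_exp u * (1 + 4 * x) + B * x"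
      using f unfolding rat by (simp add: mult_left_mono)
    have "C * sqrt T / (u - x)\<^sup>2 \<le> C * u / (u / 2)\<^sup>2"
      using C(1) sT ux u T1 by (intro frac_le mult_mono power_mono) auto
    also have "\<dots> = 4 * (C * x)" using u by (simp add: x_def power2_eq_square)
    finally have 3: "C * sqrt T / (u - x)\<^sup>2 \<le> 4 * (C * x)" .
    have "1 / ((u - x) * T)\<^sup>2 \<le> 1 / ((u / 2) * 1)\<^sup>2"
      using ux u T1 by (intro divide_left_mono power_mono mult_mono mult_pos_pos) auto
    also have "\<dots> = 4 * (x * x)" by (simp add: x_def power2_eq_square)
    also have "\<dots> \<le> 4 * (x * 1)" using x by (intro mult_left_mono) auto
    finally have 4: "1 / ((u - x) * T)\<^sup>2 \<le> 4 * x" by simp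
    have "psi_exp u * (1 + 4 * x) \<le> psi_exp u + 4 * (B * x)"
      using \<open>psi_exp u * x \<le> B * x\<close> by (simp add: algebra_simps)
    with 2 3 4 have lo: "psi_exp u \<ge> 1 - 4 * (C * x) - 4 * x - 5 * (B * x)" by linarith
    have nn: "0 \<le> C * x" "0 \<le> B * x" using C(1) B(1) x by auto
    have "(4 * C + 4 + 5 * B) / u = 4 * (C * x) + 4 * x + 5 * (B * x)"
      by (simp add: x_def add_divide_distrib)
    then show ?thesis using up lo nn x unfolding abs_le_iff by linarith
  qed
  have "\<bar>psi_exp u - 1\<bar> \<le> (4 * C + 8 + 9 * B) / u" if u: "u > 0" for u
  proof (cases "u \<ge> 4")
    case True
    have "(4 * C + 4 + 5 * B) / u \<le> (4 * C + 8 + 9 * B) / u" using u B C by (intro divide_right_mono) auto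
    then show ?thesis using large[OF True] by linarith
  next
    case False
    have "\<bar>psi_exp u - 1\<bar> \<le> B + 1" using psi_exp_nonneg[of u] B(2)[of u] B(1) by linarith
    also have "\<dots> \<le> (4 * C + 8 + 9 * B) / 4" using B C by simp
    also have "\<dots> \<le> (4 * C + 8 + 9 * B) / u" using False u B C by (intro divide_left_mono) auto
    finally show ?thesis .
  qed
  then show ?thesis using that[of "4 * C + 8 + 9 * B"] B C by simp
qed

lemma primes_psi_asymp:
  obtains K where "K > 0" "\<And>x. x > 1 \<Longrightarrow> \<bar>primes_psi x - x\<bar> \<le> K * x / ln x"
proof -
  obtain K where K: "K > 0" "\<And>u. u > 0 \<Longrightarrow> \<bar>psi_exp u - 1\<bar> \<le> K / u"
    by (rule psi_exp_asymp) blast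
  have "\<bar>primes_psi x - x\<bar> \<le> K * x / ln x" if x: "x > 1" for x
  proof -
    have "psi_exp (ln x) = primes_psi x / x" using x by (simp add: psi_exp_def exp_minus field_simps)
    then have "\<bar>primes_psi x / x - 1\<bar> \<le> K / ln x" using K(2)[of "ln x"] x by simp
    moreover have "primes_psi x / x - 1 = (primes_psi x - x) / x" using x by (simp add: field_simps)
    ultimately show ?thesis using x by (simp add: field_simps)
  qed
  with K(1) show ?thesis using that by blast
qed

section \<open>Pairs of primes\<close>


definition primes_theta :: "nat \<Rightarrow> real" where
  "primes_theta n = (\<Sum>p | prime p \<and> p \<le> n. ln (real p))"

lemma finite_primes_le [simp]: "finite {p::nat. prime p \<and> p \<le> n}"
  by (rule finite_subset[of _ "{..n}"]) auto

text \<open>A power p^k <= n with k >= 2 has p <= sqrt n, and k <= 2 ln n because ln 2 >=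
  1/2.\<close>

lemma card_proper_primepows:
  assumes "n \<ge> 1"
  shows "real (card {m\<in>{1..n}. primepow m \<and> \<not> prime m}) \<le> sqrt (real n) * (2 * ln (real n))"
proof -
  define A where "A = {1..nat \<lfloor>sqrt (real n)\<rfloor>} \<times> {1..nat \<lfloor>2 * ln (real n)\<rfloor>}"
  have "{m\<in>{1..n}. primepow m \<and> \<not> prime m} \<subseteq> (\<lambda>(p, k). p ^ k) ` A"
  proof
    fix m assume m: "m \<in> {m\<in>{1..n}. primepow m \<and> \<not> prime m}"
    then obtain p k where pk: "prime p" "k > 0" "m = p ^ k" by (auto simp: primepow_def)
    with m have k2: "k \<ge> 2" by (cases "k = 1") auto
    have p2: "p \<ge> 2" using pk prime_ge_2_nat by blast
    have "p ^ 2 \<le> p ^ k" using k2 p2 by (intro power_increasing) auto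
    then have "p ^ 2 \<le> n" using m pk by auto
    then have "real p ^ 2 \<le> real n" by (metis of_nat_le_iff of_nat_power)
    then have "real p \<le> sqrt (real n)" by (rule real_le_rsqrt)
    then have 1: "p \<le> nat \<lfloor>sqrt (real n)\<rfloor>" by (simp add: le_nat_floor)
    have "2 ^ k \<le> p ^ k" using p2 by (rule power_mono) auto
    moreover have "p ^ k \<le> n" using m pk by auto
    ultimately have "2 ^ k \<le> n" by linarith
    then have "(2::real) ^ k \<le> real n" by (metis of_nat_le_iff of_nat_numeral of_nat_power)
    then have "ln ((2::real) ^ k) \<le> ln (real n)" using assms by (subst ln_le_cancel_iff) auto
    then have "real k * ln 2 \<le> ln (real n)" by (simp add: ln_realpow)
    moreover have "real k * (1/2) \<le> real k * ln 2" using ln2_ge_two_thirds by (intro mult_left_mono) auto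
    ultimately have "real k \<le> 2 * ln (real n)" by linarith
    then have 2: "k \<le> nat \<lfloor>2 * ln (real n)\<rfloor>" by (simp add: le_nat_floor)
    show "m \<in> (\<lambda>(p, k). p ^ k) ` A"
      unfolding A_def using 1 2 pk p2 by (intro image_eqI[of _ _ "(p, k)"]) auto
  qed
  then have "card {m\<in>{1..n}. primepow m \<and> \<not> prime m} \<le> card A"
    by (rule surj_card_le[rotated]) (simp add: A_def)
  also have "card A = nat \<lfloor>sqrt (real n)\<rfloor> * nat \<lfloor>2 * ln (real n)\<rfloor>" by (simp add: A_def)
  finally have "real (card {m\<in>{1..n}. primepow m \<and> \<not> prime m}) \<le> real (nat \<lfloor>sqrt (real n)\<rfloor>) * real (nat \<lfloor>2 * ln (real n)\<rfloor>)"
    by (metis of_nat_le_iff of_nat_mult)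
  also have "\<dots> \<le> sqrt (real n) * (2 * ln (real n))"
    using assms by (intro mult_mono of_nat_floor) auto
  finally show ?thesis .
qed

lemma primes_psi_theta:
  assumes "n \<ge> 1"
  shows "\<bar>primes_psi (real n) - primes_theta n\<bar> \<le> 2 * sqrt (real n) * (ln (real n))\<^sup>2"
proof -
  let ?A = "{m\<in>{1..n}. primepow m \<and> \<not> prime m}"
  have "primes_psi (real n) = (\<Sum>m\<in>{p. prime p \<and> p \<le> n} \<union> ?A. mangoldt m)"
    unfolding primes_psi_def
    by (rule sum.mono_neutral_right) (auto simp: mangoldt_def dest: prime_gt_0_nat)
  also have "\<dots> = (\<Sum>m | prime m \<and> m \<le> n. mangoldt m) + (\<Sum>m\<in>?A. mangoldt m)"
    by (rule sum.union_disjoint) auto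
  also have "(\<Sum>m | prime m \<and> m \<le> n. mangoldt m) = primes_theta n"
    unfolding primes_theta_def by (intro sum.cong) auto
  finally have eq: "primes_psi (real n) - primes_theta n = (\<Sum>m\<in>?A. mangoldt m)" by simp
  have "(\<Sum>m\<in>?A. mangoldt m) \<le> (\<Sum>m\<in>?A. ln (real n))"
  proof (rule sum_mono)
    fix m assume "m \<in> ?A"
    then have "ln (real m) \<le> ln (real n)" by auto
    then show "mangoldt m \<le> ln (real n)" using mangoldt_le_ln[of m] by linarith
  qed
  also have "\<dots> = real (card ?A) * ln (real n)" by simp
  also have "\<dots> \<le> sqrt (real n) * (2 * ln (real n)) * ln (real n)"
    using assms by (intro mult_right_mono card_proper_primepows) auto
  finally have "(\<Sum>m\<in>?A. mangoldt m) \<le> 2 * sqrt (real n) * (ln (real n))\<^sup>2" by (simp add: power2_eq_square mult_ac)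
  moreover have "(\<Sum>m\<in>?A. mangoldt m) \<ge> (0::real)" by (intro sum_nonneg mangoldt_nonneg)
  ultimately show ?thesis unfolding eq by simp
qed

text \<open>From ln (y/x) <= y/x - 1 together with ln x >= 1; the threshold 3 exceeds e.\<close>

lemma x_over_ln_mono:
  assumes "3 \<le> x" "x \<le> (y::real)"
  shows "x / ln x \<le> y / ln y"
proof -
  have "ln x \<ge> 1" using assms exp_le by (subst ln_ge_iff) auto
  moreover have "ln y = ln x + ln (y / x)" using assms by (simp add: ln_div)
  moreover have "ln (y / x) \<le> y / x - 1" using assms by (intro ln_le_minus_one) auto
  ultimately have "x * ln y \<le> x * (ln x + (y / x - 1))" using assms by (intro mult_left_mono) auto
  also have "\<dots> = x * ln x + (y - x) * 1" using assms by (simp add: field_simps)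
  also have "\<dots> \<le> x * ln x + (y - x) * ln x" using assms \<open>ln x \<ge> 1\<close> by (intro add_left_mono mult_left_mono) auto
  finally have "x * ln y \<le> y * ln x" by (simp add: algebra_simps)
  moreover have "ln y > 0" "ln x > 0" using assms by auto
  ultimately show ?thesis by (simp add: field_simps)
qed

text \<open>The error is measured by n for every m <= n, because the convolution evaluates \<theta>
  at all arguments n - p, small ones included. Those below \<open>M\<close> are absorbed into the
  constant since n / ln n >= 1.\<close>

lemma primes_theta_asymp:
  obtains K where "K \<ge> 1" "\<And>m n. m \<le> n \<Longrightarrow> n \<ge> 3 \<Longrightarrow> \<bar>primes_theta m - real m\<bar> \<le> K * real n / ln (real n)"
proof -
  obtain K where K: "K > 0" "\<And>x. x > 1 \<Longrightarrow> \<bar>primes_psi x - x\<bar> \<le> K * x / ln x"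
    by (rule primes_psi_asymp) blast
  have "(\<lambda>x::real. 2 * sqrt x * (ln x)\<^sup>2) \<in> O(\<lambda>x. x / ln x)" by real_asymp
  then obtain c where c: "c > 0" "eventually (\<lambda>x. norm (2 * sqrt x * (ln x)\<^sup>2) \<le> c * norm (x / ln x)) at_top"
    by (elim landau_o.bigE)
  then obtain N where N: "\<And>x. x \<ge> N \<Longrightarrow> norm (2 * sqrt x * (ln x)\<^sup>2) \<le> c * norm (x / ln x)"
    by (auto simp: eventually_at_top_linorder)
  define M where "M = max 3 (nat \<lceil>N\<rceil>)"
  define C where "C = Max (insert 1 ((\<lambda>m. \<bar>primes_theta m - real m\<bar>) ` {..M}))"
  have C: "C \<ge> 1" "\<And>m. m \<le> M \<Longrightarrow> \<bar>primes_theta m - real m\<bar> \<le> C"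
    unfolding C_def by (rule Max_ge; simp)+
  have "\<bar>primes_theta m - real m\<bar> \<le> (K + c + C) * real n / ln (real n)" if mn: "m \<le> n" "n \<ge> 3" for m n
  proof -
    have ln_n: "ln (real n) > 0" using mn by simp
    have n1: "real n / ln (real n) \<ge> 1"
      using ln_le_minus_one[of "real n"] mn ln_n by (simp add: field_simps)
    have le: "a * (real n / ln (real n)) \<le> (K + c + C) * real n / ln (real n)" if "a \<le> K + c + C" for a
      using mult_right_mono[OF that, of "real n / ln (real n)"] n1 by simp
    show ?thesis
    proof (cases "m \<le> M")
      case True
      then have "\<bar>primes_theta m - real m\<bar> \<le> C * 1" using C by simp
      also have "\<dots> \<le> C * (real n / ln (real n))" using C n1 by (intro mult_left_mono) auto
      also have "\<dots> \<le> (K + c + C) * real n / ln (real n)" by (rule le) (use K c in auto)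
      finally show ?thesis .
    next
      case False
      then have m: "m \<ge> 3" "real m \<ge> N" unfolding M_def by linarith+
      then have lm: "ln (real m) > 0" by simp
      have "\<bar>primes_psi (real m) - primes_theta m\<bar> \<le> c * (real m / ln (real m))"
        using N[OF m(2)] primes_psi_theta[of m] m lm by (simp add: abs_mult)
      moreover have "\<bar>primes_psi (real m) - real m\<bar> \<le> K * (real m / ln (real m))" using K(2)[of "real m"] m by simp
      ultimately have "\<bar>primes_theta m - real m\<bar> \<le> (K + c) * (real m / ln (real m))"
        unfolding distrib_right by linarith
      also have "\<dots> \<le> (K + c) * (real n / ln (real n))"
        using m mn K c by (intro mult_left_mono x_over_ln_mono) auto
      also have "\<dots> \<le> (K + c + C) * real n / ln (real n)" by (rule le) (use C in auto)
      finally show ?thesis .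
    qed
  qed
  then show ?thesis using that[of "K + c + C"] K c C by simp
qed

section \<open>The logarithmically weighted count of ordered prime pairs\<close>

definition prime_pairs :: "nat \<Rightarrow> (nat \<times> nat) set" where
  "prime_pairs n = {(p, q). prime p \<and> prime q \<and> p + q \<le> n}"

lemma finite_prime_pairs [simp]: "finite (prime_pairs n)"
  by (rule finite_subset[of _ "{..n} \<times> {..n}"]) (auto simp: prime_pairs_def)

lemma sum_theta_convolution:
  "(\<Sum>(p, q)\<in>prime_pairs n. ln (real p) * ln (real q)) = (\<Sum>p | prime p \<and> p \<le> n. ln (real p) * primes_theta (n - p))"
proof -
  have "prime_pairs n = (SIGMA p:{p. prime p \<and> p \<le> n}. {q. prime q \<and> q \<le> n - p})"
    by (auto simp: prime_pairs_def)
  then show ?thesis by (simp add: sum.Sigma[symmetric] primes_theta_def sum_distrib_left)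
qed

text \<open>Partial summation by double counting: n - p is the number of m with p <= m < n.\<close>

lemma sum_ln_primes_diff: "(\<Sum>p | prime p \<and> p \<le> n. ln (real p) * real (n - p)) = (\<Sum>m<n. primes_theta m)"
proof -
  have "(\<Sum>m<n. primes_theta m) = (\<Sum>m<n. \<Sum>p | prime p \<and> p \<le> n. if p \<le> m then ln (real p) else 0)"
    unfolding primes_theta_def by (intro sum.cong refl sum.mono_neutral_cong_left) auto
  also have "\<dots> = (\<Sum>p | prime p \<and> p \<le> n. \<Sum>m<n. if p \<le> m then ln (real p) else 0)" by (rule sum.swap)
  also have "\<dots> = (\<Sum>p | prime p \<and> p \<le> n. ln (real p) * real (n - p))"
  proof (intro sum.cong refl)
    fix p
    have "(\<Sum>m<n. if p \<le> m then ln (real p) else 0) = (\<Sum>m\<in>{p..<n}. ln (real p))"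
      by (rule sum.mono_neutral_cong_right) auto
    then show "(\<Sum>m<n. if p \<le> m then ln (real p) else 0) = ln (real p) * real (n - p)" by simp
  qed
  finally show ?thesis ..
qed

text \<open>In the sum of ln p * \<theta>(n - p) the inner \<theta> is first replaced by its
  argument, which turns the sum into that of \<theta>(m) over m < n; there \<theta>(m) is replaced
  by m. Each replacement costs at most a multiple of n * E, where \<open>E\<close> is the uniform
  error.\<close>

lemma weighted_pairs_asymp:
  obtains K where "K > 0"
    "\<And>n. n \<ge> 3 \<Longrightarrow> \<bar>(\<Sum>(p, q)\<in>prime_pairs n. ln (real p) * ln (real q)) - (real n)\<^sup>2 / 2\<bar> \<le> K * (real n)\<^sup>2 / ln (real n)"
proof -
  obtain K where K: "K \<ge> 1" "\<And>m n. m \<le> n \<Longrightarrow> n \<ge> 3 \<Longrightarrow> \<bar>primes_theta m - real m\<bar> \<le> K * real n / ln (real n)"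
    by (rule primes_theta_asymp) blast
  have "\<bar>(\<Sum>(p, q)\<in>prime_pairs n. ln (real p) * ln (real q)) - (real n)\<^sup>2 / 2\<bar> \<le> ((1 + K) * K + K + 1) * (real n)\<^sup>2 / ln (real n)"
    if n: "n \<ge> 3" for n
  proof -
    have ln1: "ln (real n) \<ge> 1" using n exp_le by (subst ln_ge_iff) auto
    define E where "E = K * real n / ln (real n)"
    have E0: "E \<ge> 0" using K n ln1 by (simp add: E_def)
    have E1: "E \<le> K * real n"
      using divide_left_mono[of 1 "ln (real n)" "K * real n"] K(1) ln1 by (simp add: E_def)
    have th: "primes_theta n \<le> (1 + K) * real n" using K(2)[of n n] n E1 unfolding E_def[symmetric] by (simp add: algebra_simps)
    have "\<bar>(\<Sum>(p, q)\<in>prime_pairs n. ln (real p) * ln (real q)) - (\<Sum>m<n. primes_theta m)\<bar>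
        = \<bar>\<Sum>p | prime p \<and> p \<le> n. ln (real p) * (primes_theta (n - p) - real (n - p))\<bar>"
      unfolding sum_theta_convolution sum_ln_primes_diff[symmetric] sum_subtractf[symmetric] right_diff_distrib ..
    also have "\<dots> \<le> (\<Sum>p | prime p \<and> p \<le> n. \<bar>ln (real p) * (primes_theta (n - p) - real (n - p))\<bar>)"
      by (rule sum_abs)
    also have "\<dots> \<le> (\<Sum>p | prime p \<and> p \<le> n. ln (real p) * E)"
    proof (rule sum_mono)
      fix p assume p: "p \<in> {p. prime p \<and> p \<le> n}"
      then have "ln (real p) \<ge> 0" using prime_ge_2_nat[of p] by auto
      moreover have "\<bar>primes_theta (n - p) - real (n - p)\<bar> \<le> E"
        unfolding E_def by (rule K(2)) (use n in auto)
      ultimately show "\<bar>ln (real p) * (primes_theta (n - p) - real (n - p))\<bar> \<le> ln (real p) * E"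
        by (simp add: abs_mult mult_left_mono)
    qed
    also have "\<dots> = primes_theta n * E" by (simp add: primes_theta_def sum_distrib_right)
    also have "\<dots> \<le> (1 + K) * real n * E" using th E0 by (intro mult_right_mono) auto
    finally have 1: "\<bar>(\<Sum>(p, q)\<in>prime_pairs n. ln (real p) * ln (real q)) - (\<Sum>m<n. primes_theta m)\<bar> \<le> (1 + K) * real n * E" .
    have "\<bar>(\<Sum>m<n. primes_theta m) - (\<Sum>m<n. real m)\<bar> = \<bar>\<Sum>m<n. primes_theta m - real m\<bar>" by (simp add: sum_subtractf)
    also have "\<dots> \<le> (\<Sum>m<n. \<bar>primes_theta m - real m\<bar>)" by (rule sum_abs)
    also have "\<dots> \<le> (\<Sum>m<n. E)" unfolding E_def by (intro sum_mono K(2)) (use n in auto)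
    finally have 2: "\<bar>(\<Sum>m<n. primes_theta m) - (\<Sum>m<n. real m)\<bar> \<le> real n * E" by simp
    have "(\<Sum>m<n. real m) = (real n)\<^sup>2 / 2 - real n / 2"
      by (induction n) (auto simp: power2_eq_square field_simps)
    moreover have "real n / 2 \<le> (real n)\<^sup>2 / ln (real n)"
    proof -
      have "real n / 2 * ln (real n) \<le> real n * real n"
        using ln_le_minus_one[of "real n"] n ln1 by (intro mult_mono) auto
      then show ?thesis using ln1 by (simp add: field_simps power2_eq_square)
    qed
    ultimately have 3: "\<bar>(\<Sum>m<n. real m) - (real n)\<^sup>2 / 2\<bar> \<le> (real n)\<^sup>2 / ln (real n)" by simp
    have "((1 + K) * K + K + 1) * (real n)\<^sup>2 / ln (real n) = (1 + K) * real n * E + real n * E + (real n)\<^sup>2 / ln (real n)"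
      by (simp add: E_def power2_eq_square add_divide_distrib algebra_simps)
    then show ?thesis using 1 2 3 by linarith
  qed
  then show ?thesis using that[of "(1 + K) * K + K + 1"] K by (simp add: add_pos_pos)
qed

text \<open>Primes above sqrt n weigh at least ln n / 2 each in \<theta>(n) = O(n), and the others
  number at most sqrt n <= 2 n / ln n.\<close>

lemma card_primes_le_bound:
  obtains K where "K > 0" "\<And>n. n \<ge> 3 \<Longrightarrow> real (card {p. prime p \<and> p \<le> n}) \<le> K * real n / ln (real n)"
proof -
  obtain K where K: "K \<ge> 1" "\<And>m n. m \<le> n \<Longrightarrow> n \<ge> 3 \<Longrightarrow> \<bar>primes_theta m - real m\<bar> \<le> K * real n / ln (real n)"
    by (rule primes_theta_asymp) blast
  have "real (card {p. prime p \<and> p \<le> n}) \<le> (2 + 2 * (1 + K)) * real n / ln (real n)" if n: "n \<ge> 3" for n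
  proof -
    have ln1: "ln (real n) \<ge> 1" using n exp_le by (subst ln_ge_iff) auto
    have th: "primes_theta n \<le> (1 + K) * real n"
    proof -
      have "K * real n / ln (real n) \<le> K * real n"
        using divide_left_mono[of 1 "ln (real n)" "K * real n"] K(1) ln1 by simp
      then show ?thesis using K(2)[of n n] n by (simp add: algebra_simps)
    qed
    let ?P = "{p. prime p \<and> p \<le> n}" and ?s = "sqrt (real n)"
    have "?P \<subseteq> {1..nat \<lfloor>?s\<rfloor>} \<union> {p\<in>?P. ?s < real p}"
    proof
      fix p assume "p \<in> ?P"
      then show "p \<in> {1..nat \<lfloor>?s\<rfloor>} \<union> {p\<in>?P. ?s < real p}"
        using prime_ge_1_nat[of p] le_nat_floor[of p ?s] by (cases "real p \<le> ?s") auto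
    qed
    then have "card ?P \<le> card ({1..nat \<lfloor>?s\<rfloor>} \<union> {p\<in>?P. ?s < real p})" by (intro card_mono) auto
    also have "\<dots> \<le> nat \<lfloor>?s\<rfloor> + card {p\<in>?P. ?s < real p}" by (rule order_trans[OF card_Un_le]) simp
    finally have "real (card ?P) \<le> real (nat \<lfloor>?s\<rfloor>) + real (card {p\<in>?P. ?s < real p})"
      by (simp only: of_nat_add[symmetric] of_nat_le_iff)
    moreover have "real (nat \<lfloor>?s\<rfloor>) \<le> ?s" by (rule of_nat_floor) simp
    ultimately have 1: "real (card ?P) \<le> ?s + real (card {p\<in>?P. ?s < real p})" by linarith
    have "real (card {p\<in>?P. ?s < real p}) * (ln (real n) / 2) = (\<Sum>p\<in>{p\<in>?P. ?s < real p}. ln (real n) / 2)" by simp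
    also have "\<dots> \<le> (\<Sum>p\<in>{p\<in>?P. ?s < real p}. ln (real p))"
    proof (rule sum_mono)
      fix p assume "p \<in> {p\<in>?P. ?s < real p}"
      then have "ln ?s \<le> ln (real p)" using n by (subst ln_le_cancel_iff) (auto dest: prime_gt_0_nat)
      then show "ln (real n) / 2 \<le> ln (real p)" using n by (simp add: ln_sqrt)
    qed
    also have "\<dots> \<le> primes_theta n" unfolding primes_theta_def by (intro sum_mono2) (auto dest: prime_gt_0_nat)
    also note th
    finally have 2: "real (card {p\<in>?P. ?s < real p}) \<le> 2 * (1 + K) * real n / ln (real n)" using ln1 by (simp add: field_simps)
    have "ln ?s \<le> ?s - 1" using n by (intro ln_le_minus_one) auto
    then have "ln (real n) \<le> 2 * ?s" using n by (simp add: ln_sqrt)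
    then have "?s * ln (real n) \<le> ?s * (2 * ?s)" by (intro mult_left_mono) auto
    also have "?s * (2 * ?s) = 2 * real n" by simp
    finally have "?s * ln (real n) \<le> 2 * real n" .
    then have "?s \<le> 2 * real n / ln (real n)" using ln1 by (simp add: field_simps)
    moreover have "(2 + 2 * (1 + K)) * real n / ln (real n) = 2 * real n / ln (real n) + 2 * (1 + K) * real n / ln (real n)"
      by (simp only: distrib_right add_divide_distrib)
    ultimately show ?thesis using 1 2 by linarith
  qed
  then show ?thesis using that[of "2 + 2 * (1 + K)"] K by simp
qed


section \<open>From ordered pairs to the Goldbach sum\<close>

lemma card_prime_pairs_swap: "card {(p, q)\<in>prime_pairs n. P q p} = card {(p, q)\<in>prime_pairs n. P p q}"
proof -
  have "{(p, q)\<in>prime_pairs n. P q p} = (\<lambda>(p, q). (q, p)) ` {(p, q)\<in>prime_pairs n. P p q}"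
    by (auto simp: prime_pairs_def image_iff)
  then show ?thesis by (simp add: card_image inj_on_def)
qed

text \<open>Among pairs with p <= q, an odd sum forces p = 2, leaving at most n choices of q;
  passing from p <= q to all ordered pairs counts the diagonal twice, again at most n pairs.\<close>

lemma sum_goldbach_g:
  "\<bar>real (\<Sum>i=1..n div 2. goldbach_g (2 * i)) - real (card (prime_pairs n)) / 2\<bar> \<le> 2 * real n"
proof -
  let ?L = "{(p, q)\<in>prime_pairs n. p \<le> q}"
  let ?E = "{(p, q)\<in>prime_pairs n. p \<le> q \<and> even (p + q)}"
  let ?O = "{(p, q)\<in>prime_pairs n. p \<le> q \<and> odd (p + q)}"
  let ?D = "{(p, q)\<in>prime_pairs n. p = q}"
  have "(\<Sum>i=1..n div 2. goldbach_g (2 * i)) = card (\<Union>i\<in>{1..n div 2}. {(p, q). prime p \<and> prime q \<and> p \<le> q \<and> p + q = 2 * i})"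
    unfolding goldbach_g_def
  proof (subst card_UN_disjoint)
    show "\<forall>i\<in>{1..n div 2}. finite {(p, q). prime p \<and> prime q \<and> p \<le> q \<and> p + q = 2 * i}"
      by (intro ballI, rule finite_subset[of _ "{..n} \<times> {..n}"]) auto
  qed auto
  also have "(\<Union>i\<in>{1..n div 2}. {(p, q). prime p \<and> prime q \<and> p \<le> q \<and> p + q = 2 * i}) = ?E"
  proof (intro set_eqI iffI)
    fix z assume "z \<in> ?E"
    then obtain p q where z: "z = (p, q)" "prime p" "prime q" "p \<le> q" "even (p + q)" "p + q \<le> n"
      by (auto simp: prime_pairs_def)
    from z(5) obtain i where "p + q = 2 * i" by (elim evenE)
    moreover have "p > 0" using z(2) by (rule prime_gt_0_nat)
    ultimately have "i \<in> {1..n div 2}" using z by auto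
    then show "z \<in> (\<Union>i\<in>{1..n div 2}. {(p, q). prime p \<and> prime q \<and> p \<le> q \<and> p + q = 2 * i})"
      using z \<open>p + q = 2 * i\<close> by auto
  qed (auto simp: prime_pairs_def, presburger+)
  finally have sum_E: "(\<Sum>i=1..n div 2. goldbach_g (2 * i)) = card ?E" .
  have fin: "finite {(p, q)\<in>prime_pairs n. P p q}" for P
    by (rule finite_subset[OF _ finite_prime_pairs[of n]]) auto
  have "?L = ?E \<union> ?O" "?E \<inter> ?O = {}" by auto
  then have L: "card ?L = card ?E + card ?O" by (simp add: card_Un_disjoint fin)
  have O: "card ?O \<le> n"
  proof -
    have "?O \<subseteq> (\<lambda>q. (2, q)) ` {1..n}"
    proof
      fix z assume "z \<in> ?O"
      then obtain p q where z: "z = (p, q)" "prime p" "prime q" "p \<le> q" "odd (p + q)" "p + q \<le> n"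
        by (auto simp: prime_pairs_def)
      have "p = 2"
      proof (rule ccontr)
        assume "p \<noteq> 2"
        then have "p > 2" "q > 2" using z prime_ge_2_nat[of p] by auto
        then show False using z(2,3,5) prime_odd_nat by auto
      qed
      then show "z \<in> (\<lambda>q. (2, q)) ` {1..n}" using z prime_gt_0_nat[of q] by auto
    qed
    from surj_card_le[OF _ this] show ?thesis by simp
  qed
  have D: "card ?D \<le> n"
  proof -
    have "?D \<subseteq> (\<lambda>q. (q, q)) ` {1..n}" by (auto simp: prime_pairs_def dest: prime_gt_0_nat)
    from surj_card_le[OF _ this] show ?thesis by simp
  qed
  have "prime_pairs n = ?L \<union> {(p, q)\<in>prime_pairs n. q \<le> p}" "?L \<inter> {(p, q)\<in>prime_pairs n. q \<le> p} = ?D" by auto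
  then have "card (prime_pairs n) + card ?D = card ?L + card {(p, q)\<in>prime_pairs n. q \<le> p}"
    using card_Un_Int[of ?L "{(p, q)\<in>prime_pairs n. q \<le> p}"] fin by simp
  also have "card {(p, q)\<in>prime_pairs n. q \<le> p} = card ?L" by (rule card_prime_pairs_swap)
  finally have "card (prime_pairs n) + card ?D = 2 * (card ?E + card ?O)" unfolding L by simp
  then have "real (card (prime_pairs n) + card ?D) = real (2 * (card ?E + card ?O))" by (rule arg_cong)
  then have "real (card (prime_pairs n)) + real (card ?D) = 2 * (real (card ?E) + real (card ?O))"
    by (simp only: of_nat_add of_nat_mult of_nat_numeral)
  moreover have "real (card ?O) \<le> real n" "real (card ?D) \<le> real n" using O D by simp_all
  ultimately show ?thesis unfolding sum_E by (simp add: abs_le_iff)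
qed

text \<open>Pairs with a component below \<open>n / ln\<^sup>2 n\<close> are negligible; for the others both logarithms
  are \<open>ln n + O(ln ln n)\<close>, which is the source of the factor \<open>ln ln n\<close> in the error term.\<close>

lemma card_prime_pairs_bounds:
  assumes n: "n \<ge> 3" and l: "L = ln (real n)" and y: "Y = real n / L\<^sup>2" "Y > 1"
  shows "(\<Sum>(p, q)\<in>prime_pairs n. ln (real p) * ln (real q)) \<le> real (card (prime_pairs n)) * L\<^sup>2"
    and "real (card (prime_pairs n)) \<le> (\<Sum>(p, q)\<in>prime_pairs n. ln (real p) * ln (real q)) / (ln Y)\<^sup>2
      + 2 * Y * real (card {p. prime p \<and> p \<le> n})"
proof -
  let ?D = "\<Sum>(p, q)\<in>prime_pairs n. ln (real p) * ln (real q)"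
  have pos: "1 \<le> real p" "1 \<le> real q" "real p \<le> real n" "real q \<le> real n" if "(p, q) \<in> prime_pairs n" for p q
    using that prime_ge_1_nat[of p] prime_ge_1_nat[of q] by (auto simp: prime_pairs_def)
  have "?D \<le> (\<Sum>(p, q)\<in>prime_pairs n. L * L)"
  proof (rule sum_mono)
    fix z assume z: "z \<in> prime_pairs n"
    obtain p q where pq: "z = (p, q)" by (cases z)
    have "ln (real p) * ln (real q) \<le> L * L"
      unfolding l using pos[OF z[unfolded pq]] by (intro mult_mono) auto
    then show "(case z of (p, q) \<Rightarrow> ln (real p) * ln (real q)) \<le> (case z of (p, q) \<Rightarrow> L * L)" by (simp add: pq)
  qed
  also have "\<dots> = real (card (prime_pairs n)) * L\<^sup>2" by (simp add: case_prod_unfold power2_eq_square)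
  finally show "?D \<le> real (card (prime_pairs n)) * L\<^sup>2" .
  let ?P = "{p. prime p \<and> p \<le> n}"
  let ?S = "{(p, q)\<in>prime_pairs n. real p \<le> Y}" and ?S' = "{(p, q)\<in>prime_pairs n. real q \<le> Y}"
  let ?B = "{(p, q)\<in>prime_pairs n. Y < real p \<and> Y < real q}"
  have fin: "finite {(p, q)\<in>prime_pairs n. P p q}" for P
    by (rule finite_subset[OF _ finite_prime_pairs[of n]]) auto
  have "?S \<subseteq> {1..nat \<lfloor>Y\<rfloor>} \<times> ?P"
    by (auto simp: prime_pairs_def le_nat_floor dest: prime_gt_0_nat)
  then have "card ?S \<le> card ({1..nat \<lfloor>Y\<rfloor>} \<times> ?P)" by (intro card_mono) auto
  then have "real (card ?S) \<le> real (nat \<lfloor>Y\<rfloor>) * real (card ?P)" by (simp flip: of_nat_mult)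
  also have "\<dots> \<le> Y * real (card ?P)" using y by (intro mult_right_mono of_nat_floor) auto
  finally have S: "real (card ?S) \<le> Y * real (card ?P)" .
  have S': "card ?S' = card ?S" using card_prime_pairs_swap[of n "\<lambda>p q. real p \<le> Y"] .
  have "prime_pairs n = ?B \<union> (?S \<union> ?S')" by auto
  then have "card (prime_pairs n) \<le> card ?B + (card ?S + card ?S')"
    by (metis (no_types, lifting) add_left_mono card_Un_le order_trans)
  then have N: "real (card (prime_pairs n)) \<le> real (card ?B) + 2 * Y * real (card ?P)" using S S' by simp
  have "real (card ?B) * (ln Y)\<^sup>2 = (\<Sum>z\<in>?B. (ln Y)\<^sup>2)" by simp
  also have "\<dots> \<le> (\<Sum>(p, q)\<in>?B. ln (real p) * ln (real q))"
  proof (rule sum_mono)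
    fix z assume "z \<in> ?B"
    then obtain p q where pq: "z = (p, q)" "Y < real p" "Y < real q" by auto
    have "ln Y * ln Y \<le> ln (real p) * ln (real q)" using pq y by (intro mult_mono) auto
    then show "(ln Y)\<^sup>2 \<le> (case z of (p, q) \<Rightarrow> ln (real p) * ln (real q))" by (simp add: pq power2_eq_square)
  qed
  also have "\<dots> \<le> ?D"
    by (rule sum_mono2) (use pos in auto)
  finally have "real (card ?B) * (ln Y)\<^sup>2 \<le> ?D" .
  moreover have "(ln Y)\<^sup>2 > 0" using y(2) by simp
  ultimately have "real (card ?B) \<le> ?D / (ln Y)\<^sup>2" by (simp only: pos_le_divide_eq)
  with N show "real (card (prime_pairs n)) \<le> ?D / (ln Y)\<^sup>2 + 2 * Y * real (card ?P)" by linarith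
qed

text \<open>The number of pairs lies between D / L^2 and D / (L - 2 l)^2 plus a negligible term,
  where L = ln n and l = ln L. All errors are compared with X l, where X = n^2 / L^3.\<close>

lemma goldbach_bound:
  obtains K where
    "eventually (\<lambda>n. \<bar>real (\<Sum>i=1..n div 2. goldbach_g (2 * i)) - (real n)\<^sup>2 / (4 * (ln (real n))\<^sup>2)\<bar>
      \<le> K * ((real n)\<^sup>2 * ln (ln (real n)) / ln (real n) ^ 3)) sequentially"
proof -
  obtain K1 where K1: "K1 > 0"
    "\<And>n. n \<ge> 3 \<Longrightarrow> \<bar>(\<Sum>(p, q)\<in>prime_pairs n. ln (real p) * ln (real q)) - (real n)\<^sup>2 / 2\<bar> \<le> K1 * (real n)\<^sup>2 / ln (real n)"
    by (rule weighted_pairs_asymp) blast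
  obtain K2 where K2: "K2 > 0" "\<And>n. n \<ge> 3 \<Longrightarrow> real (card {p. prime p \<and> p \<le> n}) \<le> K2 * real n / ln (real n)"
    by (rule card_primes_le_bound) blast
  \<comment> \<open>In this order: X <= X l; L - 2 l >= L/2; the cut-off \<open>Y\<close> exceeds 1;
    and n <= X, which absorbs the linear error of \<open>sum_goldbach_g\<close>.\<close>
  have ev: "eventually (\<lambda>n::nat. 1 \<le> ln (ln (real n))) sequentially"
    "eventually (\<lambda>n::nat. 4 * ln (ln (real n)) \<le> ln (real n)) sequentially"
    "eventually (\<lambda>n::nat. 1 < real n / (ln (real n))\<^sup>2) sequentially"
    "eventually (\<lambda>n::nat. ln (real n) ^ 3 \<le> real n) sequentially"
    by real_asymp+
  \<comment> \<open>Origin of the constant: 2 from the passage to ordered pairs, K1 from the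
    weighted sum, and K2 + 8 (1 + K1) as half of 2 K2 + 16 (1 + K1) from small primes and from
    removing the weights.\<close>
  have "eventually (\<lambda>n. \<bar>real (\<Sum>i=1..n div 2. goldbach_g (2 * i)) - (real n)\<^sup>2 / (4 * (ln (real n))\<^sup>2)\<bar>
      \<le> (2 + K1 + K2 + 8 * (1 + K1)) * ((real n)\<^sup>2 * ln (ln (real n)) / ln (real n) ^ 3)) sequentially"
    using ev eventually_ge_at_top[of "3::nat"]
  proof eventually_elim
    case (elim n)
    define L where "L = ln (real n)"
    define l where "l = ln L"
    define Y where "Y = real n / L\<^sup>2"
    define D where "D = (\<Sum>(p, q)\<in>prime_pairs n. ln (real p) * ln (real q))"
    define N where "N = real (card (prime_pairs n))"
    define X where "X = (real n)\<^sup>2 / L ^ 3"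
    have L: "L \<ge> 1" using \<open>3 \<le> n\<close> exp_le unfolding L_def by (subst ln_ge_iff) auto
    have l: "1 \<le> l" "4 * l \<le> L" "L ^ 3 \<le> real n" "1 < Y" using elim by (simp_all add: l_def L_def Y_def)
    have n: "real n > 0" using \<open>3 \<le> n\<close> by simp
    have X0: "X > 0" using L n by (simp add: X_def)
    have X1: "X \<le> X * l" using X0 l by simp
    have lnY: "ln Y = L - 2 * l" using L n unfolding Y_def l_def by (simp add: ln_div ln_realpow L_def)
    have D1: "\<bar>D - (real n)\<^sup>2 / 2\<bar> \<le> K1 * (real n)\<^sup>2 / L" using K1(2)[OF \<open>3 \<le> n\<close>] by (simp add: D_def L_def)
    have Db: "D / L\<^sup>2 \<le> (real n)\<^sup>2 / (2 * L\<^sup>2) + K1 * X" "D / L\<^sup>2 \<ge> (real n)\<^sup>2 / (2 * L\<^sup>2) - K1 * X"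
    proof -
      have "D \<le> (real n)\<^sup>2 / 2 + K1 * (real n)\<^sup>2 / L" using D1 by linarith
      from divide_right_mono[OF this, of "L\<^sup>2"] show "D / L\<^sup>2 \<le> (real n)\<^sup>2 / (2 * L\<^sup>2) + K1 * X"
        by (simp add: X_def add_divide_distrib eval_nat_numeral)
      have "(real n)\<^sup>2 / 2 - K1 * (real n)\<^sup>2 / L \<le> D" using D1 by linarith
      from divide_right_mono[OF this, of "L\<^sup>2"] show "D / L\<^sup>2 \<ge> (real n)\<^sup>2 / (2 * L\<^sup>2) - K1 * X"
        by (simp add: X_def diff_divide_distrib eval_nat_numeral)
    qed
    have D0: "D \<ge> 0" unfolding D_def
    proof (rule sum_nonneg)
      fix z assume "z \<in> prime_pairs n"
      then show "0 \<le> (case z of (p, q) \<Rightarrow> ln (real p) * ln (real q))"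
        using prime_ge_1_nat by (auto simp: prime_pairs_def)
    qed
    have D2: "D \<le> (1 + K1) * (real n)\<^sup>2"
    proof -
      have "K1 * (real n)\<^sup>2 / L \<le> K1 * (real n)\<^sup>2"
        using divide_left_mono[of 1 L "K1 * (real n)\<^sup>2"] K1(1) L by simp
      moreover have "(real n)\<^sup>2 / 2 \<le> (real n)\<^sup>2" by simp
      moreover have "(1 + K1) * (real n)\<^sup>2 = (real n)\<^sup>2 + K1 * (real n)\<^sup>2" by (simp add: algebra_simps)
      ultimately show ?thesis using D1 by linarith
    qed
    note N1 = card_prime_pairs_bounds[OF \<open>3 \<le> n\<close> L_def Y_def l(4), folded D_def N_def]
    have lowN: "D / L\<^sup>2 \<le> N" using N1(1) L by (simp add: divide_le_eq)
    have upN: "N \<le> D / L\<^sup>2 + (16 * (1 + K1) + 2 * K2) * (X * l)"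
    proof -
      have p1: "2 * Y * real (card {p. prime p \<and> p \<le> n}) \<le> 2 * K2 * X"
      proof -
        have "2 * Y * real (card {p. prime p \<and> p \<le> n}) \<le> 2 * Y * (K2 * real n / L)"
          using K2(2)[OF \<open>3 \<le> n\<close>] l(4) unfolding L_def[symmetric] by (intro mult_left_mono) auto
        also have "\<dots> = 2 * K2 * X" by (simp add: Y_def X_def power2_eq_square power3_eq_cube mult_ac)
        finally show ?thesis .
      qed
      have Lh: "L / 2 \<le> L - 2 * l" using l by simp
      \<comment> \<open>The price of replacing ln Y = L - 2 l by L; the factor l here is the ln ln n
        of the final error.\<close>
      have "1 / (L - 2 * l)\<^sup>2 - 1 / L\<^sup>2 = (4 * L * l - 4 * l\<^sup>2) / (L\<^sup>2 * (L - 2 * l)\<^sup>2)"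
        using L Lh by (simp add: divide_simps) (simp add: power2_eq_square algebra_simps)
      also have "\<dots> \<le> (4 * L * l) / (L\<^sup>2 * (L / 2)\<^sup>2)"
        using L l Lh by (intro frac_le mult_left_mono power_mono) auto
      also have "\<dots> = 16 * l / L ^ 3" using L by (simp add: eval_nat_numeral)
      finally have "D * (1 / (L - 2 * l)\<^sup>2 - 1 / L\<^sup>2) \<le> D * (16 * l / L ^ 3)"
        using D0 by (rule mult_left_mono)
      also have "\<dots> \<le> ((1 + K1) * (real n)\<^sup>2) * (16 * l / L ^ 3)"
        using D2 L l by (intro mult_right_mono) auto
      also have "\<dots> = 16 * (1 + K1) * (X * l)" by (simp add: X_def)
      finally have "D / (L - 2 * l)\<^sup>2 \<le> D / L\<^sup>2 + 16 * (1 + K1) * (X * l)" by (simp add: right_diff_distrib)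
      moreover have "2 * K2 * X \<le> 2 * K2 * (X * l)" using X1 K2(1) by simp
      ultimately show ?thesis using N1(2) p1 unfolding lnY by (simp add: algebra_simps)
    qed
    have "real n \<le> X"
    proof -
      have "real n * L ^ 3 \<le> real n * real n" using l n by (intro mult_left_mono) auto
      then show ?thesis using L by (simp add: X_def field_simps power2_eq_square)
    qed
    have nn: "0 \<le> K1 * X" "0 \<le> K2 * (X * l)" "0 \<le> (1 + K1) * (X * l)" "K1 * X \<le> K1 * (X * l)" using K1 K2 X0 X1 l by auto
    have "real n \<le> X * l" using \<open>real n \<le> X\<close> X1 by linarith
    define G where "G = real (\<Sum>i=1..n div 2. goldbach_g (2 * i))"
    have G: "G - N / 2 \<le> 2 * real n" "N / 2 - G \<le> 2 * real n"
      using sum_goldbach_g[of n] unfolding G_def[symmetric] N_def[symmetric] by linarith+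
    define Q where "Q = (real n)\<^sup>2 / (2 * L\<^sup>2)"
    have half: "(real n)\<^sup>2 / (4 * L\<^sup>2) = Q / 2" by (simp add: Q_def)
    define V where "V = D / L\<^sup>2"
    have fin: "(2 + K1 + K2 + 8 * (1 + K1)) * ((real n)\<^sup>2 * l / L ^ 3) = 2 * (X * l) + K1 * (X * l) + K2 * (X * l) + 8 * ((1 + K1) * (X * l))"
    proof -
      have "(real n)\<^sup>2 * l / L ^ 3 = X * l" by (simp add: X_def)
      then show ?thesis by (simp only:) (simp add: algebra_simps)
    qed
    have dist: "(16 * (1 + K1) + 2 * K2) * (X * l) = 16 * ((1 + K1) * (X * l)) + 2 * (K2 * (X * l))"
      by (simp add: algebra_simps)
    have "\<bar>G - (real n)\<^sup>2 / (4 * L\<^sup>2)\<bar> \<le> (2 + K1 + K2 + 8 * (1 + K1)) * ((real n)\<^sup>2 * l / L ^ 3)"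
      using G upN[unfolded dist] lowN Db nn \<open>real n \<le> X * l\<close>
      unfolding half fin abs_le_iff Q_def[symmetric] V_def[symmetric] by (intro conjI) linarith+
    then show ?case by (simp add: G_def L_def l_def)
  qed
  then show ?thesis using that by blast
qed

theorem theorem2:
  shows "(\<lambda>x::nat. real (\<Sum>i=1..x div 2. goldbach_g (2 * i))
            - (real x)\<^sup>2 / (4 * (ln (real x))\<^sup>2))
         \<in> O[inf at_top (principal {x. even x})](\<lambda>x::nat. (real x)\<^sup>2 * ln (ln (real x)) / (ln (real x)) ^ 3)"
proof -
  obtain K where K: "eventually (\<lambda>n. \<bar>real (\<Sum>i=1..n div 2. goldbach_g (2 * i)) - (real n)\<^sup>2 / (4 * (ln (real n))\<^sup>2)\<bar>
      \<le> K * ((real n)\<^sup>2 * ln (ln (real n)) / ln (real n) ^ 3)) sequentially"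
    by (rule goldbach_bound) blast
  then have "eventually (\<lambda>n. norm (real (\<Sum>i=1..n div 2. goldbach_g (2 * i)) - (real n)\<^sup>2 / (4 * (ln (real n))\<^sup>2))
      \<le> \<bar>K\<bar> * norm ((real n)\<^sup>2 * ln (ln (real n)) / ln (real n) ^ 3)) sequentially"
  proof eventually_elim
    case (elim n)
    define z where "z = (real n)\<^sup>2 * ln (ln (real n)) / ln (real n) ^ 3"
    have "K * z \<le> \<bar>K\<bar> * \<bar>z\<bar>"
      \<comment> \<open>The sign of \<open>K\<close> is left open by \<open>goldbach_bound\<close>,
        hence the passage to |K|.\<close>
      using abs_ge_self[of "K * z"] by (simp only: abs_mult)
    with elim show ?case by (simp add: z_def)
  qed
  then show ?thesis
    \<comment> \<open>An estimate eventually true along all naturals passes to the finer filter of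
      even numbers.\<close>
    by (intro bigoI[where c = "\<bar>K\<bar>"]) (erule filter_leD[OF inf_le1])
qed

end
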